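(* Let $2p\in\{2,4,6\}$ and let $U$ be the smooth solution of the half-line wave equation with Dirichlet boundary condition $$U_{tt}=U_{xx}+F,\quad x\in[0,\infty),\ t\ge 0,\qquad U(x,0)=f^1(x),\ U_t(x,0)=f^2(x),\qquad U(0,t)=g(t),\qquad \|U(\cdot,t)\|_{L_2}<\infty,$$ where $F,f^1,f^2,g$ are compatible smooth functions with compact support. Let $u(t)=[u_0(t),u_1(t),\dots]^T$ be the solution of the SBP-SAT semi-discretization of order $2p$ with mesh size $h$ and penalty parameter $\tau$ (independent of $h$), $$u_{tt}=Du-H^{-1}S^Te_0\,(e_0^Tu-g)-\frac{\tau}{h}H^{-1}e_0\,(e_0^Tu-g)+F_g,\qquad u_j(0)=f^1(x_j),\ (u_j)_t(0)=f^2(x_j),$$ with the operators $D,H,S$ given in the context, and suppose the scheme is stable, i.e. $\tau\ge\tau_{2p}:=1/\alpha_{2p}$. Let $\xi_j(t)=U(x_j,t)-u_j(t)$ be the pointwise error. Then for every final time $t_f$ and all sufficiently small $h$, $$\sqrt{\int_0^{t_f}\|\xi(\cdot,t)\|_h^2\,dt}\le C h^q,$$ where $C$ is independent of $h$ and depends only on a fixed constant $\eta>0$, the final time $t_f$ and the derivatives of $U$ (for the given $2p$ and $\tau$), and the rate $q$ is: - $2p=2$: $q=2$ if $\tau>\tau_2$, and $q=1.5$ if $\tau=\tau_2$; - $2p=4$: $q=4$ if $\tau>\tau_4$, and $q=2.5$ if $\tau=\tau_4$; - $2p=6$: $q=5$ if $\tau>\tau_6$, and $q=3.5$ if $\ta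u=\tau_6$.
   Context: Grid: $x_j=jh$, $j=0,1,2,\dots$; $u_j(t)\approx U(x_j,t)$; $F_g$ is the grid function of $F$, $(F_g)_j=F(x_j,t)$. $e_0=[1,0,0,\dots]^T$, $E_0=e_0e_0^T$. Discrete norm: $\|v\|_h^2=h\sum_{j\ge0}|v_j|^2$; the error is required to satisfy $\|\xi\|_h<\infty$. SBP operators: $D\approx\partial^2/\partial x^2$ is the diagonal-norm summation-by-parts operator of order $2p$ (truncation error $\mathcal O(h^{2p})$ in the interior and $\mathcal O(h^p)$ at a fixed number of points near the boundary). It has the form $D=H^{-1}(-A+BS)$, with $H$ diagonal positive definite, $A$ symmetric positive semi-definite, $B=\mathrm{diag}(-1,0,0,\dots)$, and the first row of $S$ a one-sided approximation of the first derivative at $x=0$ of order $p+1$ (only the first row of $S$ enters the scheme). Rows and columns are numbered from $0$; unlisted entries of a listed row are zero. With $D_+v_j=(v_{j+1}-v_j)/h$, $D_-v_j=(v_j-v_{j-1})/h$: $2p=2$: $H=h\,\mathrm{diag}(\tfrac12,1,1,\dots)$; first row of $S$: $\frac1h(-\tfrac32,2,-\tfrac12)$; row $0$ of $h^2D$: $(1,-2,1)$; $(Dv)_j=D_+D_-v_j$ for $j\ge1$. $2p=4$: $H=h\,\mathrm{diag}(\tfrac{17}{48},\tfrac{59}{48},\tfrac{43}{48},\tfrac{49}{48},1,1,\dots)$; first row of $S$: $\frac1h(-\tfrac{11}{6},3,-\tfrac32,\tfrac13)$; rows $0$–$3$ of $h^2D$: $(2,-5,4,-1)$; $(1,-2,1)$;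 $(-\tfrac4{43},\tfrac{59}{43},-\tfrac{110}{43},\tfrac{59}{43},-\tfrac4{43})$; $(-\tfrac1{49},0,\tfrac{59}{49},-\tfrac{118}{49},\tfrac{64}{49},-\tfrac4{49})$; $(Dv)_j=(D_+D_--\tfrac{h^2}{12}(D_+D_-)^2)v_j$ for $j\ge4$. $2p=6$: $H=h\,\mathrm{diag}(\tfrac{13649}{43200},\tfrac{12013}{8640},\tfrac{2711}{4320},\tfrac{5359}{4320},\tfrac{7877}{8640},\tfrac{43801}{43200},1,1,\dots)$; first row of $S$: $\frac1h(-\tfrac{25}{12},4,-3,\tfrac43,-\tfrac14)$; rows $0$–$5$ of $h^2D$: row 0: $(\tfrac{114170}{40947},-\tfrac{438107}{54596},\tfrac{336409}{40947},-\tfrac{276997}{81894},\tfrac{3747}{13649},\tfrac{21035}{163788})$; row 1: $(\tfrac{6173}{5860},-\tfrac{2066}{879},\tfrac{3283}{1758},-\tfrac{303}{293},\tfrac{2111}{3516},-\tfrac{601}{4395})$; row 2: $(-\tfrac{52391}{81330},\tfrac{134603}{32532},-\tfrac{21982}{2711},\tfrac{112915}{16266},-\tfrac{46969}{16266},\tfrac{30409}{54220})$; row 3: $(\tfrac{68603}{321540},-\tfrac{12423}{10718},\tfrac{112915}{32154},-\tfrac{75934}{16077},\tfrac{53369}{21436},-\tfrac{54899}{160770},\tfrac{48}{5359})$; row 4: $(-\tfrac{7053}{39385},\tfrac{86551}{94524},-\tfrac{46969}{23631},\tfrac{53369}{15754},-\tfrac{87904}{23631},\tfrac{820271}{472620},-\tfrac{1296}{7877},\tfrac{96}{7877})$;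 row 5: $(\tfrac{21035}{525612},-\tfrac{24641}{131403},\tfrac{30409}{87602},-\tfrac{54899}{131403},\tfrac{820271}{525612},-\tfrac{117600}{43801},\tfrac{64800}{43801},-\tfrac{6480}{43801},\tfrac{480}{43801})$; $(Dv)_j=(D_+D_--\tfrac{h^2}{12}(D_+D_-)^2+\tfrac{h^4}{90}(D_+D_-)^3)v_j$ for $j\ge6$. Constants $\alpha_{2p}$: $\alpha_{2p}>0$ is the largest number such that $A-h\alpha_{2p}(E_0S)^T(E_0S)$ is symmetric positive semi-definite; $\alpha_2=0.4$, $\alpha_4\approx0.2508560249$, $\alpha_6\approx0.1878715026$. The scheme satisfies a discrete energy estimate when $\tau\ge1/\alpha_{2p}$. *)

theory Defs
  imports "HOL-Analysis.Analysis" "HOL-Library.More_List"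
begin

section \<open>Smooth functions on the half line and on the quadrant\<close>

text \<open>Derivatives on the domains \<open>x \<ge> 0, t \<ge> 0\<close> are one-sided at the boundary.\<close>

definition hderiv :: "(real \<Rightarrow> real) \<Rightarrow> real \<Rightarrow> real" where
  "hderiv f x = vector_derivative f (at x within {0..})"

definition smooth_half :: "(real \<Rightarrow> real) \<Rightarrow> bool" where
  "smooth_half f \<longleftrightarrow>
     (\<forall>k. \<forall>x\<ge>0. ((hderiv ^^ k) f has_real_derivative (hderiv ^^ Suc k) f x) (at x within {0..}))"

definition dx :: "(real \<Rightarrow> real \<Rightarrow> real) \<Rightarrow> real \<Rightarrow> real \<Rightarrow> real" where
  "dx U x t = hderiv (\<lambda>y. U y t) x"

definition dt :: "(real \<Rightarrow> real \<Rightarrow> real) \<Rightarrow> real \<Rightarrow> real \<Rightarrow> real" where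
  "dt U x t = hderiv (\<lambda>s. U x s) t"

definition partial :: "nat \<Rightarrow> nat \<Rightarrow> (real \<Rightarrow> real \<Rightarrow> real) \<Rightarrow> real \<Rightarrow> real \<Rightarrow> real" where
  "partial i j U = (dx ^^ i) ((dt ^^ j) U)"

text \<open>Smoothness up to the boundary: all mixed partial derivatives exist, commute and are
  jointly continuous.\<close>

definition smooth_quadrant :: "(real \<Rightarrow> real \<Rightarrow> real) \<Rightarrow> bool" where
  "smooth_quadrant U \<longleftrightarrow>
     (\<forall>i j. continuous_on ({0..} \<times> {0..}) (\<lambda>(x, t). partial i j U x t) \<and>
       (\<forall>x\<ge>0. \<forall>t\<ge>0.
          ((\<lambda>y. partial i j U y t) has_real_derivative partial (Suc i) j U x t) (at x within {0..}) \<and>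
          ((\<lambda>s. partial i j U x s) has_real_derivative partial i (Suc j) U x t) (at t within {0..})))"

definition compact_support_half :: "(real \<Rightarrow> real) \<Rightarrow> bool" where
  "compact_support_half f \<longleftrightarrow> bounded {x. 0 \<le> x \<and> f x \<noteq> 0}"

definition compact_support_quadrant :: "(real \<Rightarrow> real \<Rightarrow> real) \<Rightarrow> bool" where
  "compact_support_quadrant F \<longleftrightarrow> bounded {(x, t). 0 \<le> x \<and> 0 \<le> t \<and> F x t \<noteq> 0}"

section \<open>The continuous problem\<close>

text \<open>\<open>initial_dt F f1 f2 k\<close> is the time derivative of order \<open>k\<close> at \<open>t = 0\<close> which the
  equation and the initial data prescribe; compatibility at the corner means that it agrees at
  \<open>x = 0\<close> with the derivative of the boundary data, to every order.\<close>

fun initial_dt :: "(real \<Rightarrow> real \<Rightarrow> real) \<Rightarrow> (real \<Rightarrow> real) \<Rightarrow> (real \<Rightarrow> real) \<Rightarrow> nat \<Rightarrow> real \<Rightarrow> real" where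
  "initial_dt F f1 f2 0 = f1"
| "initial_dt F f1 f2 (Suc 0) = f2"
| "initial_dt F f1 f2 (Suc (Suc k)) =
     (\<lambda>x. (hderiv ^^ 2) (initial_dt F f1 f2 k) x + partial 0 k F x 0)"

definition compatible ::
  "(real \<Rightarrow> real \<Rightarrow> real) \<Rightarrow> (real \<Rightarrow> real) \<Rightarrow> (real \<Rightarrow> real) \<Rightarrow> (real \<Rightarrow> real) \<Rightarrow> bool" where
  "compatible F f1 f2 g \<longleftrightarrow> (\<forall>k. initial_dt F f1 f2 k 0 = (hderiv ^^ k) g 0)"

definition admissible_data ::
  "(real \<Rightarrow> real \<Rightarrow> real) \<Rightarrow> (real \<Rightarrow> real) \<Rightarrow> (real \<Rightarrow> real) \<Rightarrow> (real \<Rightarrow> real) \<Rightarrow> bool" where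
  "admissible_data F f1 f2 g \<longleftrightarrow>
     smooth_quadrant F \<and> smooth_half f1 \<and> smooth_half f2 \<and> smooth_half g \<and>
     compact_support_quadrant F \<and> compact_support_half f1 \<and> compact_support_half f2 \<and>
     compact_support_half g \<and> compatible F f1 f2 g"

definition smooth_wave_solution ::
  "(real \<Rightarrow> real \<Rightarrow> real) \<Rightarrow> (real \<Rightarrow> real) \<Rightarrow> (real \<Rightarrow> real) \<Rightarrow> (real \<Rightarrow> real) \<Rightarrow>
   (real \<Rightarrow> real \<Rightarrow> real) \<Rightarrow> bool" where
  "smooth_wave_solution F f1 f2 g U \<longleftrightarrow>
     smooth_quadrant U \<and>
     (\<forall>x\<ge>0. \<forall>t\<ge>0. partial 0 2 U x t = partial 2 0 U x t + F x t) \<and>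
     (\<forall>x\<ge>0. U x 0 = f1 x \<and> partial 0 1 U x 0 = f2 x) \<and>
     (\<forall>t\<ge>0. U 0 t = g t) \<and>
     (\<forall>t\<ge>0. set_integrable lborel {0..} (\<lambda>x. (U x t)\<^sup>2))"

section \<open>The SBP operators\<close>

text \<open>Everywhere \<open>p \<in> {1, 2, 3}\<close>, and the order of the operator is \<open>2p\<close>.  The infinite matrices
  \<open>D\<close>, \<open>A\<close>, \dots have finitely many nonzero entries per row and are represented as linear
  operators on grid functions.\<close>

type_synonym grid = "nat \<Rightarrow> real"

definition D_plus :: "real \<Rightarrow> grid \<Rightarrow> grid" where
  "D_plus h v j = (v (j + 1) - v j) / h"

text \<open>Only used at \<open>j \<ge> 1\<close>.\<close>

definition D_minus :: "real \<Rightarrow> grid \<Rightarrow> grid" where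
  "D_minus h v j = (v j - v (j - 1)) / h"

definition DD :: "real \<Rightarrow> grid \<Rightarrow> grid" where
  "DD h v = D_plus h (D_minus h v)"

definition row_apply :: "real list \<Rightarrow> grid \<Rightarrow> real" where
  "row_apply r v = (\<Sum>k<length r. r ! k * v k)"

definition H_boundary :: "nat \<Rightarrow> real list" where
  "H_boundary p =
     (if p = 1 then [1/2]
      else if p = 2 then [17/48, 59/48, 43/48, 49/48]
      else [13649/43200, 12013/8640, 2711/4320, 5359/4320, 7877/8640, 43801/43200])"

text \<open>The diagonal of \<open>H\<close>.\<close>

definition Hdiag :: "nat \<Rightarrow> real \<Rightarrow> grid" where
  "Hdiag p h j = h * nth_default 1 (H_boundary p) j"

text \<open>First row of \<open>h S\<close>.\<close>

definition S_row :: "nat \<Rightarrow> real list" where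
  "S_row p =
     (if p = 1 then [-3/2, 2, -1/2]
      else if p = 2 then [-11/6, 3, -3/2, 1/3]
      else [-25/12, 4, -3, 4/3, -1/4])"

text \<open>The first row of \<open>S\<close> as a grid function, that is \<open>S\<^sup>T e\<^sub>0\<close>.\<close>

definition S0 :: "nat \<Rightarrow> real \<Rightarrow> grid" where
  "S0 p h j = nth_default 0 (S_row p) j / h"

text \<open>\<open>e\<^sub>0\<^sup>T S v\<close>\<close>

definition S0_apply :: "nat \<Rightarrow> real \<Rightarrow> grid \<Rightarrow> real" where
  "S0_apply p h v = row_apply (S_row p) v / h"

text \<open>The boundary rows of \<open>h\<^sup>2 D\<close>.\<close>

definition D_boundary :: "nat \<Rightarrow> real list list" where
  "D_boundary p =
     (if p = 1 then [[1, -2, 1]]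
      else if p = 2 then
       [[2, -5, 4, -1],
        [1, -2, 1],
        [-4/43, 59/43, -110/43, 59/43, -4/43],
        [-1/49, 0, 59/49, -118/49, 64/49, -4/49]]
      else
       [[114170/40947, -438107/54596, 336409/40947, -276997/81894, 3747/13649, 21035/163788],
        [6173/5860, -2066/879, 3283/1758, -303/293, 2111/3516, -601/4395],
        [-52391/81330, 134603/32532, -21982/2711, 112915/16266, -46969/16266, 30409/54220],
        [68603/321540, -12423/10718, 112915/32154, -75934/16077, 53369/21436, -54899/160770,
         48/5359],
        [-7053/39385, 86551/94524, -46969/23631, 53369/15754, -87904/23631, 820271/472620,
         -1296/7877, 96/7877],
        [21035/525612, -24641/131403, 30409/87602, -54899/131403, 820271/525612, -117600/43801,
         64800/43801, -6480/43801, 480/43801]])"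

definition D_interior :: "nat \<Rightarrow> real \<Rightarrow> grid \<Rightarrow> grid" where
  "D_interior p h v j =
     (if p = 1 then DD h v j
      else if p = 2 then DD h v j - h^2 / 12 * (DD h ^^ 2) v j
      else DD h v j - h^2 / 12 * (DD h ^^ 2) v j + h^4 / 90 * (DD h ^^ 3) v j)"

definition D_op :: "nat \<Rightarrow> real \<Rightarrow> grid \<Rightarrow> grid" where
  "D_op p h v j =
     (if j < length (D_boundary p) then row_apply (D_boundary p ! j) v / h^2
      else D_interior p h v j)"

text \<open>\<open>A = B S - H D\<close>, which is the decomposition \<open>D = H\<^sup>-\<^sup>1 (-A + B S)\<close> solved for \<open>A\<close>, with
  \<open>B = diag(-1, 0, 0, \<dots>)\<close>.\<close>

definition A_op :: "nat \<Rightarrow> real \<Rightarrow> grid \<Rightarrow> grid" where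
  "A_op p h v j = (if j = 0 then - S0_apply p h v else 0) - Hdiag p h j * D_op p h v j"

definition finite_support :: "grid \<Rightarrow> bool" where
  "finite_support v \<longleftrightarrow> finite {j. v j \<noteq> 0}"

text \<open>\<open>v\<^sup>T w\<close> for \<open>v\<close> of finite support.\<close>

definition grid_dot :: "grid \<Rightarrow> grid \<Rightarrow> real" where
  "grid_dot v w = (\<Sum>j | v j \<noteq> 0. v j * w j)"

definition sym_psd :: "(grid \<Rightarrow> grid) \<Rightarrow> bool" where
  "sym_psd M \<longleftrightarrow>
     (\<forall>v w. finite_support v \<and> finite_support w \<longrightarrow> grid_dot v (M w) = grid_dot w (M v)) \<and>
     (\<forall>v. finite_support v \<longrightarrow> 0 \<le> grid_dot v (M v))"

text \<open>\<open>A - h \<alpha> (E\<^sub>0 S)\<^sup>T (E\<^sub>0 S)\<close>\<close>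

definition A_shifted :: "nat \<Rightarrow> real \<Rightarrow> real \<Rightarrow> grid \<Rightarrow> grid" where
  "A_shifted p h a v j = A_op p h v j - h * a * (S0 p h j * S0_apply p h v)"

text \<open>The condition scales like \<open>1/h\<close>, so the quantifier over \<open>h\<close> is immaterial.\<close>

definition alpha :: "nat \<Rightarrow> real" where
  "alpha p = (GREATEST a. \<forall>h>0. sym_psd (A_shifted p h a))"

definition tau_crit :: "nat \<Rightarrow> real" where
  "tau_crit p = 1 / alpha p"

section \<open>The semi-discretization and its error\<close>

definition sbp_sat_rhs ::
  "nat \<Rightarrow> real \<Rightarrow> real \<Rightarrow> (real \<Rightarrow> real \<Rightarrow> real) \<Rightarrow> (real \<Rightarrow> real) \<Rightarrow> grid \<Rightarrow> real \<Rightarrow> grid" where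
  "sbp_sat_rhs p \<tau> h F g v t j =
     D_op p h v j
     - inverse (Hdiag p h j) * S0 p h j * (v 0 - g t)
     - \<tau> / h * (inverse (Hdiag p h j) * (if j = 0 then 1 else 0) * (v 0 - g t))
     + F (real j * h) t"

text \<open>The argument order is \<open>u t j\<close>: \<open>u t\<close> is the grid function at time \<open>t\<close>.\<close>

definition sbp_sat_solution ::
  "nat \<Rightarrow> real \<Rightarrow> real \<Rightarrow> (real \<Rightarrow> real \<Rightarrow> real) \<Rightarrow> (real \<Rightarrow> real) \<Rightarrow> (real \<Rightarrow> real) \<Rightarrow>
   (real \<Rightarrow> real) \<Rightarrow> (real \<Rightarrow> grid) \<Rightarrow> bool" where
  "sbp_sat_solution p \<tau> h F f1 f2 g u \<longleftrightarrow>
     (\<exists>u_t :: real \<Rightarrow> grid. \<forall>j.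
        (\<forall>t\<ge>0. ((\<lambda>s. u s j) has_real_derivative u_t t j) (at t within {0..}) \<and>
               ((\<lambda>s. u_t s j) has_real_derivative sbp_sat_rhs p \<tau> h F g (u t) t j)
                 (at t within {0..})) \<and>
        u 0 j = f1 (real j * h) \<and> u_t 0 j = f2 (real j * h))"

definition pointwise_error ::
  "real \<Rightarrow> (real \<Rightarrow> real \<Rightarrow> real) \<Rightarrow> (real \<Rightarrow> grid) \<Rightarrow> real \<Rightarrow> grid" where
  "pointwise_error h U u t j = U (real j * h) t - u t j"

definition finite_grid_norm :: "grid \<Rightarrow> bool" where
  "finite_grid_norm v \<longleftrightarrow> summable (\<lambda>j. \<bar>v j\<bar>\<^sup>2)"

definition grid_norm :: "real \<Rightarrow> grid \<Rightarrow> real" where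
  "grid_norm h v = sqrt (h * (\<Sum>j. \<bar>v j\<bar>\<^sup>2))"

text \<open>Only used for \<open>\<tau> \<ge> tau_crit p\<close>, so the second branches mean equality.\<close>

definition rate :: "nat \<Rightarrow> real \<Rightarrow> real" where
  "rate p \<tau> =
     (if p = 1 then (if \<tau> > tau_crit p then 2 else 3/2)
      else if p = 2 then (if \<tau> > tau_crit p then 4 else 5/2)
      else (if \<tau> > tau_crit p then 5 else 7/2))"

end

theory Submission
  imports Defs
begin

text \<open>The error \<open>\<xi>\<close> solves \<open>\<xi>\<^sub>t\<^sub>t = - H\<^sup>-\<^sup>1 M \<xi> + T\<close> with zero initial data, where
  \<open>M = A + E\<^sub>0 S + S\<^sup>T E\<^sub>0 + (\<tau>/h) E\<^sub>0\<close> is symmetric, positive semi-definite for \<open>\<tau> \<ge> 1/\<alpha>\<close>, and \<open>T\<close> is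
  the truncation error. The energy of the time integral of \<open>\<xi>\<close> bounds \<open>\<xi>\<close> in \<open>l\<^sup>2\<close> by \<open>T\<close>, which has norm
  \<open>O(h\<^sup>p \<surd>h)\<close> because of the boundary rows; this is the rate for \<open>\<tau> = 1/\<alpha>\<close>. For \<open>\<tau> > 1/\<alpha>\<close> the error is
  corrected explicitly: for every boundary row \<open>i\<close> the stationary problem
  \<open>M W = e\<^sub>i\<close> has a solution that tends exponentially to a constant, so the boundary truncation error can be
  removed by a grid function of size \<open>h\<^sup>p\<^sup>+\<^sup>2\<close>, leaving a residual of size
  \<open>O(h\<^bsup>min(2p, p+2)\<^esup>)\<close>. Since \<open>\<xi>(t) \<in> l\<^sup>2\<close> is assumed for each \<open>t\<close> without uniformity, local boundedness
  of \<open>\<parallel>\<xi>(t)\<parallel>\<close> must first be established; it follows from the Baire category theorem.\<close>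

section \<open>Boundedness of pointwise square-summable solutions\<close>

text \<open>Three obstacles shape the proof. Nothing is assumed about the velocity of the error, so
  the energy is that of the time integral: its kinetic part is \<xi> itself, which is
  square-summable. Its potential part moreover starts at zero, so initial values are not weighted by
  h^-2; this matters because the corrector need not vanish at time 0. Second, \<open>A\<close>
  annihilates constants, so a solution of M W = e_i tends to a constant that is in general nonzero
  and has to be cut off at a distance of order 1. The corrector is therefore of size h^(p+2) on
  about 1/h grid points, and p+2, rather than p+5/2, competes with the interior order 2p. Third,
  eliminating the interior unknowns leaves a scalar equation with coefficient \<tau> - \<sigma>^T
  Q^-1 \<sigma>, where \<sigma> is the first row of h S in terms of forward differences; \<sigma>^T
  Q^-1 \<sigma> is at most 1/\<alpha>, which is where the strict inequality for \<tau> enters. When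
  \<tau> = 1/\<alpha> only the energy estimate remains, and the gain over h^p is the factor sqrt h
  that comes from having finitely many boundary rows.\<close>

text \<open>The three-point estimate lets boundedness propagate across every gap of the closed set where
  \<open>N\<close> is not locally bounded; the Baire category theorem then forces this set to be empty.\<close>

lemma bounded_by_three_point_estimate:
  fixes N :: "real \<Rightarrow> real"
  assumes cl: "\<And>M. closed {t \<in> {0..T}. N t \<le> M}"
    and ext: "\<And>c d x y \<mu> B t. 0 \<le> c \<Longrightarrow> d \<le> T \<Longrightarrow> c \<le> x \<Longrightarrow> x < y \<Longrightarrow> y \<le> d \<Longrightarrow> d - c \<le> \<delta> \<Longrightarrow>
        d - c \<le> 2 * (y - x) \<Longrightarrow> (\<And>s. c \<le> s \<Longrightarrow> s \<le> d \<Longrightarrow> N s \<le> B) \<Longrightarrow> N x \<le> \<mu> \<Longrightarrow> N y \<le> \<mu> \<Longrightarrow>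
        c \<le> t \<Longrightarrow> t \<le> d \<Longrightarrow> N t \<le> 10 * \<mu> + \<Theta>"
    and \<delta>: "\<delta> > 0"
  shows "\<exists>B. \<forall>t\<in>{0..T}. N t \<le> B"
proof (rule ccontr)
  assume unb: "\<nexists>B. \<forall>t\<in>{0..T}. N t \<le> B"
  define bd where "bd I \<longleftrightarrow> (\<exists>B. \<forall>t\<in>I \<inter> {0..T}. N t \<le> B)" for I
  have bd_un: "bd (I \<union> J)" if IJ: "bd I" "bd J" for I J
  proof -
    obtain B B' where "\<forall>t\<in>I \<inter> {0..T}. N t \<le> B" "\<forall>t\<in>J \<inter> {0..T}. N t \<le> B'"
      using IJ unfolding bd_def by meson
    then have "\<forall>t\<in>(I \<union> J) \<inter> {0..T}. N t \<le> max B B'" by (auto simp: le_max_iff_disj)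
    then show ?thesis unfolding bd_def by blast
  qed
  have bd_sub: "bd I" if "bd J" "I \<subseteq> J" for I J
    using that unfolding bd_def by blast
  define G where "G = {t \<in> {0..T}. \<exists>e>0. bd {t-e<..<t+e}}"
  define K where "K = {0..T} - G"
  have cpt: "bd {a..b}" if "0 \<le> a" "a \<le> b" "b \<le> T" "{a..b} \<subseteq> G" for a b
    using \<open>a \<le> b\<close>
  proof (induct rule: Bolzano)
    case (trans u v w)
    then show ?case using bd_un[of "{u..v}" "{v..w}"]
      by (simp add: ivl_disj_un_two_touch)
  next
    case (local x)
    then have "x \<in> G" using that by auto
    then obtain e where "e > 0" "bd {x-e<..<x+e}" unfolding G_def by auto
    moreover have "bd {u..v}" if "u \<le> x \<and> x \<le> v \<and> v - u < e" for u v
      by (rule bd_sub[OF \<open>bd {x-e<..<x+e}\<close>]) (use that in auto)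
    ultimately show ?case by (intro exI[of _ e]) auto
  qed
  have "openin (top_of_set {0..T}) G"
  proof (rule openin_subopen[THEN iffD2], intro ballI)
    fix t assume t: "t \<in> G"
    then obtain e where e: "e > 0" "bd {t-e<..<t+e}" unfolding G_def by auto
    have "s \<in> G" if "s \<in> {0..T} \<inter> {t-e<..<t+e}" for s
    proof -
      define e' where "e' = min (s - (t - e)) (t + e - s)"
      have "e' > 0" "{s-e'<..<s+e'} \<subseteq> {t-e<..<t+e}" using that by (auto simp: e'_def)
      then have "\<exists>e>0. bd {s-e<..<s+e}" using bd_sub[OF e(2), of "{s-e'<..<s+e'}"] by auto
      then show ?thesis using that by (simp add: G_def)
    qed
    moreover have "openin (top_of_set {0..T}) ({0..T} \<inter> {t-e<..<t+e})"
      by (intro openin_open_Int open_greaterThanLessThan)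
    ultimately show "\<exists>V. openin (top_of_set {0..T}) V \<and> t \<in> V \<and> V \<subseteq> G"
      using e(1) t by (intro exI[of _ "{0..T} \<inter> {t-e<..<t+e}"]) (auto simp: G_def)
  qed
  moreover have "{0..T} - K = G" by (auto simp: K_def G_def)
  ultimately have "closedin (top_of_set {0..T}) K"
    by (simp add: closedin_def K_def)
  then have K_closed: "closed K" by (rule closedin_closed_trans) simp
  have KT: "K \<subseteq> {0..T}" by (auto simp: K_def)
  \<comment> \<open>\<open>ext\<close> asks for boundedness on a compact interval, but inside the
    gap N is only known to be bounded on compact subintervals. The quarter points \<open>x\<close>,
    \<open>y\<close> stay fixed while [c,d] exhausts the gap, and y - x is half the gap length, so
    the resulting bound does not depend on c and d.\<close>
  have open_gap: "bd {l..u}" if lu: "0 \<le> l" "l < u" "u \<le> T" "u - l \<le> \<delta>" and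
    gap: "K \<inter> {l<..<u} = {}" for l u
  proof -
    define x y where "x = l + (u - l) / 4" and "y = u - (u - l) / 4"
    have xy: "l < x" "x < y" "y < u" "2 * (y - x) = u - l" using lu by (auto simp: x_def y_def field_simps)
    define \<mu> where "\<mu> = max (N x) (N y)"
    have "N t \<le> 10 * \<mu> + \<Theta>" if t: "l < t" "t < u" for t
    proof -
      define c d where "c = min t x" and "d = max t y"
      have cd: "l < c" "c \<le> x" "y \<le> d" "d < u" "c \<le> t" "t \<le> d" using t xy by (auto simp: c_def d_def)
      have sub: "{c..d} \<subseteq> G"
      proof
        fix s assume s: "s \<in> {c..d}"
        then have "s \<in> {l<..<u}" "s \<in> {0..T}" using cd lu by auto
        then show "s \<in> G" using gap unfolding K_def by blast
      qed
      have "bd {c..d}" using cpt[of c d] sub cd lu xy by simp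
      then obtain B where B: "\<forall>s\<in>{c..d} \<inter> {0..T}. N s \<le> B" unfolding bd_def by auto
      have B': "N s \<le> B" if "c \<le> s" "s \<le> d" for s using B that cd lu by auto
      show ?thesis
      proof (rule ext)
        show "0 \<le> c" "d \<le> T" "c \<le> x" "x < y" "y \<le> d" "d - c \<le> \<delta>" "d - c \<le> 2 * (y - x)"
          using cd lu xy by linarith+
        show "N x \<le> \<mu>" "N y \<le> \<mu>" by (auto simp: \<mu>_def)
        show "c \<le> t" "t \<le> d" by (auto simp: cd)
      qed (fact B')
    qed
    then have "N t \<le> max (max (N l) (N u)) (10 * \<mu> + \<Theta>)" if "t \<in> {l..u}" for t
      using that by (cases "t = l \<or> t = u") (auto simp: le_max_iff_disj)
    then show ?thesis unfolding bd_def by blast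
  qed
  have "K \<noteq> {}"
  proof
    assume "K = {}"
    then have "{0..T} \<subseteq> G" by (auto simp: K_def)
    moreover have "0 \<le> T" using unb by fastforce
    ultimately have "bd {0..T}" using cpt by simp
    then show False using unb by (simp add: bd_def)
  qed
  define KM where "KM M = {t \<in> K. N t \<le> real M}" for M :: nat
  \<comment> \<open>Baire: the closed sets \<open>KM M\<close> cover K, so one of them contains a
    relative neighbourhood in K of some point \<open>t0\<close>.\<close>
  have KM: "\<exists>M. \<not> K \<subseteq> closure (K - KM M)"
  proof (rule ccontr)
    assume "\<not> ?thesis"
    then have dense: "K \<subseteq> closure (K - KM M)" for M by blast
    have "K \<subseteq> closure (\<Inter>(range (\<lambda>M. K - KM M)))"
    proof (rule Baire[OF K_closed])
      fix V assume "V \<in> range (\<lambda>M. K - KM M)"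
      then obtain M where V: "V = K - KM M" by auto
      have eq: "KM M = K \<inter> {t \<in> {0..T}. N t \<le> real M}" using KT by (auto simp: KM_def)
      have "closedin (top_of_set K) (KM M)" unfolding eq by (intro closedin_closed_Int cl)
      then have "openin (top_of_set K) V" unfolding V
        by (metis openin_diff openin_topspace topspace_euclidean_subtopology)
      then show "openin (top_of_set K) V \<and> K \<subseteq> closure V" using dense V by auto
    qed auto
    moreover have empty: "\<Inter>(range (\<lambda>M. K - KM M)) = {}"
    proof -
      have "\<exists>M. t \<notin> K - KM M" for t
        using real_arch_simple[of "N t"] by (auto simp: KM_def)
      then show ?thesis by blast
    qed
    ultimately show False using \<open>K \<noteq> {}\<close> by (simp only: empty closure_empty subset_empty)
  qed
  then obtain M t0 where t0: "t0 \<in> K" "t0 \<notin> closure (K - KM M)" by blast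
  then obtain e0 where e0: "e0 > 0" "\<And>t. t \<in> K - KM M \<Longrightarrow> \<bar>t - t0\<bar> \<ge> e0"
    by (auto simp: closure_approachable dist_real_def not_less)
  define e where "e = min e0 \<delta>"
  have e: "e > 0" "e \<le> \<delta>" using e0 \<delta> by (auto simp: e_def)
  have KN: "N t \<le> real M" if "t \<in> K" "\<bar>t - t0\<bar> < e" for t
    using e0(2)[of t] that by (fastforce simp: e_def KM_def)
  \<comment> \<open>A point t outside K lies in a gap whose endpoints belong to K and are close to
    \<open>t0\<close>, where N is at most M. With these endpoints as anchors the bound is the same
    for every gap, however short.\<close>
  have closed_gap: "bd {l..u}" if l: "l \<in> K" and u: "u \<in> K" and "l < u" "\<bar>l - t0\<bar> < e" "\<bar>u - t0\<bar> < e"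
    "u - l \<le> \<delta>" for l u
  proof -
    have lu: "0 \<le> l" "u \<le> T" using l u KT by auto
    have "N t \<le> max (real M) (10 * real M + \<Theta>)" if t: "l \<le> t" "t \<le> u" for t
    proof (cases "t \<in> K")
      case True
      then show ?thesis using KN[of t] t \<open>\<bar>l - t0\<bar> < e\<close> \<open>\<bar>u - t0\<bar> < e\<close> by (simp add: le_max_iff_disj abs_if split: if_splits)
    next
      case False
      define a b where "a = Sup (K \<inter> {l..t})" and "b = Inf (K \<inter> {t..u})"
      have bdd: "bdd_above (K \<inter> {l..t})" "bdd_below (K \<inter> {t..u})" by auto
      have a: "a \<in> K \<inter> {l..t}" unfolding a_def
        using l t K_closed by (intro closed_contains_Sup) auto
      have b: "b \<in> K \<inter> {t..u}" unfolding b_def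
        using u t K_closed by (intro closed_contains_Inf) auto
      have ab: "a < t" "t < b" using a b False by (auto simp: order_less_le)
      have gap: "K \<inter> {a<..<b} = {}"
      proof (rule ccontr)
        assume "\<not> ?thesis"
        then obtain s where s: "s \<in> K" "a < s" "s < b" by auto
        show False
        proof (cases "s \<le> t")
          case True
          have "s \<le> a" unfolding a_def using s True a
            by (intro cSup_upper) auto
          then show False using s by simp
        next
          case False
          have "b \<le> s" unfolding b_def using s False b
            by (intro cInf_lower) auto
          then show False using s by simp
        qed
      qed
      have ab2: "0 \<le> a" "a < b" "b \<le> T" "b - a \<le> \<delta>" "\<bar>a - t0\<bar> < e" "\<bar>b - t0\<bar> < e"
        using a b ab lu that \<open>\<bar>l - t0\<bar> < e\<close> \<open>\<bar>u - t0\<bar> < e\<close> \<open>u - l \<le> \<delta>\<close> by auto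
      obtain B where B: "\<forall>s\<in>{a..b} \<inter> {0..T}. N s \<le> B"
        using open_gap[OF ab2(1-4) gap] unfolding bd_def by auto
      have "N t \<le> 10 * real M + \<Theta>"
      proof (rule ext)
        show "0 \<le> a" "b \<le> T" "a \<le> a" "a < b" "b \<le> b" "b - a \<le> \<delta>" "b - a \<le> 2 * (b - a)"
          using ab2 by simp_all
        show "N a \<le> real M" "N b \<le> real M" using a b ab2 KN by auto
        show "a \<le> t" "t \<le> b" using ab by auto
        show "N s \<le> B" if "a \<le> s" "s \<le> b" for s using B that ab2 by auto
      qed
      then show ?thesis by simp
    qed
    then show ?thesis unfolding bd_def by fastforce
  qed
  have t0T: "0 \<le> t0" "t0 \<le> T" using t0 KT by auto
  \<comment> \<open>Either K has no points in a short interval to the right of \<open>t0\<close>,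
    which is then a gap, or any such point of K closes an interval of the previous kind. At t0 = T
    nothing lies to the right within {0..T}.\<close>
  have right: "\<exists>r>0. bd {t0..t0+r}"
  proof (cases "t0 = T")
    case True
    then have "{t0..t0+1} \<inter> {0..T} = {t0}" using t0T by auto
    then show ?thesis unfolding bd_def by (intro exI[of _ 1]) auto
  next
    case False
    define u where "u = min (t0 + e/2) T"
    have u: "t0 < u" "u \<le> T" "\<bar>u - t0\<bar> < e" "u - t0 \<le> \<delta>" using False t0T e by (auto simp: u_def)
    show ?thesis
    proof (cases "K \<inter> {t0<..<u} = {}")
      case True
      then show ?thesis using open_gap[of t0 u] u t0T by (intro exI[of _ "u - t0"]) auto
    next
      case False
      then obtain r where "r \<in> K" "t0 < r" "r < u" by auto
      then show ?thesis using closed_gap[of t0 r] u t0 e by (intro exI[of _ "r - t0"]) auto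
    qed
  qed
  have left: "\<exists>r>0. bd {t0-r..t0}"
  proof (cases "t0 = 0")
    case True
    then have "{t0-1..t0} \<inter> {0..T} = {t0}" using t0T by auto
    then show ?thesis unfolding bd_def by (intro exI[of _ 1]) auto
  next
    case False
    define u where "u = max (t0 - e/2) 0"
    have u: "u < t0" "0 \<le> u" "\<bar>u - t0\<bar> < e" "t0 - u \<le> \<delta>" using False t0T e by (auto simp: u_def)
    show ?thesis
    proof (cases "K \<inter> {u<..<t0} = {}")
      case True
      then show ?thesis using open_gap[of u t0] u t0T by (intro exI[of _ "t0 - u"]) auto
    next
      case False
      then obtain r where "r \<in> K" "u < r" "r < t0" by auto
      then show ?thesis using closed_gap[of r t0] u t0 e by (intro exI[of _ "t0 - r"]) auto
    qed
  qed
  obtain r r' where r: "r > 0" "r' > 0" "bd {t0-r..t0}" "bd {t0..t0+r'}" using left right by auto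
  have "bd {t0 - min r r'<..<t0 + min r r'}"
    by (rule bd_sub[OF bd_un[OF r(3,4)]]) auto
  then have "t0 \<in> G" using r t0T unfolding G_def by (auto intro!: exI[of _ "min r r'"])
  then show False using t0(1) by (simp add: K_def)
qed

section \<open>Norms of square-summable sequences\<close>

definition l2norm :: "(nat \<Rightarrow> real) \<Rightarrow> real" where
  "l2norm x = sqrt (\<Sum>j. (x j)\<^sup>2)"

lemma l2norm_nonneg: "0 \<le> l2norm x" if "summable (\<lambda>j. (x j)\<^sup>2)"
  using that by (simp add: l2norm_def suminf_nonneg)

lemma L2_set_le_l2norm:
  assumes "summable (\<lambda>j. (x j)\<^sup>2)" "finite A"
  shows "L2_set x A \<le> l2norm x"
  unfolding L2_set_def l2norm_def
  using assms by (intro real_sqrt_le_mono sum_le_suminf) auto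

lemma summable_sq_if_L2_set_le:
  assumes "\<And>n. L2_set x {..<n} \<le> M"
  shows "summable (\<lambda>j. (x j)\<^sup>2)"
proof (rule summableI_nonneg_bounded)
  fix n
  have "sqrt (\<Sum>j<n. (x j)\<^sup>2) \<le> M" using assms by (simp add: L2_set_def)
  then show "(\<Sum>j<n. (x j)\<^sup>2) \<le> M\<^sup>2"
    by (meson order_trans real_sqrt_le_iff sqrt_le_D)
qed auto

lemma l2norm_le:
  assumes "\<And>n. L2_set x {..<n} \<le> M"
  shows "l2norm x \<le> M"
proof -
  have "0 \<le> M" using assms[of 0] by simp
  have "(\<Sum>j. (x j)\<^sup>2) \<le> M\<^sup>2"
  proof (rule suminf_le_const[OF summable_sq_if_L2_set_le[OF assms]])
    fix n
    have "sqrt (\<Sum>j<n. (x j)\<^sup>2) \<le> M" using assms by (simp add: L2_set_def)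
    then show "(\<Sum>j<n. (x j)\<^sup>2) \<le> M\<^sup>2" by (meson order_trans real_sqrt_le_iff sqrt_le_D)
  qed
  then show ?thesis unfolding l2norm_def using \<open>0 \<le> M\<close> by (intro real_le_lsqrt) auto
qed

lemma l2norm_le_dom:
  assumes "summable (\<lambda>j. (y j)\<^sup>2)" "\<And>j. \<bar>x j\<bar> \<le> y j"
  shows "summable (\<lambda>j. (x j)\<^sup>2)" "l2norm x \<le> l2norm y"
proof -
  have le: "(x j)\<^sup>2 \<le> (y j)\<^sup>2" for j using assms(2)[of j] by (metis abs_le_square_iff abs_of_nonneg abs_ge_zero order_trans)
  show s: "summable (\<lambda>j. (x j)\<^sup>2)"
    by (rule summable_comparison_test'[OF assms(1), of 0]) (simp add: le)
  show "l2norm x \<le> l2norm y" unfolding l2norm_def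
    by (intro real_sqrt_le_mono suminf_le le s assms)
qed

lemma abs_sum_mult_le_L2_set:
  "\<bar>\<Sum>j\<in>A. f j * g j\<bar> \<le> L2_set f A * L2_set g (A :: 'a set)"
proof -
  have "\<bar>\<Sum>j\<in>A. f j * g j\<bar> \<le> (\<Sum>j\<in>A. \<bar>f j\<bar> * \<bar>g j\<bar>)"
    by (metis (no_types, lifting) abs_mult sum.cong sum_abs)
  also have "\<dots> \<le> L2_set f A * L2_set g A" by (rule L2_set_mult_ineq)
  finally show ?thesis .
qed

text \<open>The mean value theorem yields a point of [x,y] with |\<phi>'| at most 2 \<mu> / (y - x).
  The bound on \<phi>'' spreads this over [c,d], and another integration starting at x gives \<mu> +
  4 \<mu>, since d - c is at most twice y - x.\<close>

lemma three_point_estimate: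
  fixes \<phi> :: "real \<Rightarrow> real"
  assumes d1: "\<And>s. s \<in> {c..d} \<Longrightarrow> (\<phi> has_real_derivative \<phi>' s) (at s within {c..d})"
    and d2: "\<And>s. s \<in> {c..d} \<Longrightarrow> (\<phi>' has_real_derivative \<phi>'' s) (at s within {c..d})"
    and b2: "\<And>s. s \<in> {c..d} \<Longrightarrow> \<bar>\<phi>'' s\<bar> \<le> \<beta>"
    and xy: "c \<le> x" "x < y" "y \<le> d" "d - c \<le> 2 * (y - x)"
    and \<mu>: "\<bar>\<phi> x\<bar> \<le> \<mu>" "\<bar>\<phi> y\<bar> \<le> \<mu>"
    and t: "t \<in> {c..d}"
  shows "\<bar>\<phi> t\<bar> \<le> 5 * \<mu> + \<beta> * (d - c)\<^sup>2"
proof -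
  have "\<exists>s\<in>{x..y}. \<phi> y - \<phi> x = \<phi>' s * (y - x)"
  proof (rule mvt_very_simple)
    show "(\<phi> has_derivative (\<lambda>h. \<phi>' s * h)) (at s within {x..y})" if "x \<le> s" "s \<le> y" for s
      using d1[of s] that xy unfolding has_field_derivative_def
      by (auto intro: has_derivative_subset)
  qed (use xy in auto)
  then obtain s where s: "s \<in> {x..y}" "\<phi> y - \<phi> x = \<phi>' s * (y - x)" by blast
  have \<beta>: "0 \<le> \<beta>" using b2[OF t] by linarith
  have ps: "\<bar>\<phi>' s\<bar> \<le> 2 * \<mu> / (y - x)"
  proof -
    have "\<bar>\<phi>' s\<bar> * (y - x) = \<bar>\<phi> y - \<phi> x\<bar>" using s xy by (simp add: abs_mult)
    also have "\<dots> \<le> 2 * \<mu>" using \<mu> by linarith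
    finally show ?thesis using xy by (simp add: field_simps)
  qed
  have p': "\<bar>\<phi>' u\<bar> \<le> 2 * \<mu> / (y - x) + \<beta> * (d - c)" if u: "u \<in> {c..d}" for u
  proof -
    have "norm (\<phi>' u - \<phi>' s) \<le> \<beta> * norm (u - s)"
      by (rule field_differentiable_bound[of "{c..d}"]) (use d2 b2 u s xy in auto)
    also have "\<dots> \<le> \<beta> * (d - c)" using u s xy \<beta> by (intro mult_left_mono) auto
    finally show ?thesis using ps by simp
  qed
  have "norm (\<phi> t - \<phi> x) \<le> (2 * \<mu> / (y - x) + \<beta> * (d - c)) * norm (t - x)"
    by (rule field_differentiable_bound[of "{c..d}"]) (use d1 p' t xy in auto)
  also have "\<dots> \<le> (2 * \<mu> / (y - x) + \<beta> * (d - c)) * (d - c)"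
    using t xy p'[OF t] by (intro mult_left_mono) auto
  also have "\<dots> = 2 * \<mu> * ((d - c) / (y - x)) + \<beta> * (d - c)\<^sup>2"
    by (simp add: algebra_simps power2_eq_square)
  also have "2 * \<mu> * ((d - c) / (y - x)) \<le> 2 * \<mu> * 2"
    using xy \<mu> by (intro mult_left_mono) (auto simp: field_simps)
  finally show ?thesis using \<mu> by simp
qed

text \<open>Square-summability is known for every t but without any uniformity. Pairing w(u) with a
  fixed truncation of w(s) turns the system into one scalar second-order relation, to which the
  three-point estimate applies with constants independent of the truncation.\<close>

lemma l2norm_bounded_on_interval:
  fixes w :: "real \<Rightarrow> nat \<Rightarrow> real"
  assumes w: "\<And>t j. t \<in> {0..T} \<Longrightarrow> ((\<lambda>s. w s j) has_real_derivative w' t j) (at t within {0..T})"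
    and w': "\<And>t j. t \<in> {0..T} \<Longrightarrow> ((\<lambda>s. w' s j) has_real_derivative f t j) (at t within {0..T})"
    and summ: "\<And>t. t \<in> {0..T} \<Longrightarrow> summable (\<lambda>j. (w t j)\<^sup>2)"
    and f: "\<And>t n. t \<in> {0..T} \<Longrightarrow> L2_set (f t) {..<n} \<le> \<Lambda> * l2norm (w t) + \<Theta>"
    and pos: "\<Lambda> \<ge> 0" "\<Theta> \<ge> 0"
  shows "\<exists>B. \<forall>t\<in>{0..T}. l2norm (w t) \<le> B"
proof (rule bounded_by_three_point_estimate)
  \<comment> \<open>Chosen such that \<open>\<delta>\<^sup>2 * \<Lambda> \<le> 1/2\<close>: on
    intervals of this length the contribution of the unknown supremum \<open>Y\<close> is at most
    Y/2 and can be absorbed.\<close>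
  define \<delta> where "\<delta> = sqrt (1 / (2 * (\<Lambda> + 1)))"
  have \<delta>: "\<delta>\<^sup>2 * \<Lambda> \<le> 1 / 2" "\<delta>\<^sup>2 \<le> 1" using pos by (auto simp: \<delta>_def field_simps)
  show "\<delta> > 0" using pos by (simp add: \<delta>_def)
  have cont: "continuous_on {0..T} (\<lambda>t. w t j)" for j
    using w by (intro DERIV_continuous_on) auto
  show "closed {t \<in> {0..T}. l2norm (w t) \<le> M}" for M
  proof (cases "M \<ge> 0")
    case True
    \<comment> \<open>The norm is a supremum of continuous truncated norms, hence lower
      semicontinuous in t; this is all that coordinatewise continuity gives.\<close>
    have "{t \<in> {0..T}. l2norm (w t) \<le> M} = (\<Inter>n. {t \<in> {0..T}. L2_set (w t) {..<n} \<le> M})"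
    proof (intro set_eqI iffI)
      fix t assume "t \<in> {t \<in> {0..T}. l2norm (w t) \<le> M}"
      then show "t \<in> (\<Inter>n. {t \<in> {0..T}. L2_set (w t) {..<n} \<le> M})"
        using L2_set_le_l2norm[OF summ[of t]] by (auto intro: order_trans)
    next
      fix t assume "t \<in> (\<Inter>n. {t \<in> {0..T}. L2_set (w t) {..<n} \<le> M})"
      then show "t \<in> {t \<in> {0..T}. l2norm (w t) \<le> M}" by (auto intro: l2norm_le)
    qed
    also have "closed \<dots>"
      unfolding L2_set_def
      by (intro closed_INT ballI continuous_on_closed_Collect_le continuous_intros cont closed_atLeastAtMost)
    finally show ?thesis .
  next
    case False
    then have empty: "{t \<in> {0..T}. l2norm (w t) \<le> M} = {}" using l2norm_nonneg[OF summ] by fastforce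
    show ?thesis unfolding empty by simp
  qed
  fix c d x y \<mu> B t :: real
  assume c: "0 \<le> c" and d: "d \<le> T" and xy: "c \<le> x" "x < y" "y \<le> d" "d - c \<le> 2 * (y - x)"
    and dc: "d - c \<le> \<delta>" and B: "\<And>s. c \<le> s \<Longrightarrow> s \<le> d \<Longrightarrow> l2norm (w s) \<le> B"
    and \<mu>: "l2norm (w x) \<le> \<mu>" "l2norm (w y) \<le> \<mu>" and t: "c \<le> t" "t \<le> d"
  \<comment> \<open>Finite because of \<open>B\<close>; the size of \<open>B\<close> disappears from
    the final bound when Y/2 is absorbed.\<close>
  define Y where "Y = (SUP s\<in>{c..d}. l2norm (w s))"
  have Y: "l2norm (w s) \<le> Y" if "s \<in> {c..d}" for s
    unfolding Y_def using that B by (intro cSUP_upper bdd_aboveI2[where M=B]) auto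
  have sub: "s \<in> {0..T}" if "s \<in> {c..d}" for s using that c d by auto
  \<comment> \<open>Here \<phi>(u) is the inner product of w(s) and w(u) over the first n
    coordinates. Since \<phi>(s) = \<alpha>^2 and every bound carries one factor \<alpha>, dividing
    by \<alpha> leaves the truncated norm.\<close>
  have pt: "l2norm (w s) \<le> 5 * \<mu> + (\<Lambda> * Y + \<Theta>) * (d - c)\<^sup>2" if s: "s \<in> {c..d}" for s
  proof (rule l2norm_le)
    fix n
    define \<alpha> where "\<alpha> = L2_set (w s) {..<n}"
    define \<phi> \<phi>' \<phi>'' where "\<phi> u = (\<Sum>j<n. w s j * w u j)" and "\<phi>' u = (\<Sum>j<n. w s j * w' u j)"
      and "\<phi>'' u = (\<Sum>j<n. w s j * f u j)" for u
    have der: "((\<lambda>u. w u j) has_real_derivative w' u j) (at u within {c..d})"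
        "((\<lambda>u. w' u j) has_real_derivative f u j) (at u within {c..d})" if "u \<in> {c..d}" for u j
      using DERIV_subset[OF w[OF sub[OF that]]] DERIV_subset[OF w'[OF sub[OF that]]] c d by auto
    have \<phi>: "\<bar>\<phi> u\<bar> \<le> \<alpha> * l2norm (w u)" if "u \<in> {c..d}" for u
    proof -
      have "\<bar>\<phi> u\<bar> \<le> \<alpha> * L2_set (w u) {..<n}" unfolding \<phi>_def \<alpha>_def by (rule abs_sum_mult_le_L2_set)
      also have "\<dots> \<le> \<alpha> * l2norm (w u)"
        using L2_set_le_l2norm[OF summ[OF sub[OF that]], of "{..<n}"] by (intro mult_left_mono) (auto simp: \<alpha>_def)
      finally show ?thesis .
    qed
    have \<alpha>0: "0 \<le> \<alpha>" by (simp add: \<alpha>_def)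
    have "\<bar>\<phi> s\<bar> \<le> 5 * (\<alpha> * \<mu>) + (\<alpha> * (\<Lambda> * Y + \<Theta>)) * (d - c)\<^sup>2"
    proof (rule three_point_estimate[where \<phi> = \<phi> and \<phi>' = \<phi>' and \<phi>'' = \<phi>'' and x = x and y = y])
      show "(\<phi> has_real_derivative \<phi>' u) (at u within {c..d})" if "u \<in> {c..d}" for u
        unfolding \<phi>_def \<phi>'_def using der(1)[OF that] by (auto intro!: derivative_eq_intros sum.cong)
      show "(\<phi>' has_real_derivative \<phi>'' u) (at u within {c..d})" if "u \<in> {c..d}" for u
        unfolding \<phi>'_def \<phi>''_def using der(2)[OF that] by (auto intro!: derivative_eq_intros sum.cong)
      show "\<bar>\<phi>'' u\<bar> \<le> \<alpha> * (\<Lambda> * Y + \<Theta>)" if "u \<in> {c..d}" for u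
      proof -
        have "\<bar>\<phi>'' u\<bar> \<le> \<alpha> * L2_set (f u) {..<n}" unfolding \<phi>''_def \<alpha>_def by (rule abs_sum_mult_le_L2_set)
        also have "\<dots> \<le> \<alpha> * (\<Lambda> * l2norm (w u) + \<Theta>)"
          using f[OF sub[OF that]] \<alpha>0 by (intro mult_left_mono)
        also have "\<dots> \<le> \<alpha> * (\<Lambda> * Y + \<Theta>)" using Y[OF that] pos \<alpha>0
          by (intro mult_left_mono add_right_mono)
        finally show ?thesis .
      qed
      show "\<bar>\<phi> x\<bar> \<le> \<alpha> * \<mu>" using \<phi>[of x] mult_left_mono[OF \<mu>(1) \<alpha>0] xy by auto
      show "\<bar>\<phi> y\<bar> \<le> \<alpha> * \<mu>" using \<phi>[of y] mult_left_mono[OF \<mu>(2) \<alpha>0] xy by auto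
    qed (use xy s in auto)
    moreover have "\<phi> s = \<alpha> * \<alpha>"
      by (simp add: \<phi>_def \<alpha>_def L2_set_def real_sqrt_mult_self sum_nonneg power2_eq_square)
    ultimately have "\<alpha> * \<alpha> \<le> \<alpha> * (5 * \<mu> + (\<Lambda> * Y + \<Theta>) * (d - c)\<^sup>2)"
      by (simp add: algebra_simps)
    moreover have "0 \<le> \<mu>" using order_trans[OF l2norm_nonneg[OF summ[OF sub]] \<mu>(1)] xy by auto
    moreover have "0 \<le> Y" using order_trans[OF l2norm_nonneg[OF summ[OF sub[OF s]]] Y[OF s]] .
    ultimately show "L2_set (w s) {..<n} \<le> 5 * \<mu> + (\<Lambda> * Y + \<Theta>) * (d - c)\<^sup>2"
      using pos \<alpha>0 unfolding \<alpha>_def[symmetric] by (cases "\<alpha> = 0") auto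
  qed
  have Y0: "0 \<le> Y" using order_trans[OF l2norm_nonneg[OF summ[OF sub]] Y[of x]] xy by auto
  have "(d - c)\<^sup>2 \<le> \<delta>\<^sup>2" using dc xy by (intro power_mono) auto
  then have "(\<Lambda> * Y + \<Theta>) * (d - c)\<^sup>2 \<le> (\<Lambda> * Y + \<Theta>) * \<delta>\<^sup>2" using pos Y0 by (intro mult_left_mono) auto
  also have "\<dots> = (\<delta>\<^sup>2 * \<Lambda>) * Y + \<Theta> * \<delta>\<^sup>2" by (simp add: algebra_simps)
  also have "\<dots> \<le> 1 / 2 * Y + \<Theta> * 1" using \<delta> Y0 pos by (intro add_mono mult_right_mono mult_left_mono) auto
  finally have "l2norm (w s) \<le> 5 * \<mu> + (Y / 2 + \<Theta>)" if "s \<in> {c..d}" for s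
    using pt[OF that] by linarith
  then have "(SUP s\<in>{c..d}. l2norm (w s)) \<le> 5 * \<mu> + (Y / 2 + \<Theta>)"
    using t by (intro cSUP_least) auto
  then have "Y \<le> 5 * \<mu> + (Y / 2 + \<Theta>)" by (simp add: Y_def)
  then show "l2norm (w t) \<le> 10 * \<mu> + 2 * \<Theta>" using Y[of t] t by auto
qed

section \<open>Energy estimate for banded wave equations\<close>

text \<open>Instantiated later with H^-1/2 M H^-1/2, the symmetric form of H^-1 M. Semi-definiteness
  is stated for leading blocks, that is, for finitely supported vectors, so that no series has to
  converge.\<close>

locale banded_psd =
  fixes m :: "nat \<Rightarrow> nat \<Rightarrow> real" and b :: nat and B :: real
  assumes band: "m j k \<noteq> 0 \<Longrightarrow> j \<le> k + b \<and> k \<le> j + b"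
    and bound: "\<bar>m j k\<bar> \<le> B"
    and sym: "m j k = m k j"
    and psd: "0 \<le> (\<Sum>j<n. \<Sum>k<n. m j k * x j * x k)"
begin

definition mv :: "(nat \<Rightarrow> real) \<Rightarrow> nat \<Rightarrow> real" where
  "mv x j = (\<Sum>k<j+b+1. m j k * x k)"

lemma B_nonneg: "0 \<le> B" using bound[of 0 0] by linarith

text \<open>Schur test: Cauchy-Schwarz on the at most 2 b + 1 entries of a row gives a factor 2 b +
  1 in the square, and each x_k is met by at most 2 b + 1 rows, which gives the second one.\<close>

lemma L2_set_mv_le:
  assumes "summable (\<lambda>j. (x j)\<^sup>2)"
  shows "L2_set (mv x) {..<n} \<le> (2 * real b + 1) * B * l2norm x"
proof -
  define I where "I j = {k. j \<le> k + b \<and> k \<le> j + b}" for j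
  have I: "I j \<subseteq> {j - b..j + b}" for j by (auto simp: I_def)
  have I_fin: "finite (I j)" for j using I finite_subset by blast
  have "card (I j) \<le> card {j - b..j + b}" for j by (intro card_mono I) auto
  also have "card {j - b..j + b} \<le> 2 * b + 1" for j by auto
  finally have card: "card (I j) \<le> 2 * b + 1" for j .
  have sq: "(mv x j)\<^sup>2 \<le> (2 * real b + 1) * B\<^sup>2 * (\<Sum>k\<in>I j. (x k)\<^sup>2)" for j
  proof -
    have "mv x j = (\<Sum>k\<in>I j. m j k * x k)"
      unfolding mv_def by (rule sum.mono_neutral_right) (use band in \<open>force simp: I_def\<close>)+
    then have "(mv x j)\<^sup>2 = (\<Sum>k\<in>I j. m j k * x k)\<^sup>2" by simp
    also have "\<dots> \<le> (\<Sum>k\<in>I j. (m j k)\<^sup>2) * (\<Sum>k\<in>I j. (x k)\<^sup>2)"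
      by (rule Cauchy_Schwarz_ineq_sum)
    also have "\<dots> \<le> ((2 * real b + 1) * B\<^sup>2) * (\<Sum>k\<in>I j. (x k)\<^sup>2)"
    proof (intro mult_right_mono sum_nonneg)
      have "(m j k)\<^sup>2 \<le> B\<^sup>2" for k using bound[of j k] B_nonneg
        by (metis abs_le_square_iff abs_of_nonneg)
      then have "(\<Sum>k\<in>I j. (m j k)\<^sup>2) \<le> of_nat (card (I j)) * B\<^sup>2" by (intro sum_bounded_above)
      also have "\<dots> \<le> (2 * real b + 1) * B\<^sup>2"
        using card[of j] by (intro mult_right_mono) (simp_all flip: of_nat_le_iff)
      finally show "(\<Sum>k\<in>I j. (m j k)\<^sup>2) \<le> (2 * real b + 1) * B\<^sup>2" .
    qed auto
    finally show ?thesis .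
  qed
  have "(\<Sum>j<n. \<Sum>k\<in>I j. (x k)\<^sup>2) = (\<Sum>j<n. \<Sum>k<n+b. if k \<in> I j then (x k)\<^sup>2 else 0)"
  proof (rule sum.cong[OF refl])
    fix j assume "j \<in> {..<n}"
    then have "I j \<subseteq> {..<n+b}" by (auto simp: I_def)
    then have "I j = {..<n+b} \<inter> I j" by auto
    then show "(\<Sum>k\<in>I j. (x k)\<^sup>2) = (\<Sum>k<n+b. if k \<in> I j then (x k)\<^sup>2 else 0)"
      by (metis (no_types, lifting) finite_lessThan sum.inter_restrict sum.cong)
  qed
  also have "\<dots> = (\<Sum>k<n+b. \<Sum>j<n. if k \<in> I j then (x k)\<^sup>2 else 0)" by (rule sum.swap)
  also have "\<dots> \<le> (\<Sum>k<n+b. (2 * real b + 1) * (x k)\<^sup>2)"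
  proof (rule sum_mono)
    fix k
    have "(\<Sum>j<n. if k \<in> I j then (x k)\<^sup>2 else 0) = (\<Sum>j\<in>{..<n} \<inter> I k. (x k)\<^sup>2)"
      by (subst sum.inter_restrict) (auto simp: I_def intro!: sum.cong)
    also have "\<dots> = of_nat (card ({..<n} \<inter> I k)) * (x k)\<^sup>2" by simp
    also have "\<dots> \<le> (2 * real b + 1) * (x k)\<^sup>2"
    proof (intro mult_right_mono)
      have "card ({..<n} \<inter> I k) \<le> 2 * b + 1"
        using card[of k] card_mono[OF I_fin[of k], of "{..<n} \<inter> I k"] by simp
      then show "real (card ({..<n} \<inter> I k)) \<le> 2 * real b + 1" by linarith
    qed auto
    finally show "(\<Sum>j<n. if k \<in> I j then (x k)\<^sup>2 else 0) \<le> (2 * real b + 1) * (x k)\<^sup>2" .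
  qed
  also have "\<dots> = (2 * real b + 1) * (\<Sum>k<n+b. (x k)\<^sup>2)" by (simp add: sum_distrib_left)
  also have "\<dots> \<le> (2 * real b + 1) * (\<Sum>k. (x k)\<^sup>2)"
    using assms by (intro mult_left_mono sum_le_suminf) auto
  finally have II: "(\<Sum>j<n. \<Sum>k\<in>I j. (x k)\<^sup>2) \<le> (2 * real b + 1) * (\<Sum>k. (x k)\<^sup>2)" .
  have "(\<Sum>j<n. (mv x j)\<^sup>2) \<le> (\<Sum>j<n. (2 * real b + 1) * B\<^sup>2 * (\<Sum>k\<in>I j. (x k)\<^sup>2))"
    by (intro sum_mono sq)
  also have "\<dots> = ((2 * real b + 1) * B\<^sup>2) * (\<Sum>j<n. \<Sum>k\<in>I j. (x k)\<^sup>2)" by (simp add: sum_distrib_left)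
  also have "\<dots> \<le> ((2 * real b + 1) * B\<^sup>2) * ((2 * real b + 1) * (\<Sum>k. (x k)\<^sup>2))"
    by (intro mult_left_mono II) auto
  also have "\<dots> = ((2 * real b + 1) * B)\<^sup>2 * (\<Sum>k. (x k)\<^sup>2)" by (simp add: power2_eq_square algebra_simps)
  finally have "sqrt (\<Sum>j<n. (mv x j)\<^sup>2) \<le> sqrt (((2 * real b + 1) * B)\<^sup>2 * (\<Sum>k. (x k)\<^sup>2))"
    by (rule real_sqrt_le_mono)
  also have "\<dots> = (2 * real b + 1) * B * l2norm x"
    using B_nonneg by (simp add: real_sqrt_mult l2norm_def)
  finally show ?thesis by (simp add: L2_set_def)
qed

text \<open>The energy of the time integral \<open>z\<close> of \<open>w\<close> controls \<open>z' = w\<close> itself, so that initial data and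
  residual enter only through their \<open>l\<^sup>2\<close> norms.\<close>

lemma l2norm_solution_le:
  fixes w :: "real \<Rightarrow> nat \<Rightarrow> real"
  assumes T: "0 \<le> T"
    and w: "\<And>t j. t \<in> {0..T} \<Longrightarrow> ((\<lambda>s. w s j) has_real_derivative w' t j) (at t within {0..T})"
    and w': "\<And>t j. t \<in> {0..T} \<Longrightarrow>
      ((\<lambda>s. w' s j) has_real_derivative - mv (w t) j + r t j) (at t within {0..T})"
    and summ: "\<And>t. t \<in> {0..T} \<Longrightarrow> summable (\<lambda>j. (w t j)\<^sup>2)"
    and \<beta>: "summable (\<lambda>j. (\<beta> j)\<^sup>2)"
    and r: "\<And>t j. t \<in> {0..T} \<Longrightarrow> \<bar>r t j\<bar> \<le> \<beta> j"
    and w0: "\<And>j. \<bar>w 0 j\<bar> \<le> \<beta> j" and w'0: "\<And>j. \<bar>w' 0 j\<bar> \<le> \<beta> j"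
    and t: "t \<in> {0..T}"
  shows "l2norm (w t) \<le> (1 + 2 * T * (1 + T)) * l2norm \<beta>"
proof -
  define S where "S = l2norm \<beta>"
  have S0: "0 \<le> S" using l2norm_nonneg[OF \<beta>] by (simp add: S_def)
  have \<beta>_L2: "L2_set \<beta> {..<n} \<le> S" for n unfolding S_def by (rule L2_set_le_l2norm[OF \<beta>]) simp
  have dom: "L2_set x {..<n} \<le> c * S" if "\<And>j. \<bar>x j\<bar> \<le> c * \<beta> j" "0 \<le> c" for x c n
  proof -
    have "L2_set x {..<n} = L2_set (\<lambda>j. \<bar>x j\<bar>) {..<n}" by (simp add: L2_set_def)
    also have "\<dots> \<le> L2_set (\<lambda>j. c * \<beta> j) {..<n}" using that by (intro L2_set_mono) auto
    also have "\<dots> = c * L2_set \<beta> {..<n}" using that by (simp add: L2_set_right_distrib)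
    also have "\<dots> \<le> c * S" using \<beta>_L2 that by (intro mult_left_mono)
    finally show ?thesis .
  qed
  \<comment> \<open>A qualitative bound: it makes the supremum and the time integrals below finite,
    and its size does not enter the conclusion.\<close>
  have "\<exists>M. \<forall>t\<in>{0..T}. l2norm (w t) \<le> M"
  proof (rule l2norm_bounded_on_interval[OF w w' summ])
    fix t n assume t: "t \<in> {0..T}"
    have "L2_set (\<lambda>j. - mv (w t) j + r t j) {..<n} \<le> L2_set (\<lambda>j. - mv (w t) j) {..<n} + L2_set (r t) {..<n}"
      by (rule L2_set_triangle_ineq)
    also have "L2_set (\<lambda>j. - mv (w t) j) {..<n} = L2_set (mv (w t)) {..<n}" by (simp add: L2_set_def)
    also have "\<dots> \<le> (2 * real b + 1) * B * l2norm (w t)" by (rule L2_set_mv_le[OF summ[OF t]])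
    also have "L2_set (r t) {..<n} \<le> 1 * S" using r[OF t] by (intro dom) auto
    finally show "L2_set (\<lambda>j. - mv (w t) j + r t j) {..<n} \<le> (2 * real b + 1) * B * l2norm (w t) + S" by simp
  qed (use B_nonneg S0 in auto)
  then obtain M where M: "\<And>t. t \<in> {0..T} \<Longrightarrow> l2norm (w t) \<le> M" by blast
  have M0: "0 \<le> M" using M[OF t] l2norm_nonneg[OF summ[OF t]] by linarith
  have w_L2: "L2_set (w t) {..<n} \<le> M" if "t \<in> {0..T}" for t n
    using L2_set_le_l2norm[OF summ[OF that], of "{..<n}"] M[OF that] by simp
  have cont_w: "continuous_on {0..T} (\<lambda>t. w t j)" for j
    using w by (intro DERIV_continuous_on) auto
  define z where "z t j = integral {0..t} (\<lambda>s. w s j)" for t j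
  have z: "((\<lambda>s. z s j) has_real_derivative w t j) (at t within {0..T})" if "t \<in> {0..T}" for t j
    unfolding z_def using integral_has_real_derivative[OF cont_w that] .
  have z0: "z 0 j = 0" for j by (simp add: z_def)
  have cont_z: "continuous_on {0..T} (\<lambda>t. z t j)" for j
    using z by (intro DERIV_continuous_on) auto
  have z_L2: "L2_set (z t) {..<n} \<le> T * M" if t: "t \<in> {0..T}" for t n
  proof -
    define \<alpha> where "\<alpha> = L2_set (z t) {..<n}"
    have "norm ((\<Sum>j<n. z t j * z t j) - (\<Sum>j<n. z t j * z 0 j)) \<le> (\<alpha> * M) * norm (t - 0)"
    proof (rule field_differentiable_bound[of "{0..T}"])
      show "((\<lambda>s. \<Sum>j<n. z t j * z s j) has_real_derivative (\<Sum>j<n. z t j * w s j)) (at s within {0..T})"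
        if "s \<in> {0..T}" for s using z[OF that] by (auto intro!: derivative_eq_intros sum.cong)
      show "norm (\<Sum>j<n. z t j * w s j) \<le> \<alpha> * M" if "s \<in> {0..T}" for s
        using abs_sum_mult_le_L2_set[of "z t" "w s" "{..<n}"] w_L2[OF that]
          mult_left_mono[OF w_L2[OF that, of n], of \<alpha>] by (simp add: \<alpha>_def)
    qed (use t T in auto)
    then have "\<alpha> * \<alpha> \<le> \<alpha> * M * t"
      using t by (simp add: z0 \<alpha>_def L2_set_def real_sqrt_mult_self sum_nonneg power2_eq_square)
    then have "\<alpha> * \<alpha> \<le> \<alpha> * (M * t)" by (simp only: mult.assoc)
    moreover have "0 \<le> \<alpha>" by (simp add: \<alpha>_def)
    ultimately have "\<alpha> \<le> M * t" using M0 t by (cases "\<alpha> = 0") auto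
    also have "\<dots> \<le> M * T" using t M0 by (intro mult_left_mono) auto
    finally show ?thesis by (simp add: \<alpha>_def mult.commute)
  qed
  \<comment> \<open>One time integration of the equation: z'' = - mv z + \<rho>, where \<rho>(t) is
    w'(0) plus the integral of r. Thus w' is controlled coordinatewise by \<open>\<beta>\<close>
    once mv z is split off.\<close>
  define \<rho> where "\<rho> t j = w' t j + mv (z t) j" for t j
  have \<rho>: "\<bar>\<rho> t j\<bar> \<le> (1 + T) * \<beta> j" if t: "t \<in> {0..T}" for t j
  proof -
    have "norm (\<rho> t j - \<rho> 0 j) \<le> \<beta> j * norm (t - 0)"
    proof (rule field_differentiable_bound[of "{0..T}"])
      fix s assume s: "s \<in> {0..T}"
      have "((\<lambda>u. mv (z u) j) has_real_derivative mv (w s) j) (at s within {0..T})"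
        unfolding mv_def using z[OF s] by (auto intro!: derivative_eq_intros sum.cong)
      then show "((\<lambda>u. \<rho> u j) has_real_derivative r s j) (at s within {0..T})"
        unfolding \<rho>_def using w'[OF s] by (auto intro!: derivative_eq_intros)
      show "norm (r s j) \<le> \<beta> j" using r[OF s] by simp
    qed (use t T in auto)
    also have "\<dots> \<le> \<beta> j * T" using t abs_ge_zero[of "r 0 j"] r[of 0 j] T by (intro mult_left_mono) auto
    finally have "\<bar>\<rho> t j\<bar> \<le> \<bar>\<rho> 0 j\<bar> + \<beta> j * T" by simp
    moreover have "\<rho> 0 j = w' 0 j" by (simp add: \<rho>_def mv_def z0)
    ultimately show ?thesis using w'0[of j] by (simp add: algebra_simps)
  qed
  define Y where "Y = (SUP t\<in>{0..T}. l2norm (w t))"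
  have Y: "l2norm (w t) \<le> Y" if "t \<in> {0..T}" for t
    unfolding Y_def using that M by (intro cSUP_upper bdd_aboveI2[where M=M]) auto
  have Y0: "0 \<le> Y" using Y[OF t] l2norm_nonneg[OF summ[OF t]] by linarith
  define q where "q t i = (w t i)\<^sup>2 + (z t i)\<^sup>2" for t i
  have cont_q: "continuous_on {0..T} (\<lambda>t. q t i)" for i
    unfolding q_def by (intro continuous_intros cont_w cont_z)
  have q_nonneg: "0 \<le> q t i" for t i by (simp add: q_def)
  \<comment> \<open>Energy of z truncated to the first n indices; its kinetic part is that of z' =
    w.\<close>
  define E where "E n t = (\<Sum>j<n. (w t j)\<^sup>2) / 2 + (\<Sum>j<n. \<Sum>k<n. m j k * z t j * z t k) / 2" for n t
  define E' where "E' n t = (\<Sum>j<n. w t j * w' t j) + (\<Sum>j<n. \<Sum>k<n. m j k * w t j * z t k)" for n t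
  have E: "(E n has_real_derivative E' n t) (at t within {0..T})" if t: "t \<in> {0..T}" for n t
  proof -
    have "(E n has_real_derivative (\<Sum>j<n. 2 * w t j * w' t j) / 2
        + (\<Sum>j<n. \<Sum>k<n. m j k * w t j * z t k + m j k * z t j * w t k) / 2) (at t within {0..T})"
      unfolding E_def using w[OF t] z[OF t]
      by (auto intro!: derivative_eq_intros sum.cong simp: algebra_simps)
    moreover have "(\<Sum>j<n. \<Sum>k<n. m j k * z t j * w t k) = (\<Sum>j<n. \<Sum>k<n. m j k * w t j * z t k)"
      by (subst sum.swap) (simp add: sym mult_ac)
    ultimately show ?thesis
      by (simp add: E'_def sum.distrib mult.assoc flip: sum_distrib_left)
  qed
  \<comment> \<open>Truncation leaves a flux through the cut at n: the entries that couple an index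
    below n with one above lie in this window of width 2 b.\<close>
  define Q where "Q n t = (\<Sum>i=n-b..<n+b. q t i)" for n t
  have E'_le: "E' n t \<le> Y * ((1 + T) * S) + B * real b * Q n t" if t: "t \<in> {0..T}" for n t
  proof -
    have split: "mv (z t) j = (\<Sum>k<n. m j k * z t k) + (\<Sum>k=n..<n+b. m j k * z t k)" if "j < n" for j
    proof -
      have "mv (z t) j = (\<Sum>k<n+b. m j k * z t k)"
        using that band unfolding mv_def by (intro sum.mono_neutral_cong_left) force+
      also have "{..<n+b} = {..<n} \<union> {n..<n+b}" by auto
      also have "(\<Sum>k\<in>\<dots>. m j k * z t k) = (\<Sum>k<n. m j k * z t k) + (\<Sum>k=n..<n+b. m j k * z t k)"
        by (rule sum.union_disjoint) auto
      finally show ?thesis .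
    qed
    have "E' n t = (\<Sum>j<n. w t j * (w' t j + (\<Sum>k<n. m j k * z t k)))"
      unfolding E'_def by (simp add: distrib_left sum.distrib sum_distrib_left mult_ac)
    also have "\<dots> = (\<Sum>j<n. w t j * \<rho> t j - (\<Sum>k=n..<n+b. m j k * w t j * z t k))"
      by (rule sum.cong) (auto simp: \<rho>_def split algebra_simps sum_distrib_left)
    also have "\<dots> = (\<Sum>j<n. w t j * \<rho> t j) - (\<Sum>j<n. \<Sum>k=n..<n+b. m j k * w t j * z t k)"
      by (rule sum_subtractf)
    finally have E'_eq: "E' n t = \<dots>" .
    have "(\<Sum>j<n. w t j * \<rho> t j) \<le> Y * ((1 + T) * S)"
    proof -
      have "(\<Sum>j<n. w t j * \<rho> t j) \<le> L2_set (w t) {..<n} * L2_set (\<rho> t) {..<n}"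
        using abs_sum_mult_le_L2_set[of "w t" "\<rho> t" "{..<n}"] by linarith
      also have "\<dots> \<le> Y * ((1 + T) * S)"
        using Y[OF t] L2_set_le_l2norm[OF summ[OF t], of "{..<n}"] \<rho>[OF t] T Y0
        by (intro mult_mono dom) auto
      finally show ?thesis .
    qed
    moreover have "- (\<Sum>j<n. \<Sum>k=n..<n+b. m j k * w t j * z t k) \<le> B * real b * Q n t"
    proof -
      have "(\<Sum>j<n. \<Sum>k=n..<n+b. m j k * w t j * z t k) = (\<Sum>j=n-b..<n. \<Sum>k=n..<n+b. m j k * w t j * z t k)"
      proof (rule sum.mono_neutral_right)
        show "\<forall>j\<in>{..<n} - {n - b..<n}. (\<Sum>k=n..<n+b. m j k * w t j * z t k) = 0"
        proof
          fix j assume "j \<in> {..<n} - {n - b..<n}"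
          then have "m j k = 0" if "k \<ge> n" for k using band[of j k] that by force
          then show "(\<Sum>k=n..<n+b. m j k * w t j * z t k) = 0" by (intro sum.neutral) auto
        qed
      qed auto
      then have "- (\<Sum>j<n. \<Sum>k=n..<n+b. m j k * w t j * z t k)
          = (\<Sum>j=n-b..<n. \<Sum>k=n..<n+b. - (m j k * w t j * z t k))" by (simp add: sum_negf)
      also have "\<dots> \<le> (\<Sum>j=n-b..<n. \<Sum>k=n..<n+b. B * (w t j)\<^sup>2 + B * (z t k)\<^sup>2)"
      proof (intro sum_mono)
        fix j k
        have "- (m j k * w t j * z t k) \<le> \<bar>m j k\<bar> * (\<bar>w t j\<bar> * \<bar>z t k\<bar>)"
          by (metis abs_ge_minus_self abs_mult mult.assoc)
        also have "\<dots> \<le> B * ((w t j)\<^sup>2 + (z t k)\<^sup>2)"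
        proof (intro mult_mono bound B_nonneg)
          have "0 \<le> (\<bar>w t j\<bar> - \<bar>z t k\<bar>)\<^sup>2" by simp
          then have "2 * (\<bar>w t j\<bar> * \<bar>z t k\<bar>) \<le> (w t j)\<^sup>2 + (z t k)\<^sup>2"
            by (simp add: power2_diff)
          moreover have "0 \<le> \<bar>w t j\<bar> * \<bar>z t k\<bar>" by simp
          ultimately show "\<bar>w t j\<bar> * \<bar>z t k\<bar> \<le> (w t j)\<^sup>2 + (z t k)\<^sup>2" by linarith
        qed auto
        finally show "- (m j k * w t j * z t k) \<le> B * (w t j)\<^sup>2 + B * (z t k)\<^sup>2" by (simp add: distrib_left)
      qed
      also have "\<dots> = B * real b * (\<Sum>j=n-b..<n. (w t j)\<^sup>2) + B * real (n - (n - b)) * (\<Sum>k=n..<n+b. (z t k)\<^sup>2)"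
        by (simp add: sum.distrib mult_ac flip: sum_distrib_left sum_distrib_right)
      also have "\<dots> \<le> B * real b * (\<Sum>i=n-b..<n+b. (w t i)\<^sup>2) + B * real b * (\<Sum>i=n-b..<n+b. (z t i)\<^sup>2)"
        using B_nonneg by (intro add_mono mult_mono sum_mono2 mult_left_mono) (auto intro: sum_nonneg)
      also have "\<dots> = B * real b * Q n t" by (simp add: Q_def q_def sum.distrib distrib_left)
      finally show ?thesis .
    qed
    ultimately show ?thesis unfolding E'_eq by linarith
  qed
  \<comment> \<open>The flux is not known to be small uniformly in t, but the time integrals of
    \<open>q\<close> are summable over the index, so the flux integrated over [0,T] tends to 0 as n
    grows.\<close>
  define c where "c i = integral {0..T} (\<lambda>t. q t i)" for i
  have "summable c"
  proof (rule summableI_nonneg_bounded)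
    show "0 \<le> c i" for i unfolding c_def using q_nonneg cont_q
      by (intro integral_nonneg integrable_continuous_real) auto
    fix n
    have "(\<Sum>i<n. c i) = integral {0..T} (\<lambda>t. \<Sum>i<n. q t i)"
      unfolding c_def using cont_q by (subst integral_sum) (auto intro: integrable_continuous_real)
    also have "\<dots> \<le> integral {0..T} (\<lambda>t. M\<^sup>2 + (T * M)\<^sup>2)"
    proof (rule integral_le)
      show "(\<lambda>t. \<Sum>i<n. q t i) integrable_on {0..T}"
        using cont_q by (intro integrable_continuous_real continuous_on_sum)
      fix t assume t: "t \<in> {0..T}"
      have "(\<Sum>i<n. q t i) = (L2_set (w t) {..<n})\<^sup>2 + (L2_set (z t) {..<n})\<^sup>2"
        by (simp add: q_def L2_set_def sum.distrib sum_nonneg)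
      also have "\<dots> \<le> M\<^sup>2 + (T * M)\<^sup>2"
        using w_L2[OF t] z_L2[OF t] by (intro add_mono power_mono) auto
      finally show "(\<Sum>i<n. q t i) \<le> M\<^sup>2 + (T * M)\<^sup>2" .
    qed auto
    finally show "(\<Sum>i<n. c i) \<le> integral {0..T} (\<lambda>t. M\<^sup>2 + (T * M)\<^sup>2)" .
  qed
  then have c_lim: "c \<longlonglongrightarrow> 0" by (rule summable_LIMSEQ_zero)
  define \<epsilon> where "\<epsilon> n = B * real b * (\<Sum>i=n-b..<n+b. c i)" for n
  have "(\<lambda>n. c (i + n)) \<longlonglongrightarrow> 0" for i
    using LIMSEQ_ignore_initial_segment[OF c_lim, of i] by (simp add: add.commute)
  then have "(\<lambda>n. B * real b * (\<Sum>i<2*b. c (i + n))) \<longlonglongrightarrow> B * real b * (\<Sum>i<2*b. 0)"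
    by (intro tendsto_mult tendsto_const tendsto_sum)
  \<comment> \<open>The shift by b avoids the truncated subtraction \<open>n - b\<close>.\<close>
  then have "(\<lambda>n. \<epsilon> (n + b)) \<longlonglongrightarrow> 0"
  proof -
    assume L: "(\<lambda>n. B * real b * (\<Sum>i<2*b. c (i + n))) \<longlonglongrightarrow> B * real b * (\<Sum>i<2*b. 0)"
    have "(\<Sum>i=n+b-b..<n+b+b. c i) = (\<Sum>i<2*b. c (i + n))" for n
      using sum.shift_bounds_nat_ivl[of c 0 n "2*b"] by (simp add: atLeast0LessThan mult_2 add_ac)
    then show ?thesis using L by (simp add: \<epsilon>_def)
  qed
  then have \<epsilon>_lim: "\<epsilon> \<longlonglongrightarrow> 0" by (rule LIMSEQ_offset)
  have E0: "E n 0 \<le> S\<^sup>2 / 2" for n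
  proof -
    have "(L2_set (w 0) {..<n})\<^sup>2 \<le> (1 * S)\<^sup>2" using w0 by (intro power_mono dom) auto
    then show ?thesis by (simp add: E_def z0 L2_set_def sum_nonneg)
  qed
  have main: "(L2_set (w t) {..<n})\<^sup>2 / 2 \<le> S\<^sup>2 / 2 + T * (Y * ((1 + T) * S)) + \<epsilon> n" if t: "t \<in> {0..T}" for t n
  proof -
    define P where "P s = E n s - (s * (Y * ((1 + T) * S)) + B * real b * integral {0..s} (Q n))" for s
    have cont_Q: "continuous_on {0..T} (Q n)" unfolding Q_def by (intro continuous_intros cont_q)
    have P: "(P has_real_derivative E' n s - (Y * ((1 + T) * S) + B * real b * Q n s)) (at s within {0..T})"
      if "s \<in> {0..T}" for s
      unfolding P_def using E[OF that] integral_has_real_derivative[OF cont_Q that]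
      by (auto intro!: derivative_eq_intros)
    have "\<exists>s\<in>{0..t}. P t - P 0 = (E' n s - (Y * ((1 + T) * S) + B * real b * Q n s)) * (t - 0)"
    proof (rule mvt_very_simple)
      fix s assume s: "0 \<le> s" "s \<le> t"
      then have "s \<in> {0..T}" using t by auto
      from P[OF this] show "(P has_derivative (\<lambda>h. (E' n s - (Y * ((1 + T) * S) + B * real b * Q n s)) * h))
          (at s within {0..t})"
        using t unfolding has_field_derivative_def by (auto intro: has_derivative_subset)
    qed (use t in auto)
    then obtain s where s: "s \<in> {0..t}" "P t - P 0 = (E' n s - (Y * ((1 + T) * S) + B * real b * Q n s)) * t" by auto
    have "(E' n s - (Y * ((1 + T) * S) + B * real b * Q n s)) * t \<le> 0"
      using E'_le[of s n] s(1) t by (intro mult_nonpos_nonneg) auto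
    then have "P t \<le> P 0" using s(2) by linarith
    then have "E n t \<le> E n 0 + t * (Y * ((1 + T) * S)) + B * real b * integral {0..t} (Q n)"
      by (simp add: P_def)
    also have "t * (Y * ((1 + T) * S)) \<le> T * (Y * ((1 + T) * S))"
      using t Y0 S0 T by (intro mult_right_mono) auto
    also have "B * real b * integral {0..t} (Q n) \<le> B * real b * integral {0..T} (Q n)"
      using t B_nonneg cont_Q
      by (intro mult_left_mono integral_subset_le integrable_continuous_real)
        (auto intro: continuous_on_subset sum_nonneg q_nonneg simp: Q_def)
    also have "integral {0..T} (Q n) = (\<Sum>i=n-b..<n+b. c i)"
      unfolding Q_def c_def using cont_q by (subst integral_sum) (auto intro: integrable_continuous_real)
    finally have "E n t \<le> E n 0 + T * (Y * ((1 + T) * S)) + \<epsilon> n" by (simp add: \<epsilon>_def)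
    moreover have "(L2_set (w t) {..<n})\<^sup>2 / 2 \<le> E n t"
      using psd[of "z t" n] by (simp add: E_def L2_set_def sum_nonneg)
    ultimately show ?thesis using E0[of n] by linarith
  qed
  have sq: "(l2norm (w t))\<^sup>2 \<le> S\<^sup>2 + 2 * T * (Y * ((1 + T) * S))" if t: "t \<in> {0..T}" for t
  proof (rule LIMSEQ_le)
    have "(\<lambda>n. \<Sum>j<n. (w t j)\<^sup>2) \<longlonglongrightarrow> (\<Sum>j. (w t j)\<^sup>2)" by (rule summable_LIMSEQ[OF summ[OF t]])
    then show "(\<lambda>n. (L2_set (w t) {..<n})\<^sup>2) \<longlonglongrightarrow> (l2norm (w t))\<^sup>2"
      by (simp add: L2_set_def l2norm_def sum_nonneg suminf_nonneg[OF summ[OF t]])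
    show "(\<lambda>n. S\<^sup>2 + 2 * T * (Y * ((1 + T) * S)) + 2 * \<epsilon> n) \<longlonglongrightarrow> S\<^sup>2 + 2 * T * (Y * ((1 + T) * S))"
      using tendsto_add[OF tendsto_const tendsto_mult[OF tendsto_const \<epsilon>_lim]] by (metis mult_zero_right add_0_right)
    show "\<exists>N. \<forall>n\<ge>N. (L2_set (w t) {..<n})\<^sup>2 \<le> S\<^sup>2 + 2 * T * (Y * ((1 + T) * S)) + 2 * \<epsilon> n"
      using main[OF t] by (auto simp: field_simps)
  qed
  \<comment> \<open>For Y > S the term S^2 is at most S Y, so the quadratic inequality becomes Y^2
    \<le> (1 + 2 T (1 + T)) S Y and one factor Y cancels.\<close>
  have "Y \<le> (1 + 2 * T * (1 + T)) * S"
  proof (rule ccontr)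
    assume contr: "\<not> ?thesis"
    have "S \<le> (1 + 2 * T * (1 + T)) * S" using S0 T by (simp add: distrib_right)
    then have "S < Y" using contr by linarith
    have "(l2norm (w t))\<^sup>2 \<le> (1 + 2 * T * (1 + T)) * S * Y" if "t \<in> {0..T}" for t
    proof -
      have "S\<^sup>2 \<le> S * Y" using \<open>S < Y\<close> S0 by (simp add: power2_eq_square mult_left_mono)
      then show ?thesis using sq[OF that] by (simp add: algebra_simps)
    qed
    then have "l2norm (w t) \<le> sqrt ((1 + 2 * T * (1 + T)) * S * Y)" if "t \<in> {0..T}" for t
      using that by (intro real_le_rsqrt) auto
    then have "(SUP t\<in>{0..T}. l2norm (w t)) \<le> sqrt ((1 + 2 * T * (1 + T)) * S * Y)"
      using t by (intro cSUP_least) auto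
    then have "Y \<le> sqrt ((1 + 2 * T * (1 + T)) * S * Y)" by (simp add: Y_def)
    then have "Y\<^sup>2 \<le> (sqrt ((1 + 2 * T * (1 + T)) * S * Y))\<^sup>2" using Y0 by (intro power_mono)
    then have "Y\<^sup>2 \<le> (1 + 2 * T * (1 + T)) * S * Y" using Y0 S0 T by simp
    then have "Y \<le> (1 + 2 * T * (1 + T)) * S" using \<open>S < Y\<close> S0 by (simp add: power2_eq_square)
    then show False using contr by simp
  qed
  then show ?thesis using Y[OF t] by (simp add: S_def)
qed

end

section \<open>Coefficients of the SBP operators\<close>

definition ndist :: "nat \<Rightarrow> nat \<Rightarrow> nat" where
  "ndist j k = (j - k) + (k - j)"

text \<open>\<open>A = D\<^sub>+\<^sup>T Q D\<^sub>+\<close> for undivided forward differences \<open>D\<^sub>+\<close>: the entries of \<open>Q\<close> are the sums of the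
  entries of \<open>h A\<close> over the leading rectangles. \<open>Q\<close> is Toeplitz outside a leading block.\<close>

definition Q_block :: "nat \<Rightarrow> real list list" where
  "Q_block p =
     (if p = 1 then []
      else if p = 2 then [[9/8, -5/48, -1/48], [-5/48, 9/8, -1/48], [-1/48, -1/48, 9/8]]
      else
       [[15583/12960, -135959/518400, 4907/34560, -63601/518400, 4207/103680],
        [-135959/518400, 133147/86400, -7033/10800, 27059/51840, -25843/172800],
        [4907/34560, -7033/10800, 12931/5760, -2533/2700, 1399/6912],
        [-63601/518400, 27059/51840, -2533/2700, 450449/259200, -108911/518400],
        [4207/103680, -25843/172800, 1399/6912, -108911/518400, 37/30]])"

definition Q_stencil :: "nat \<Rightarrow> real list" where
  "Q_stencil p = (if p = 1 then [1] else if p = 2 then [7/6, -1/12] else [37/30, -23/180, 1/90])"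

definition Q_mat :: "nat \<Rightarrow> nat \<Rightarrow> nat \<Rightarrow> real" where
  "Q_mat p k l =
     (if k < length (Q_block p) \<and> l < length (Q_block p) then Q_block p ! k ! l
      else nth_default 0 (Q_stencil p) (ndist k l))"

text \<open>Bordering Q by a zero row and a zero column lets \<open>A_mat\<close> be one mixed
  second difference of entries, including row and column 0.\<close>

definition Q_shift :: "nat \<Rightarrow> nat \<Rightarrow> nat \<Rightarrow> real" where
  "Q_shift p j k = (if j = 0 \<or> k = 0 then 0 else Q_mat p (j - 1) (k - 1))"

definition A_mat :: "nat \<Rightarrow> nat \<Rightarrow> nat \<Rightarrow> real" where
  "A_mat p j k = Q_shift p j k - Q_shift p j (Suc k) - Q_shift p (Suc j) k + Q_shift p (Suc j) (Suc k)"

text \<open>Distances from the diagonal index this list: it is the symmetric stencil obtained by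
  expanding the powers of the difference operator in \<open>D_interior\<close>, as
  \<open>D_op_eq\<close> confirms.\<close>

definition D_stencil :: "nat \<Rightarrow> real list" where
  "D_stencil p = (if p = 1 then [-2, 1] else if p = 2 then [-5/2, 4/3, -1/12]
     else [-49/18, 3/2, -3/20, 1/90])"

definition D_mat :: "nat \<Rightarrow> nat \<Rightarrow> nat \<Rightarrow> real" where
  "D_mat p j k =
     (if j < length (D_boundary p) then nth_default 0 (D_boundary p ! j) k
      else nth_default 0 (D_stencil p) (ndist j k))"

definition S_mat :: "nat \<Rightarrow> nat \<Rightarrow> real" where
  "S_mat p k = nth_default 0 (S_row p) k"

definition H_mat :: "nat \<Rightarrow> nat \<Rightarrow> real" where
  "H_mat p j = nth_default 1 (H_boundary p) j"


text \<open>\<open>Q\<close> is diagonally dominant with respect to these weights; for \<open>p = 3\<close> it is not so with weights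
  \<open>1\<close>, since rows \<open>1\<close> and \<open>3\<close> fail. The geometric tail of the weights yields exponential decay of
  solutions of \<open>Q y = \<eta>\<close>.\<close>

definition dom_weight :: "nat \<Rightarrow> real" where
  "dom_weight k = (if k = 1 \<or> k = 3 then 11/10 else if k < 5 then 1 else (1/2) ^ (k - 4))"

section \<open>Finite checks on the coefficient tables and their consequences\<close>

lemma ndist_self [simp]: "ndist j j = 0"
  by (simp add: ndist_def)

lemma nth_default_list_bound:
  assumes "list_all (\<lambda>x. \<bar>x\<bar> \<le> c) xs" "\<bar>d\<bar> \<le> c"
  shows "\<bar>nth_default d xs i\<bar> \<le> (c::real)"
  using assms by (auto simp: nth_default_def list_all_length)

lemma list_all_iff_nat: "list_all P [0..<n] \<longleftrightarrow> (\<forall>j<n. P j)"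
  by (auto simp: list_all_iff)

text \<open>Exact rational check that the tabulated Q belongs to the tabulated D. The window
  contains every row below 6 and all columns these rows reach; \<open>HD_mat\<close> covers the rest
  by vanishing and by the Toeplitz structure.\<close>

lemma HD_mat_boundary:
  "list_all (\<lambda>p. list_all (\<lambda>j. list_all (\<lambda>k. H_mat p j * D_mat p j k =
     - A_mat p j k - (if j = 0 then S_mat p k else 0)) [0..<10]) [0..<6]) [1,2,3]"
  by code_simp

text \<open>Exactness up to degree p + 1 is what yields a truncation error of order h^p in these
  rows. The range below j + 9 covers each row, since tabulated rows have at most 9 entries.\<close>

lemma D_moments_boundary:
  "list_all (\<lambda>p. list_all (\<lambda>j. list_all (\<lambda>i. (\<Sum>k\<leftarrow>[0..<j+9]. D_mat p j k * (real k - real j) ^ i) =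
     (if i = 2 then 2 else 0)) [0..<p+2]) [0..<length (D_boundary p)]) [1,2,3]"
  by code_simp

text \<open>From row 7 on, the stencil of Q meets only the geometric tail of the weights, so a
  single computation settles all those rows.\<close>

lemma Q_dominant_boundary:
  "list_all (\<lambda>p. list_all (\<lambda>k. (\<Sum>l\<leftarrow>[0..<k]. \<bar>Q_mat p k l\<bar> * dom_weight l) +
      (\<Sum>l\<leftarrow>[Suc k..<k+5]. \<bar>Q_mat p k l\<bar> * dom_weight l) \<le>
     99/100 * (Q_mat p k k * dom_weight k)) [0..<7]) [1,2,3]"
  by code_simp

lemma coefficient_bounds:
  "list_all (\<lambda>p. list_all (\<lambda>k. list_all (\<lambda>l. \<bar>Q_block p ! k ! l\<bar> \<le> 3 \<and> Q_block p ! k ! l = Q_block p ! l ! k)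
     [0..<length (Q_block p)]) [0..<length (Q_block p)]) [1,2,3]"
  "list_all (\<lambda>p. list_all (\<lambda>r. length r \<le> 9 \<and> list_all (\<lambda>x. \<bar>x\<bar> \<le> 10) r) (D_boundary p)) [1,2,3]"
  "list_all (\<lambda>p. list_all (\<lambda>x. \<bar>x\<bar> \<le> 3) (Q_stencil p) \<and> list_all (\<lambda>x. \<bar>x\<bar> \<le> 10) (D_stencil p)
      \<and> list_all (\<lambda>x. \<bar>x\<bar> \<le> 4) (S_row p) \<and> list_all (\<lambda>x. 1/4 \<le> x \<and> x \<le> 2) (H_boundary p)) [1,2,3]"
  "list_all (\<lambda>p. length (Q_stencil p) \<le> 3 \<and> length (D_stencil p) \<le> 4 \<and> length (S_row p) \<le> 5 
      \<and> length (H_boundary p) \<le> 6 \<and> length (Q_block p) \<le> 5 \<and> length (D_boundary p) \<le> 6) [1,2,3]"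
  "list_all (\<lambda>p. list_all (\<lambda>k. Q_mat p k k \<ge> 1) [0..<5]) [1,2,3]"
  by code_simp+

lemma length_bounds:
  assumes "p \<in> {1, 2, 3}"
  shows "length (Q_stencil p) \<le> 3" "length (D_stencil p) \<le> 4" "length (S_row p) \<le> 5"
    "length (H_boundary p) \<le> 6" "length (Q_block p) \<le> 5" "length (D_boundary p) \<le> 6"
  using assms coefficient_bounds(4) by auto

lemma H_mat_bounds: "p \<in> {1, 2, 3} \<Longrightarrow> 1/4 \<le> H_mat p j" "p \<in> {1, 2, 3} \<Longrightarrow> H_mat p j \<le> 2"
  using coefficient_bounds(3) by (auto simp: H_mat_def nth_default_def list_all_length)

lemma S_mat_bound: "p \<in> {1, 2, 3} \<Longrightarrow> \<bar>S_mat p j\<bar> \<le> 4"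
  using coefficient_bounds(3) unfolding S_mat_def by (intro nth_default_list_bound) auto

lemma S_mat_eq_0: "p \<in> {1, 2, 3} \<Longrightarrow> 5 \<le> k \<Longrightarrow> S_mat p k = 0"
  using length_bounds(3)[of p] by (simp add: S_mat_def nth_default_beyond)

lemma Q_mat_bound: "p \<in> {1, 2, 3} \<Longrightarrow> \<bar>Q_mat p k l\<bar> \<le> 3"
  using coefficient_bounds(1,3) unfolding Q_mat_def
  by (auto simp: list_all_iff_nat intro!: nth_default_list_bound)

lemma Q_mat_sym: "p \<in> {1, 2, 3} \<Longrightarrow> Q_mat p k l = Q_mat p l k"
  using coefficient_bounds(1) unfolding Q_mat_def
  by (auto simp: list_all_iff_nat ndist_def add.commute)

lemma Q_mat_stencil: "p \<in> {1, 2, 3} \<Longrightarrow> 5 \<le> k \<or> 5 \<le> l \<Longrightarrow> Q_mat p k l = nth_default 0 (Q_stencil p) (ndist k l)"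
  using length_bounds(5)[of p] by (auto simp: Q_mat_def)

lemma Q_mat_band: "p \<in> {1, 2, 3} \<Longrightarrow> Q_mat p k l \<noteq> 0 \<Longrightarrow> k \<le> l + 4 \<and> l \<le> k + 4"
proof -
  assume p: "p \<in> {1, 2, 3}" and nz: "Q_mat p k l \<noteq> 0"
  show ?thesis
  proof (cases "5 \<le> k \<or> 5 \<le> l")
    case True
    then have "nth_default 0 (Q_stencil p) (ndist k l) \<noteq> 0" using nz Q_mat_stencil[OF p] by simp
    then have "ndist k l < 3" using length_bounds(1)[OF p]
      by (meson nth_default_beyond not_le order_less_le_trans)
    then show ?thesis by (auto simp: ndist_def)
  qed auto
qed

lemma Q_mat_diag: "p \<in> {1, 2, 3} \<Longrightarrow> 1 \<le> Q_mat p k k"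
proof -
  assume p: "p \<in> {1, 2, 3}"
  show ?thesis
  proof (cases "k < 5")
    case True
    then show ?thesis using p coefficient_bounds(5) by (auto simp: list_all_iff_nat)
  next
    case False
    then show ?thesis using p Q_mat_stencil[OF p, of k k]
      by (auto simp: Q_stencil_def nth_default_Cons)
  qed
qed

lemma dom_weight_pos: "0 < dom_weight k" by (simp add: dom_weight_def)

text \<open>For k at least 7 the neighbours carry weights 4, 2, 1/2 and 1/4 relative to that of k.
  The off-diagonal coefficients of Q are so small that even the two larger weights leave ample
  room.\<close>

lemma Q_mat_dominant:
  assumes p: "p \<in> {1, 2, 3}"
  shows "(\<Sum>l\<in>{..<k+5}-{k}. \<bar>Q_mat p k l\<bar> * dom_weight l) \<le> 99/100 * (Q_mat p k k * dom_weight k)"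
proof (cases "k < 7")
  case True
  have "(\<Sum>l\<leftarrow>[0..<k]. \<bar>Q_mat p k l\<bar> * dom_weight l) + (\<Sum>l\<leftarrow>[Suc k..<k+5]. \<bar>Q_mat p k l\<bar> * dom_weight l)
      \<le> 99/100 * (Q_mat p k k * dom_weight k)"
    using Q_dominant_boundary p True by (auto simp: list_all_iff_nat)
  moreover have "{..<k+5} - {k} = {0..<k} \<union> {Suc k..<k+5}" by auto
  then have "(\<Sum>l\<in>{..<k+5}-{k}. \<bar>Q_mat p k l\<bar> * dom_weight l) =
      (\<Sum>l\<leftarrow>[0..<k]. \<bar>Q_mat p k l\<bar> * dom_weight l) + (\<Sum>l\<leftarrow>[Suc k..<k+5]. \<bar>Q_mat p k l\<bar> * dom_weight l)"
    by (simp add: sum.union_disjoint interv_sum_list_conv_sum_set_nat)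
  ultimately show ?thesis by simp
next
  case False
  then obtain i where k: "k = i + 7" by (metis add.commute le_Suc_ex not_less)
  define u where "u = dom_weight k"
  have u: "0 < u" by (simp add: u_def dom_weight_pos)
  have wts: "dom_weight (i + 5) = 4 * u" "dom_weight (i + 6) = 2 * u" "dom_weight (i + 8) = u / 2"
      "dom_weight (i + 9) = u / 4"
    by (simp_all add: u_def dom_weight_def k power_add eval_nat_numeral)
  have Q: "Q_mat p k l = nth_default 0 (Q_stencil p) (ndist k l)" for l
    by (rule Q_mat_stencil) (use p k in auto)
  have "(\<Sum>l\<in>{..<k+5}-{k}. \<bar>Q_mat p k l\<bar> * dom_weight l) = (\<Sum>l\<in>{i+5, i+6, i+8, i+9}. \<bar>Q_mat p k l\<bar> * dom_weight l)"
  proof (rule sum.mono_neutral_right)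
    show "\<forall>l\<in>{..<k+5}-{k} - {i+5, i+6, i+8, i+9}. \<bar>Q_mat p k l\<bar> * dom_weight l = 0"
    proof
      fix l assume "l \<in> {..<k+5}-{k} - {i+5, i+6, i+8, i+9}"
      then have "3 \<le> ndist k l" by (auto simp: k ndist_def)
      then show "\<bar>Q_mat p k l\<bar> * dom_weight l = 0"
        using length_bounds(1)[OF p] by (simp add: Q nth_default_beyond)
    qed
  qed (auto simp: k)
  also have "\<dots> \<le> 99/100 * (Q_mat p k k * u)"
    using p u unfolding Q
    by (auto simp: wts ndist_def k Q_stencil_def nth_default_Cons numeral_2_eq_2)
  finally show ?thesis by (simp add: u_def)
qed

lemma D_mat_bound: "p \<in> {1, 2, 3} \<Longrightarrow> \<bar>D_mat p j k\<bar> \<le> 10"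
  using coefficient_bounds(2,3) unfolding D_mat_def
  by (auto intro!: nth_default_list_bound simp: list_all_length)

lemma D_mat_interior: "p \<in> {1, 2, 3} \<Longrightarrow> length (D_boundary p) \<le> j \<Longrightarrow>
  D_mat p j k = nth_default 0 (D_stencil p) (ndist j k)"
  by (auto simp: D_mat_def)

lemma D_stencil_eq_0: "p \<in> {1, 2, 3} \<Longrightarrow> 4 \<le> d \<Longrightarrow> nth_default 0 (D_stencil p) d = 0"
  using length_bounds(2)[of p] by (simp add: nth_default_beyond)

lemma D_mat_band: "p \<in> {1, 2, 3} \<Longrightarrow> D_mat p j k \<noteq> 0 \<Longrightarrow> j \<le> k + 8 \<and> k \<le> j + 8"
proof -
  assume p: "p \<in> {1, 2, 3}" and nz: "D_mat p j k \<noteq> 0"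
  show ?thesis
  proof (cases "length (D_boundary p) \<le> j")
    case True
    then have "ndist j k < 4" using nz D_mat_interior[OF p] D_stencil_eq_0[OF p] by (metis not_le)
    then show ?thesis by (auto simp: ndist_def)
  next
    case False
    then have "length (D_boundary p ! j) \<le> 9" using p coefficient_bounds(2) by (auto simp: list_all_length)
    moreover have "k < length (D_boundary p ! j)" using nz False
      by (simp add: D_mat_def) (meson nth_default_beyond not_le)
    ultimately show ?thesis using False length_bounds(6)[OF p] by auto
  qed
qed

text \<open>Entrywise form of \<open>H D = -A + B S\<close>. Away from the boundary it says that the
  stencil of D is the second difference of the stencil of Q, extended evenly across the
  diagonal.\<close>

lemma HD_mat:
  assumes p: "p \<in> {1, 2, 3}"
  shows "H_mat p j * D_mat p j k = - A_mat p j k - (if j = 0 then S_mat p k else 0)"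
proof -
  consider "j < 6" "k < 10" | "j < 6" "k \<ge> 10" | "j \<ge> 6" by linarith
  then show ?thesis
  proof cases
    case 1
    then show ?thesis using HD_mat_boundary p by (auto simp: list_all_iff_nat)
  next
    case 2
    have Q: "Q_mat p k' l' = 0" if "k' \<le> 6" "l' \<ge> 9" for k' l'
      using Q_mat_stencil[OF p, of k' l'] length_bounds(1)[OF p] that
      by (auto simp: nth_default_beyond ndist_def)
    have "D_mat p j k = 0"
    proof (cases "length (D_boundary p) \<le> j")
      case True
      then show ?thesis using 2 D_stencil_eq_0[OF p] by (simp add: D_mat_interior[OF p] ndist_def)
    next
      case False
      then have "length (D_boundary p ! j) \<le> 9" using p coefficient_bounds(2) by (auto simp: list_all_length)
      then show ?thesis using 2 False by (simp add: D_mat_def nth_default_beyond)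
    qed
    then show ?thesis using 2 Q S_mat_eq_0[OF p, of k] by (auto simp: A_mat_def Q_shift_def)
  next
    case 3
    have H: "H_mat p j = 1" using 3 length_bounds(4)[OF p] by (simp add: H_mat_def nth_default_beyond)
    obtain i where j: "j = Suc i" "5 \<le> i" using 3 by (cases j) auto
    have Q: "Q_mat p i l = nth_default 0 (Q_stencil p) (ndist i l)"
        "Q_mat p (Suc i) l = nth_default 0 (Q_stencil p) (ndist (Suc i) l)" for l
      using Q_mat_stencil[OF p] j by auto
    have Q0: "nth_default 0 (Q_stencil p) d = 0" if "d \<ge> 3" for d
      using length_bounds(1)[OF p] that by (simp add: nth_default_beyond)
    have D: "D_mat p j k = nth_default 0 (D_stencil p) (ndist j k)"
      using 3 length_bounds(6)[OF p] by (simp add: D_mat_interior[OF p])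
    have st:
      "nth_default 0 (D_stencil p) 0 = 2 * nth_default 0 (Q_stencil p) (Suc 0) - 2 * nth_default 0 (Q_stencil p) 0"
      "nth_default 0 (D_stencil p) (Suc d) = nth_default 0 (Q_stencil p) d + nth_default 0 (Q_stencil p) (Suc (Suc d))
          - 2 * nth_default 0 (Q_stencil p) (Suc d)" for d
      using p by (auto simp: D_stencil_def Q_stencil_def nth_default_Cons split: nat.splits)
    show ?thesis
    proof (cases k)
      case 0
      then show ?thesis unfolding H D using j Q0 D_stencil_eq_0[OF p, of "Suc i"]
        by (simp add: A_mat_def Q_shift_def Q ndist_def)
    next
      case (Suc l)
      consider d where "l = i + Suc d" | "l = i" | d where "i = l + Suc d"
        by (metis less_imp_Suc_add linorder_neqE_nat add_Suc_right)
      moreover have "A_mat p j k = nth_default 0 (Q_stencil p) (ndist i l) - nth_default 0 (Q_stencil p) (ndist i (Suc l))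
          - nth_default 0 (Q_stencil p) (ndist (Suc i) l) + nth_default 0 (Q_stencil p) (ndist (Suc i) (Suc l))"
        by (simp add: A_mat_def Q_shift_def Q j(1) Suc)
      ultimately show ?thesis unfolding H D
        by cases (simp_all add: j(1) Suc st ndist_def)
    qed
  qed
qed

lemma A_mat_sym: "p \<in> {1, 2, 3} \<Longrightarrow> A_mat p j k = A_mat p k j"
proof -
  assume p: "p \<in> {1, 2, 3}"
  have "Q_shift p j k = Q_shift p k j" for j k
    using Q_mat_sym[OF p, of "j-1" "k-1"] by (auto simp: Q_shift_def)
  then show ?thesis by (simp add: A_mat_def)
qed

lemma A_mat_bound: "p \<in> {1, 2, 3} \<Longrightarrow> \<bar>A_mat p j k\<bar> \<le> 12"
proof -
  assume p: "p \<in> {1, 2, 3}"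
  have "\<bar>Q_shift p j k\<bar> \<le> 3" for j k using Q_mat_bound[OF p] by (simp add: Q_shift_def)
  from this[of j k] this[of "Suc j" k] this[of j "Suc k"] this[of "Suc j" "Suc k"]
  show ?thesis unfolding A_mat_def by linarith
qed

lemma A_mat_band: "p \<in> {1, 2, 3} \<Longrightarrow> A_mat p j k \<noteq> 0 \<Longrightarrow> j \<le> k + 5 \<and> k \<le> j + 5"
proof -
  assume p: "p \<in> {1, 2, 3}" and nz: "A_mat p j k \<noteq> 0"
  have Q: "Q_shift p j' k' \<noteq> 0 \<Longrightarrow> j' \<le> k' + 4 \<and> k' \<le> j' + 4" for j' k'
    using Q_mat_band[OF p, of "j'-1" "k'-1"] by (auto simp: Q_shift_def split: if_splits)
  have "Q_shift p j k \<noteq> 0 \<or> Q_shift p j (Suc k) \<noteq> 0 \<or> Q_shift p (Suc j) k \<noteq> 0 \<or> Q_shift p (Suc j) (Suc k) \<noteq> 0"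
    using nz by (auto simp: A_mat_def)
  then show ?thesis using Q by (auto dest!: Q)
qed

section \<open>Summation by parts, coercivity and inversion of Q\<close>

lemma sum_by_parts_zero:
  fixes X v :: "nat \<Rightarrow> real"
  assumes "X 0 = 0" "v n = 0"
  shows "(\<Sum>j<n. (X j - X (Suc j)) * v j) = (\<Sum>j<n. X (Suc j) * (v (Suc j) - v j))"
proof -
  have "(\<Sum>j<n. (X j - X (Suc j)) * v j) = (\<Sum>j<n. X (Suc j) * (v (Suc j) - v j)) - v n * X n + v 0 * X 0"
    by (induct n) (auto simp: algebra_simps)
  then show ?thesis using assms by simp
qed

text \<open>Summation by parts in both indices: the terms at 0 vanish by the zero border in
  \<open>Q_shift\<close>, those at n by the assumptions.\<close>

lemma A_mat_form:
  assumes "v n = 0" "u n = 0"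
  shows "(\<Sum>j<n. \<Sum>k<n. A_mat p j k * v j * u k) =
    (\<Sum>j<n. \<Sum>k<n. Q_mat p j k * (v (Suc j) - v j) * (u (Suc k) - u k))"
proof -
  have *: "(\<Sum>k<n. A_mat p j k * u k) =
      (\<Sum>k<n. (Q_shift p j (Suc k) - Q_shift p (Suc j) (Suc k)) * (u (Suc k) - u k))" for j
    using sum_by_parts_zero[of "\<lambda>k. Q_shift p j k - Q_shift p (Suc j) k" u n] assms
    by (simp add: A_mat_def Q_shift_def algebra_simps)
  define X where "X j = (\<Sum>k<n. Q_shift p j (Suc k) * (u (Suc k) - u k))" for j
  have "(\<Sum>j<n. \<Sum>k<n. A_mat p j k * v j * u k) = (\<Sum>j<n. (\<Sum>k<n. A_mat p j k * u k) * v j)"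
    by (simp add: sum_distrib_right sum_distrib_left mult_ac)
  also have "\<dots> = (\<Sum>j<n. (X j - X (Suc j)) * v j)"
    unfolding * X_def by (simp add: left_diff_distrib sum_subtractf)
  also have "\<dots> = (\<Sum>j<n. X (Suc j) * (v (Suc j) - v j))"
    by (rule sum_by_parts_zero) (simp_all add: X_def Q_shift_def assms)
  also have "\<dots> = (\<Sum>j<n. \<Sum>k<n. Q_mat p j k * (v (Suc j) - v j) * (u (Suc k) - u k))"
    by (simp add: X_def Q_shift_def sum_distrib_right sum_distrib_left mult_ac)
  finally show ?thesis .
qed

text \<open>Gershgorin with weights: each product y_k y_l is split by Young's inequality in the
  ratio w_l : w_k, so that row k collects its weighted off-diagonal sum divided by w_k.\<close>

lemma dominant_imp_coercive:
  fixes Q :: "nat \<Rightarrow> nat \<Rightarrow> real"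
  assumes sym: "\<And>k l. Q k l = Q l k" and w: "\<And>k. 0 < w k"
    and dom: "\<And>k. k < n \<Longrightarrow> (\<Sum>l\<in>{..<n}-{k}. \<bar>Q k l\<bar> * w l) \<le> \<omega> * (Q k k * w k)"
    and diag: "\<And>k. q \<le> Q k k" and \<omega>: "\<omega> \<le> 1"
  shows "(1 - \<omega>) * q * (\<Sum>k<n. (y k)\<^sup>2) \<le> (\<Sum>k<n. \<Sum>l<n. Q k l * y k * y l)"
proof -
  define R where "R k = (\<Sum>l\<in>{..<n}-{k}. \<bar>Q k l\<bar> * (w l / w k) * (y k)\<^sup>2)" for k
  have off: "- (\<bar>Q k l\<bar> * (w l / w k) * (y k)\<^sup>2 + \<bar>Q l k\<bar> * (w k / w l) * (y l)\<^sup>2) / 2 \<le> Q k l * y k * y l" for k l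
  proof -
    define a b where "a = sqrt (w l / w k) * y k" and "b = sqrt (w k / w l) * y l"
    have ab: "a\<^sup>2 = w l / w k * (y k)\<^sup>2" "b\<^sup>2 = w k / w l * (y l)\<^sup>2"
      using w[of k] w[of l] by (simp_all add: a_def b_def power_mult_distrib)
    have "sqrt (w l / w k) * sqrt (w k / w l) = 1"
      using w[of k] w[of l] by (simp flip: real_sqrt_mult)
    then have y: "a * b = y k * y l" unfolding a_def b_def by (simp add: algebra_simps)
    have "\<bar>Q k l\<bar> * (2 * \<bar>a * b\<bar>) \<le> \<bar>Q k l\<bar> * (a\<^sup>2 + b\<^sup>2)"
    proof (rule mult_left_mono)
      have "0 \<le> (\<bar>a\<bar> - \<bar>b\<bar>)\<^sup>2" by simp
      then show "2 * \<bar>a * b\<bar> \<le> a\<^sup>2 + b\<^sup>2" by (simp add: power2_diff abs_mult)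
    qed simp
    moreover have "- (\<bar>Q k l\<bar> * \<bar>a * b\<bar>) \<le> Q k l * (a * b)" by (metis abs_ge_minus_self abs_mult minus_le_iff)
    ultimately have "- (\<bar>Q k l\<bar> * a\<^sup>2 + \<bar>Q k l\<bar> * b\<^sup>2) / 2 \<le> Q k l * (a * b)" by (simp add: algebra_simps)
    then show ?thesis by (simp add: ab y sym[of l k] mult.assoc)
  qed
  have diff: "(\<Sum>k<n. \<Sum>l<n. Q k l * y k * y l) = (\<Sum>k<n. Q k k * (y k)\<^sup>2) + (\<Sum>k<n. \<Sum>l\<in>{..<n}-{k}. Q k l * y k * y l)"
    by (simp add: sum.distrib[symmetric] sum.remove[of "{..<n}"] power2_eq_square mult.assoc)
  have "(\<Sum>k<n. \<Sum>l\<in>{..<n}-{k}. Q k l * y k * y l) \<ge>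
      (\<Sum>k<n. \<Sum>l\<in>{..<n}-{k}. - (\<bar>Q k l\<bar> * (w l / w k) * (y k)\<^sup>2 + \<bar>Q l k\<bar> * (w k / w l) * (y l)\<^sup>2) / 2)"
    by (intro sum_mono off)
  also have "(\<Sum>k<n. \<Sum>l\<in>{..<n}-{k}. - (\<bar>Q k l\<bar> * (w l / w k) * (y k)\<^sup>2 + \<bar>Q l k\<bar> * (w k / w l) * (y l)\<^sup>2) / 2)
     = - ((\<Sum>k<n. R k) + (\<Sum>k<n. \<Sum>l\<in>{..<n}-{k}. \<bar>Q l k\<bar> * (w k / w l) * (y l)\<^sup>2)) / 2"
    unfolding R_def sum.distrib[symmetric] sum_negf[symmetric] sum_divide_distrib ..
  also have "(\<Sum>k<n. \<Sum>l\<in>{..<n}-{k}. \<bar>Q l k\<bar> * (w k / w l) * (y l)\<^sup>2)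
      = (\<Sum>k<n. R k)"
  proof -
    have "(\<Sum>k<n. \<Sum>l\<in>{..<n}-{k}. f l k) = (\<Sum>l<n. \<Sum>k\<in>{..<n}-{l}. f l k)" for f :: "nat \<Rightarrow> nat \<Rightarrow> real"
    proof -
      have "(\<Sum>k<n. \<Sum>l\<in>{..<n}-{k}. f l k) = (\<Sum>k<n. \<Sum>l<n. if l \<noteq> k then f l k else 0)"
        by (intro sum.cong refl sum.mono_neutral_cong_left) auto
      also have "\<dots> = (\<Sum>l<n. \<Sum>k<n. if l \<noteq> k then f l k else 0)" by (rule sum.swap)
      also have "\<dots> = (\<Sum>l<n. \<Sum>k\<in>{..<n}-{l}. f l k)"
        by (intro sum.cong refl sum.mono_neutral_cong_right) auto
      finally show ?thesis .
    qed
    then show ?thesis by (simp add: R_def)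
  qed
  finally have off_sum: "- (\<Sum>k<n. R k) \<le> (\<Sum>k<n. \<Sum>l\<in>{..<n}-{k}. Q k l * y k * y l)" by simp
  have R: "R k \<le> \<omega> * Q k k * (y k)\<^sup>2" if "k < n" for k
  proof -
    have "R k = (\<Sum>l\<in>{..<n}-{k}. \<bar>Q k l\<bar> * w l) / w k * (y k)\<^sup>2"
      by (simp add: R_def sum_divide_distrib sum_distrib_right)
    also have "\<dots> \<le> \<omega> * (Q k k * w k) / w k * (y k)\<^sup>2"
      using dom[OF that] w[of k] by (intro mult_right_mono divide_right_mono) auto
    also have "\<dots> = \<omega> * Q k k * (y k)\<^sup>2" using w[of k] by simp
    finally show ?thesis .
  qed
  have "(1 - \<omega>) * q * (\<Sum>k<n. (y k)\<^sup>2) = (\<Sum>k<n. (1 - \<omega>) * q * (y k)\<^sup>2)" by (simp add: sum_distrib_left)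
  also have "\<dots> \<le> (\<Sum>k<n. (1 - \<omega>) * Q k k * (y k)\<^sup>2)"
    using diag \<omega> by (intro sum_mono mult_right_mono mult_left_mono) auto
  also have "\<dots> = (\<Sum>k<n. Q k k * (y k)\<^sup>2) - (\<Sum>k<n. \<omega> * Q k k * (y k)\<^sup>2)"
    by (simp add: left_diff_distrib sum_subtractf)
  also have "\<dots> \<le> (\<Sum>k<n. Q k k * (y k)\<^sup>2) - (\<Sum>k<n. R k)"
    using R by (intro diff_left_mono sum_mono) auto
  also have "\<dots> \<le> (\<Sum>k<n. \<Sum>l<n. Q k l * y k * y l)" using off_sum diff by linarith
  finally show ?thesis .
qed

lemma Q_mat_coercive:
  assumes p: "p \<in> {1, 2, 3}"
  shows "1/100 * (\<Sum>k<n. (y k)\<^sup>2) \<le> (\<Sum>k<n. \<Sum>l<n. Q_mat p k l * y k * y l)"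
proof -
  have "(1 - 99/100) * 1 * (\<Sum>k<n. (y k)\<^sup>2) \<le> (\<Sum>k<n. \<Sum>l<n. Q_mat p k l * y k * y l)"
  proof (rule dominant_imp_coercive[where w = dom_weight])
    fix k
    have "(\<Sum>l\<in>{..<n}-{k}. \<bar>Q_mat p k l\<bar> * dom_weight l) = (\<Sum>l\<in>({..<n}-{k}) \<inter> {..<k+5}. \<bar>Q_mat p k l\<bar> * dom_weight l)"
      by (rule sum.mono_neutral_right) (use Q_mat_band[OF p, of k] in force)+
    also have "\<dots> \<le> (\<Sum>l\<in>{..<k+5}-{k}. \<bar>Q_mat p k l\<bar> * dom_weight l)"
      by (rule sum_mono2) (auto intro: mult_nonneg_nonneg less_imp_le[OF dom_weight_pos])
    finally show "(\<Sum>l\<in>{..<n}-{k}. \<bar>Q_mat p k l\<bar> * dom_weight l) \<le> 99/100 * (Q_mat p k k * dom_weight k)"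
      using Q_mat_dominant[OF p, of k] by linarith
  qed (use Q_mat_sym[OF p] Q_mat_diag[OF p] dom_weight_pos in auto)
  then show ?thesis by simp
qed

text \<open>Jacobi iteration: with q the diagonal of Q, y is the Neumann series for Q = q - (q - Q)
  started at \<eta>/q. Dominance makes each step contract by 99/100 in the norm weighted by
  \<open>dom_weight\<close>, so y inherits the decay of \<eta>.\<close>

lemma Q_mat_solvable:
  assumes p: "p \<in> {1, 2, 3}" and \<eta>: "\<And>k. \<bar>\<eta> k\<bar> \<le> C * dom_weight k"
  obtains y K where "\<And>k. \<bar>y k\<bar> \<le> K * dom_weight k" "\<And>k. (\<Sum>l<k+5. Q_mat p k l * y l) = \<eta> k"
proof -
  define q where "q k = Q_mat p k k" for k
  have q: "1 \<le> q k" for k using Q_mat_diag[OF p] by (simp add: q_def)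
  have qnz: "q k \<noteq> 0" for k using q[of k] by auto
  define x where "x = rec_nat (\<lambda>k. \<eta> k / q k) (\<lambda>_ x k. - (\<Sum>l\<in>{..<k+5}-{k}. Q_mat p k l * x l) / q k)"
  have x0: "x 0 k = \<eta> k / q k" and xS: "x (Suc i) k = - (\<Sum>l\<in>{..<k+5}-{k}. Q_mat p k l * x i l) / q k" for i k
    by (simp_all add: x_def)
  have C: "0 \<le> C" using order_trans[OF abs_ge_zero \<eta>, of 0] dom_weight_pos[of 0] by (simp add: zero_le_mult_iff)
  have bnd: "\<bar>x i k\<bar> \<le> C * (99/100) ^ i * dom_weight k" for i k
  proof (induct i arbitrary: k)
    case 0
    have "\<bar>\<eta> k\<bar> / q k \<le> \<bar>\<eta> k\<bar> / 1" using q[of k] by (intro divide_left_mono) auto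
    then show ?case using \<eta>[of k] q[of k] by (simp add: x0 abs_divide)
  next
    case (Suc i)
    have "\<bar>\<Sum>l\<in>{..<k+5}-{k}. Q_mat p k l * x i l\<bar> \<le> (\<Sum>l\<in>{..<k+5}-{k}. \<bar>Q_mat p k l\<bar> * (C * (99/100) ^ i * dom_weight l))"
      by (rule order_trans[OF sum_abs]) (auto simp: abs_mult intro!: sum_mono mult_left_mono Suc)
    also have "\<dots> = C * (99/100) ^ i * (\<Sum>l\<in>{..<k+5}-{k}. \<bar>Q_mat p k l\<bar> * dom_weight l)"
      by (simp add: sum_distrib_left mult_ac)
    also have "\<dots> \<le> C * (99/100) ^ i * (99/100 * (q k * dom_weight k))"
      using C Q_mat_dominant[OF p, of k] by (intro mult_left_mono) (auto simp: q_def)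
    finally have "\<bar>\<Sum>l\<in>{..<k+5}-{k}. Q_mat p k l * x i l\<bar> \<le> C * (99/100) ^ Suc i * dom_weight k * q k"
      by (simp add: mult_ac)
    then show ?case using q[of k] by (simp add: xS abs_divide pos_divide_le_eq)
  qed
  have geo: "summable (\<lambda>i. C * (99/100) ^ i * dom_weight k)" for k
    by (intro summable_mult summable_mult2 summable_geometric) auto
  have summ: "summable (\<lambda>i. x i k)" for k
    by (rule summable_comparison_test'[OF geo[of k], of 0]) (use bnd in auto)
  define y where "y k = (\<Sum>i. x i k)" for k
  \<comment> \<open>100 is the sum of the geometric series with ratio 99/100.\<close>
  have "\<bar>y k\<bar> \<le> (100 * C) * dom_weight k" for k
  proof -
    have "summable (\<lambda>i. \<bar>x i k\<bar>)"
      by (rule summable_comparison_test'[OF geo[of k], of 0]) (use bnd in auto)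
    then have "\<bar>y k\<bar> \<le> (\<Sum>i. \<bar>x i k\<bar>)" unfolding y_def by (rule summable_rabs)
    also have "\<dots> \<le> (\<Sum>i. C * (99/100) ^ i * dom_weight k)"
      by (intro suminf_le bnd \<open>summable (\<lambda>i. \<bar>x i k\<bar>)\<close> geo)
    also have "\<dots> = C * (1 / (1 - 99/100)) * dom_weight k"
      by (subst suminf_mult2[symmetric], simp, subst suminf_mult, simp)
        (simp add: suminf_geometric)
    finally show ?thesis by simp
  qed
  moreover have "(\<Sum>l<k+5. Q_mat p k l * y l) = \<eta> k" for k
  proof -
    have "(\<Sum>l\<in>{..<k+5}-{k}. Q_mat p k l * y l) = (\<Sum>i. \<Sum>l\<in>{..<k+5}-{k}. Q_mat p k l * x i l)"
      unfolding y_def using summ by (subst suminf_sum) (auto simp: suminf_mult summable_mult)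
    also have "\<dots> = (\<Sum>i. - q k * x (Suc i) k)" using qnz by (simp add: xS)
    also have "\<dots> = - q k * (\<Sum>i. x (Suc i) k)"
      using summ[of k] by (intro suminf_mult) (subst summable_Suc_iff)
    also have "(\<Sum>i. x (Suc i) k) = y k - x 0 k" unfolding y_def by (rule suminf_split_head[OF summ])
    finally have "(\<Sum>l\<in>{..<k+5}-{k}. Q_mat p k l * y l) = - q k * (y k - \<eta> k / q k)" by (simp add: x0)
    moreover have "(\<Sum>l<k+5. Q_mat p k l * y l) = q k * y k + (\<Sum>l\<in>{..<k+5}-{k}. Q_mat p k l * y l)"
      by (subst sum.remove[of _ k]) (auto simp: q_def)
    ultimately show ?thesis using qnz[of k] by (simp add: algebra_simps)
  qed
  ultimately show thesis using that by blast
qed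

lemma stencil_sum:
  assumes "length c \<le> Suc L" "i + 2 * L < n"
  shows "(\<Sum>k<n. nth_default 0 c (ndist (i + L) k) * v k) = (\<Sum>d\<le>2*L. nth_default 0 c (ndist L d) * (v (i + d) :: real))"
proof -
  have "(\<Sum>k<n. nth_default 0 c (ndist (i + L) k) * v k) = (\<Sum>k\<in>{i..i+2*L}. nth_default 0 c (ndist (i + L) k) * v k)"
  proof (rule sum.mono_neutral_right)
    show "\<forall>k\<in>{..<n} - {i..i+2*L}. nth_default 0 c (ndist (i + L) k) * v k = 0"
    proof
      fix k assume "k \<in> {..<n} - {i..i+2*L}"
      then have "length c \<le> ndist (i + L) k" using assms by (auto simp: ndist_def)
      then show "nth_default 0 c (ndist (i + L) k) * v k = 0" by (simp add: nth_default_beyond)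
    qed
  qed (use assms in auto)
  also have "{i..i+2*L} = (+) i ` {..2*L}"
    by (simp add: atMost_atLeast0)
  also have "(\<Sum>k\<in>\<dots>. nth_default 0 c (ndist (i + L) k) * v k) = (\<Sum>d\<le>2*L. nth_default 0 c (ndist (i + L) (i + d)) * v (i + d))"
    by (subst sum.reindex) auto
  finally show ?thesis by (simp add: ndist_def)
qed

lemma D_mat_sum_interior:
  assumes p: "p \<in> {1, 2, 3}" and j: "length (D_boundary p) \<le> j"
  obtains i where "j = i + p" "(\<Sum>k<j+9. D_mat p j k * v k) = (\<Sum>d\<le>2*p. nth_default 0 (D_stencil p) (ndist p d) * v (i + d))"
proof -
  have "p \<le> j" "length (D_stencil p) \<le> Suc p" using p j by (auto simp: D_boundary_def D_stencil_def)
  then obtain i where i: "j = i + p" by (metis add.commute le_Suc_ex)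
  have "(\<Sum>k<j+9. D_mat p j k * v k) = (\<Sum>k<j+9. nth_default 0 (D_stencil p) (ndist (i + p) k) * v k)"
    using D_mat_interior[OF p j] by (simp add: i)
  also have "\<dots> = (\<Sum>d\<le>2*p. nth_default 0 (D_stencil p) (ndist p d) * v (i + d))"
    using \<open>length (D_stencil p) \<le> Suc p\<close> p by (intro stencil_sum) (auto simp: i)
  finally show thesis using that i by blast
qed

text \<open>Interior rows have j at least p, so the nested differences never evaluate
  \<open>D_minus\<close> at 0, where \<open>j - 1\<close> is truncated.\<close>

lemma D_op_eq:
  assumes p: "p \<in> {1, 2, 3}" and h: "h \<noteq> 0"
  shows "D_op p h v j = (\<Sum>k<j+9. D_mat p j k * v k) / h\<^sup>2"
proof (cases "length (D_boundary p) \<le> j")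
  case False
  then have len: "length (D_boundary p ! j) \<le> 9" using p coefficient_bounds(2) by (auto simp: list_all_length)
  have "row_apply (D_boundary p ! j) v = (\<Sum>k<j+9. D_mat p j k * v k)"
    unfolding row_apply_def using len False
    by (intro sum.mono_neutral_cong_left) (auto simp: D_mat_def nth_default_def)
  then show ?thesis using False by (simp add: D_op_def)
next
  case True
  obtain i where i: "j = i + p" and eq: "(\<Sum>k<j+9. D_mat p j k * v k) =
      (\<Sum>d\<le>2*p. nth_default 0 (D_stencil p) (ndist p d) * v (i + d))"
    using D_mat_sum_interior[OF p True] by blast
  have "D_op p h v j = D_interior p h v j" using True by (simp add: D_op_def)
  also have "\<dots> = (\<Sum>d\<le>2*p. nth_default 0 (D_stencil p) (ndist p d) * v (i + d)) / h\<^sup>2"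
  proof -
    consider "p = 1" | "p = 2" | "p = 3" using p by auto
    then show ?thesis
    proof cases
      case 1
      then show ?thesis using h
        by (simp add: i D_interior_def DD_def D_plus_def D_minus_def D_stencil_def ndist_def nth_default_Cons
            numeral_2_eq_2 divide_simps) (simp add: algebra_simps)?
    next
      case 2
      then show ?thesis using h
        by (simp add: i D_interior_def DD_def D_plus_def D_minus_def D_stencil_def ndist_def nth_default_Cons
            eval_nat_numeral divide_simps) (simp add: algebra_simps)?
    next
      case 3
      then show ?thesis using h
        by (simp add: i D_interior_def DD_def D_plus_def D_minus_def D_stencil_def ndist_def nth_default_Cons
            eval_nat_numeral divide_simps) (simp add: algebra_simps)?
    qed
  qed
  finally show ?thesis by (simp add: eq)
qed

section \<open>The constant alpha and semi-definiteness of M\<close>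

lemma sum_by_parts:
  fixes X v :: "nat \<Rightarrow> real"
  shows "(\<Sum>j<n. (X j - X (Suc j)) * v j) = (\<Sum>j<n. X (Suc j) * (v (Suc j) - v j)) - X n * v n + X 0 * v 0"
  by (induct n) (auto simp: algebra_simps)

text \<open>The first row of \<open>h S\<close> annihilates constants; \<open>sigma\<close> expresses it through forward
  differences.\<close>

definition sigma :: "nat \<Rightarrow> nat \<Rightarrow> real" where
  "sigma p k = - (\<Sum>i\<le>k. S_mat p i)"

lemma S_mat_sigma: "S_mat p (Suc k) = sigma p k - sigma p (Suc k)" "S_mat p 0 = - sigma p 0"
  by (simp_all add: sigma_def)

lemma sigma_eq_0:
  assumes p: "p \<in> {1, 2, 3}" and k: "4 \<le> k"
  shows "sigma p k = 0"
proof -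
  have "(\<Sum>i\<le>k. S_mat p i) = (\<Sum>i\<le>4. S_mat p i)"
    using k S_mat_eq_0[OF p] by (intro sum.mono_neutral_right) auto
  also have "\<dots> = 0" using p by (auto simp: S_mat_def S_row_def nth_default_Cons eval_nat_numeral)
  finally show ?thesis by (simp add: sigma_def)
qed

lemma S_mat_sum:
  "(\<Sum>k<n. S_mat p k * v k) = (\<Sum>k<n. sigma p k * (v (Suc k) - v k)) - (if n = 0 then 0 else sigma p (n - 1)) * v n"
proof -
  define X where "X k = (if k = 0 then 0 else sigma p (k - 1))" for k
  have "S_mat p k = X k - X (Suc k)" for k by (cases k) (simp_all add: X_def S_mat_sigma)
  then show ?thesis using sum_by_parts[of X v n] by (simp add: X_def)
qed

lemma grid_dot_eq:
  assumes "\<And>j. n \<le> j \<Longrightarrow> v j = 0"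
  shows "grid_dot v w = (\<Sum>j<n. v j * w j)"
  unfolding grid_dot_def
  by (rule sum.mono_neutral_left) (use assms not_less in auto)

lemma finite_support_bound:
  assumes "finite_support v"
  obtains n where "\<And>j. n \<le> j \<Longrightarrow> v j = 0"
proof -
  obtain n where "{j. v j \<noteq> 0} \<subseteq> {..<n}"
    using assms finite_nat_bounded unfolding finite_support_def by blast
  then show thesis using that[of n] by force
qed

lemma S0_apply_eq:
  assumes p: "p \<in> {1, 2, 3}" and v: "\<And>j. n \<le> j \<Longrightarrow> v j = 0"
  shows "S0_apply p h v = (\<Sum>k<n. S_mat p k * v k) / h"
proof -
  have "row_apply (S_row p) v = (\<Sum>k<n. S_mat p k * v k)"
  proof -
    have "row_apply (S_row p) v = (\<Sum>k<max n 5. S_mat p k * v k)"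
      unfolding row_apply_def using length_bounds(3)[OF p]
      by (intro sum.mono_neutral_cong_left) (auto simp: S_mat_def nth_default_def)
    also have "\<dots> = (\<Sum>k<n. S_mat p k * v k)"
      by (rule sum.mono_neutral_right) (use v not_less in auto)
    finally show ?thesis .
  qed
  then show ?thesis by (simp add: S0_apply_def)
qed

lemma A_op_eq:
  assumes p: "p \<in> {1, 2, 3}" and h: "h \<noteq> 0" and v: "\<And>j. n \<le> j \<Longrightarrow> v j = 0"
  shows "A_op p h v j = (\<Sum>k<n. A_mat p j k * v k) / h"
proof -
  have "(\<Sum>k<j+9. D_mat p j k * v k) = (\<Sum>k<max n (j+9). D_mat p j k * v k)"
    by (rule sum.mono_neutral_left) (use D_mat_band[OF p, of j] in force)+
  also have "\<dots> = (\<Sum>k<n. D_mat p j k * v k)"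
    by (rule sum.mono_neutral_right) (use v not_less in auto)
  finally have "Hdiag p h j * D_op p h v j = H_mat p j * (\<Sum>k<n. D_mat p j k * v k) / h"
    using h by (simp add: D_op_eq[OF p h] Hdiag_def H_mat_def power2_eq_square)
  then have D: "Hdiag p h j * D_op p h v j = (\<Sum>k<n. (H_mat p j * D_mat p j k) * v k) / h"
    by (simp add: sum_distrib_left mult.assoc)
  have S: "S0_apply p h v = (\<Sum>k<n. S_mat p k * v k) / h" by (rule S0_apply_eq[OF p v])
  show ?thesis
    unfolding A_op_def D HD_mat[OF p] S
    by (simp add: left_diff_distrib sum_negf sum_subtractf diff_divide_distrib)
qed

lemma A_shifted_form:
  assumes p: "p \<in> {1, 2, 3}" and h: "0 < h" and v: "\<And>j. n \<le> j \<Longrightarrow> v j = 0" and w: "\<And>j. n \<le> j \<Longrightarrow> w j = 0"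
  shows "grid_dot v (A_shifted p h a w) =
    ((\<Sum>j<n. \<Sum>k<n. Q_mat p j k * (v (Suc j) - v j) * (w (Suc k) - w k))
      - a * (\<Sum>k<n. sigma p k * (v (Suc k) - v k)) * (\<Sum>k<n. sigma p k * (w (Suc k) - w k))) / h"
proof -
  have S: "(\<Sum>k<n. S_mat p k * u k) = (\<Sum>k<n. sigma p k * (u (Suc k) - u k))" if "u n = 0" for u
    using that by (simp add: S_mat_sum)
  have "grid_dot v (A_shifted p h a w) = (\<Sum>j<n. v j * A_shifted p h a w j)" by (rule grid_dot_eq[OF v])
  also have "\<dots> = (\<Sum>j<n. v j * ((\<Sum>k<n. A_mat p j k * w k) / h - a * S_mat p j * (\<Sum>k<n. S_mat p k * w k) / h))"
    using h by (intro sum.cong refl)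
      (simp add: A_shifted_def A_op_eq[OF p _ w] S0_apply_eq[OF p w] S0_def S_mat_def[of p])
  also have "\<dots> = ((\<Sum>j<n. \<Sum>k<n. A_mat p j k * v j * w k) - a * (\<Sum>k<n. S_mat p k * v k) * (\<Sum>k<n. S_mat p k * w k)) / h"
    by (simp add: right_diff_distrib sum_subtractf diff_divide_distrib sum_distrib_left sum_distrib_right
        sum_divide_distrib mult_ac)
  also have "\<dots> = ((\<Sum>j<n. \<Sum>k<n. Q_mat p j k * (v (Suc j) - v j) * (w (Suc k) - w k))
      - a * (\<Sum>k<n. sigma p k * (v (Suc k) - v k)) * (\<Sum>k<n. sigma p k * (w (Suc k) - w k))) / h"
    using A_mat_form[of v n w p] S[of v] S[of w] v[of n] w[of n] by simp
  finally show ?thesis .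
qed

text \<open>Finitely supported v and their forward differences y correspond bijectively, so the
  condition on A becomes one on Q and \<sigma>; the mesh size survives only as an overall factor
  1/h.\<close>

lemma sym_psd_A_shifted_iff:
  assumes p: "p \<in> {1, 2, 3}" and h: "0 < h"
  shows "sym_psd (A_shifted p h a) \<longleftrightarrow>
    (\<forall>n y. a * (\<Sum>k<n. sigma p k * y k)\<^sup>2 \<le> (\<Sum>k<n. \<Sum>l<n. Q_mat p k l * y k * y l))"
proof
  assume psd: "sym_psd (A_shifted p h a)"
  show "\<forall>n y. a * (\<Sum>k<n. sigma p k * y k)\<^sup>2 \<le> (\<Sum>k<n. \<Sum>l<n. Q_mat p k l * y k * y l)"
  proof (intro allI)
    fix n and y :: "nat \<Rightarrow> real"
    \<comment> \<open>Summing from the right makes v vanish from n on, so that it has finite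
      support.\<close>
    define v where "v j = - (\<Sum>k=j..<n. y k)" for j
    have v0: "v j = 0" if "n \<le> j" for j using that by (simp add: v_def)
    have \<Delta>: "v (Suc j) - v j = y j" if "j < n" for j
      using that by (simp add: v_def sum.atLeast_Suc_lessThan)
    have "{j. v j \<noteq> 0} \<subseteq> {..<n}" using v0 not_less by auto
    then have "finite_support v" unfolding finite_support_def using finite_subset by blast
    then have "0 \<le> grid_dot v (A_shifted p h a v)" using psd by (simp add: sym_psd_def)
    also have "\<dots> = ((\<Sum>k<n. \<Sum>l<n. Q_mat p k l * y k * y l) - a * (\<Sum>k<n. sigma p k * y k) * (\<Sum>k<n. sigma p k * y k)) / h"
      by (simp add: A_shifted_form[OF p h v0 v0] \<Delta>)
    finally show "a * (\<Sum>k<n. sigma p k * y k)\<^sup>2 \<le> (\<Sum>k<n. \<Sum>l<n. Q_mat p k l * y k * y l)"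
      using h by (simp add: zero_le_divide_iff power2_eq_square mult.assoc)
  qed
next
  assume form: "\<forall>n y. a * (\<Sum>k<n. sigma p k * y k)\<^sup>2 \<le> (\<Sum>k<n. \<Sum>l<n. Q_mat p k l * y k * y l)"
  show "sym_psd (A_shifted p h a)"
    unfolding sym_psd_def
  proof (intro conjI allI impI)
    fix v w :: grid assume "finite_support v \<and> finite_support w"
    then obtain n1 n2 where n12: "\<And>j. n1 \<le> j \<Longrightarrow> v j = 0" "\<And>j. n2 \<le> j \<Longrightarrow> w j = 0"
      by (meson finite_support_bound)
    define n where "n = max n1 n2"
    have v: "\<And>j. n \<le> j \<Longrightarrow> v j = 0" and w: "\<And>j. n \<le> j \<Longrightarrow> w j = 0" using n12 by (auto simp: n_def)
    have "(\<Sum>j<n. \<Sum>k<n. Q_mat p j k * (v (Suc j) - v j) * (w (Suc k) - w k))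
        = (\<Sum>j<n. \<Sum>k<n. Q_mat p j k * (w (Suc j) - w j) * (v (Suc k) - v k))"
      by (subst sum.swap) (simp add: Q_mat_sym[OF p] mult_ac)
    then show "grid_dot v (A_shifted p h a w) = grid_dot w (A_shifted p h a v)"
      by (simp add: A_shifted_form[OF p h v w] A_shifted_form[OF p h w v] mult_ac)
  next
    fix v :: grid assume "finite_support v"
    then obtain n where v: "\<And>j. n \<le> j \<Longrightarrow> v j = 0" by (meson finite_support_bound)
    show "0 \<le> grid_dot v (A_shifted p h a v)"
      using form[rule_format, of "\<lambda>j. v (Suc j) - v j" n] h
      by (simp add: A_shifted_form[OF p h v v] power2_eq_square mult.assoc)
  qed
qed

text \<open>A \<open>GREATEST\<close> carries information only when the maximum is attained. The
  admissible set is nonempty by coercivity of Q, bounded above by testing with a unit vector, and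
  contains its supremum because every condition is linear in a.\<close>

lemma alpha_greatest:
  assumes p: "p \<in> {1, 2, 3}"
  shows "0 < alpha p" "alpha p * (\<Sum>k<n. sigma p k * y k)\<^sup>2 \<le> (\<Sum>k<n. \<Sum>l<n. Q_mat p k l * y k * y l)"
proof -
  define P where "P a \<longleftrightarrow> (\<forall>h>0. sym_psd (A_shifted p h a))" for a
  have P: "P a \<longleftrightarrow> (\<forall>n y. a * (\<Sum>k<n. sigma p k * y k)\<^sup>2 \<le> (\<Sum>k<n. \<Sum>l<n. Q_mat p k l * y k * y l))" for a
  proof
    assume "P a"
    then have "sym_psd (A_shifted p 1 a)" by (simp add: P_def)
    then show "\<forall>n y. a * (\<Sum>k<n. sigma p k * y k)\<^sup>2 \<le> (\<Sum>k<n. \<Sum>l<n. Q_mat p k l * y k * y l)"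
      by (rule sym_psd_A_shifted_iff[OF p zero_less_one, THEN iffD1])
  next
    assume form: "\<forall>n y. a * (\<Sum>k<n. sigma p k * y k)\<^sup>2 \<le> (\<Sum>k<n. \<Sum>l<n. Q_mat p k l * y k * y l)"
    show "P a"
      unfolding P_def using sym_psd_A_shifted_iff[OF p, THEN iffD2, OF _ form] by blast
  qed
  define c where "c = (\<Sum>k<4. (sigma p k)\<^sup>2) + 1"
  have c: "0 < c" unfolding c_def by (intro add_nonneg_pos sum_nonneg) auto
  \<comment> \<open>Cauchy-Schwarz gives the factor c, and 1/100 is the coercivity constant of
    Q.\<close>
  have P0: "P (1 / (100 * c))"
    unfolding P
  proof (intro allI)
    fix n and y :: "nat \<Rightarrow> real"
    have "(\<Sum>k<n. sigma p k * y k)\<^sup>2 \<le> (\<Sum>k<n. (sigma p k)\<^sup>2) * (\<Sum>k<n. (y k)\<^sup>2)"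
      by (rule Cauchy_Schwarz_ineq_sum)
    also have "\<dots> \<le> c * (\<Sum>k<n. (y k)\<^sup>2)"
    proof (intro mult_right_mono sum_nonneg)
      have "(\<Sum>k<n. (sigma p k)\<^sup>2) \<le> (\<Sum>k<max n 4. (sigma p k)\<^sup>2)" by (intro sum_mono2) auto
      also have "\<dots> = (\<Sum>k<4. (sigma p k)\<^sup>2)"
        by (rule sum.mono_neutral_right) (auto simp: sigma_eq_0[OF p])
      finally show "(\<Sum>k<n. (sigma p k)\<^sup>2) \<le> c" by (simp add: c_def)
    qed auto
    finally have "1 / (100 * c) * (\<Sum>k<n. sigma p k * y k)\<^sup>2 \<le> 1 / (100 * c) * (c * (\<Sum>k<n. (y k)\<^sup>2))"
      using c by (intro mult_left_mono) auto
    also have "\<dots> = 1/100 * (\<Sum>k<n. (y k)\<^sup>2)" using c by simp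
    also have "\<dots> \<le> (\<Sum>k<n. \<Sum>l<n. Q_mat p k l * y k * y l)" by (rule Q_mat_coercive[OF p])
    finally show "1 / (100 * c) * (\<Sum>k<n. sigma p k * y k)\<^sup>2 \<le> (\<Sum>k<n. \<Sum>l<n. Q_mat p k l * y k * y l)" .
  qed
  have sigma0: "sigma p 0 \<noteq> 0" using p by (auto simp: sigma_def S_mat_def S_row_def)
  \<comment> \<open>The constant function 1, taken with n = 1, acts as the unit vector e_0.\<close>
  have upper: "a \<le> Q_mat p 0 0 / (sigma p 0)\<^sup>2" if "P a" for a
    using that[unfolded P, rule_format, of "\<lambda>_. 1" 1] sigma0 by (simp add: field_simps)
  have bdd: "bdd_above {a. P a}" by (rule bdd_aboveI) (use upper in blast)
  define s where "s = Sup {a. P a}"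
  have Ps: "P s"
    unfolding P
  proof (intro allI)
    fix n and y :: "nat \<Rightarrow> real"
    define q x where "q = (\<Sum>k<n. \<Sum>l<n. Q_mat p k l * y k * y l)" and "x = (\<Sum>k<n. sigma p k * y k)\<^sup>2"
    have le: "a * x \<le> q" if "P a" for a using that unfolding P q_def x_def by blast
    show "s * x \<le> q"
    proof (cases "x = 0")
      case True
      then show ?thesis using le[OF P0] by simp
    next
      case False
      then have "0 < x" by (simp add: x_def)
      then have "s \<le> q / x" unfolding s_def using P0 le by (intro cSup_least) (auto simp: pos_le_divide_eq)
      then show ?thesis using \<open>0 < x\<close> by (simp add: pos_le_divide_eq)
    qed
  qed
  have le_s: "a \<le> s" if "P a" for a unfolding s_def using that bdd by (intro cSup_upper) auto
  have alpha: "alpha p = s"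
    unfolding alpha_def P_def[symmetric] by (rule Greatest_equality[where P = P, OF Ps le_s])
  have "0 < 1 / (100 * c)" using c by simp
  also have "\<dots> \<le> s" by (rule le_s[OF P0])
  finally show "0 < alpha p" by (simp add: alpha)
  show "alpha p * (\<Sum>k<n. sigma p k * y k)\<^sup>2 \<le> (\<Sum>k<n. \<Sum>l<n. Q_mat p k l * y k * y l)"
    unfolding alpha using Ps unfolding P by blast
qed

text \<open>\<open>h (A + E\<^sub>0 S + S\<^sup>T E\<^sub>0 + (\<tau>/h) E\<^sub>0)\<close>: the scheme reads \<open>u\<^sub>t\<^sub>t = - (h H)\<^sup>-\<^sup>1 M u + \<dots>\<close>\<close>

definition M_mat :: "nat \<Rightarrow> real \<Rightarrow> nat \<Rightarrow> nat \<Rightarrow> real" where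
  "M_mat p \<tau> j k = A_mat p j k + (if j = 0 then S_mat p k else 0) + (if k = 0 then S_mat p j else 0)
     + (if j = 0 \<and> k = 0 then \<tau> else 0)"

lemma M_mat_sym: "p \<in> {1, 2, 3} \<Longrightarrow> M_mat p \<tau> j k = M_mat p \<tau> k j"
  by (simp add: M_mat_def A_mat_sym[of p j k])

lemma M_mat_bound:
  assumes p: "p \<in> {1, 2, 3}"
  shows "\<bar>M_mat p \<tau> j k\<bar> \<le> 20 + \<bar>\<tau>\<bar>"
proof -
  define a b c d where "a = A_mat p j k" and "b = (if j = 0 then S_mat p k else 0)"
    and "c = (if k = 0 then S_mat p j else 0)" and "d = (if j = 0 \<and> k = 0 then \<tau> else 0)"
  have "\<bar>a\<bar> \<le> 12" "\<bar>b\<bar> \<le> 4" "\<bar>c\<bar> \<le> 4" "\<bar>d\<bar> \<le> \<bar>\<tau>\<bar>"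
    using A_mat_bound[OF p] S_mat_bound[OF p] by (simp_all add: a_def b_def c_def d_def)
  moreover have "M_mat p \<tau> j k = a + b + c + d" by (simp add: M_mat_def a_def b_def c_def d_def)
  ultimately show ?thesis by linarith
qed

lemma M_mat_band: "p \<in> {1, 2, 3} \<Longrightarrow> M_mat p \<tau> j k \<noteq> 0 \<Longrightarrow> j \<le> k + 5 \<and> k \<le> j + 5"
proof (rule ccontr)
  assume p: "p \<in> {1, 2, 3}" and nz: "M_mat p \<tau> j k \<noteq> 0" and far: "\<not> (j \<le> k + 5 \<and> k \<le> j + 5)"
  have "A_mat p j k = 0" using A_mat_band[OF p, of j k] far by blast
  moreover have "k = 0 \<Longrightarrow> S_mat p j = 0" "j = 0 \<Longrightarrow> S_mat p k = 0"
    using far by (auto intro!: S_mat_eq_0[OF p])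
  ultimately show False using nz far by (auto simp: M_mat_def split: if_splits)
qed

lemma complete_square: "0 < a \<Longrightarrow> a * s\<^sup>2 + v * s + v * s + 1 / a * v\<^sup>2 = a * (s + v / a)\<^sup>2" for a s v :: real
  by (simp add: power2_eq_square field_simps)

text \<open>With s the first row of h S applied to v, the definition of \<alpha> and \<tau> \<ge>
  1/\<alpha> give the lower bound \<alpha> s^2 + 2 v_0 s + v_0^2 / \<alpha>, a complete
  square.\<close>

lemma M_mat_psd:
  assumes p: "p \<in> {1, 2, 3}" and \<tau>: "tau_crit p \<le> \<tau>"
  shows "0 \<le> (\<Sum>j<n. \<Sum>k<n. M_mat p \<tau> j k * x j * x k)"
proof (cases "n = 0")
  case False
  \<comment> \<open>Extension by zero, so that summation by parts leaves no term at n even when x n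
    is nonzero.\<close>
  define v where "v j = (if j < n then x j else 0)" for j
  define s where "s = (\<Sum>k<n. S_mat p k * v k)"
  define y where "y j = v (Suc j) - v j" for j
  have vn: "v n = 0" by (simp add: v_def)
  have s: "s = (\<Sum>k<n. sigma p k * y k)" by (simp add: s_def S_mat_sum vn y_def)
  have "(\<Sum>j<n. \<Sum>k<n. M_mat p \<tau> j k * x j * x k) = (\<Sum>j<n. \<Sum>k<n. M_mat p \<tau> j k * v j * v k)"
    by (simp add: v_def)
  also have "\<dots> = (\<Sum>j<n. \<Sum>k<n. A_mat p j k * v j * v k)
      + (\<Sum>j<n. \<Sum>k<n. (if j = 0 then S_mat p k else 0) * v j * v k)
      + (\<Sum>j<n. \<Sum>k<n. (if k = 0 then S_mat p j else 0) * v j * v k)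
      + (\<Sum>j<n. \<Sum>k<n. (if j = 0 \<and> k = 0 then \<tau> else 0) * v j * v k)"
    by (simp only: M_mat_def distrib_right sum.distrib)
  finally have split: "(\<Sum>j<n. \<Sum>k<n. M_mat p \<tau> j k * x j * x k) = \<dots>" .
  have S1: "(\<Sum>j<n. \<Sum>k<n. (if k = 0 then S_mat p j else 0) * v j * v k) = v 0 * s"
  proof -
    have "(\<Sum>k<n. (if k = 0 then S_mat p j else 0) * v j * v k) = S_mat p j * v j * v 0" for j
      using False by (subst sum.remove[of _ 0]) auto
    then show ?thesis by (simp add: s_def sum_distrib_left mult_ac)
  qed
  have S2: "(\<Sum>j<n. \<Sum>k<n. (if j = 0 then S_mat p k else 0) * v j * v k) = v 0 * s"
  proof -
    have "(\<Sum>j<n. \<Sum>k<n. (if j = 0 then S_mat p k else 0) * v j * v k) = (\<Sum>k<n. S_mat p k * v 0 * v k)"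
      using False by (subst sum.remove[of _ 0]) auto
    then show ?thesis by (simp add: s_def sum_distrib_left mult_ac)
  qed
  have S3: "(\<Sum>j<n. \<Sum>k<n. (if j = 0 \<and> k = 0 then \<tau> else 0) * v j * v k) = \<tau> * (v 0)\<^sup>2"
  proof -
    have "(\<Sum>j<n. \<Sum>k<n. (if j = 0 \<and> k = 0 then \<tau> else 0) * v j * v k) = (\<Sum>k<n. (if k = 0 then \<tau> else 0) * v 0 * v k)"
      using False by (subst sum.remove[of _ 0]) auto
    also have "\<dots> = \<tau> * (v 0)\<^sup>2" using False by (subst sum.remove[of _ 0]) (auto simp: power2_eq_square)
    finally show ?thesis .
  qed
  have S4: "(\<Sum>j<n. \<Sum>k<n. A_mat p j k * v j * v k) = (\<Sum>j<n. \<Sum>k<n. Q_mat p j k * y j * y k)"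
    unfolding y_def by (rule A_mat_form[where v = v and u = v, OF vn vn])
  have eq: "(\<Sum>j<n. \<Sum>k<n. M_mat p \<tau> j k * x j * x k) =
      (\<Sum>j<n. \<Sum>k<n. Q_mat p j k * y j * y k) + v 0 * s + v 0 * s + \<tau> * (v 0)\<^sup>2"
    unfolding split S1 S2 S3 S4 ..
  have \<alpha>: "0 < alpha p" by (rule alpha_greatest(1)[OF p])
  define q where "q = (\<Sum>j<n. \<Sum>k<n. Q_mat p j k * y j * y k)"
  have "alpha p * s\<^sup>2 \<le> q" unfolding s q_def by (rule alpha_greatest(2)[OF p])
  moreover have "1 / alpha p * (v 0)\<^sup>2 \<le> \<tau> * (v 0)\<^sup>2"
    using \<tau> unfolding tau_crit_def by (rule mult_right_mono) simp
  moreover have "0 \<le> alpha p * (s + v 0 / alpha p)\<^sup>2" using \<alpha> by simp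
  ultimately have "0 \<le> q + v 0 * s + v 0 * s + \<tau> * (v 0)\<^sup>2"
    using complete_square[OF \<alpha>, of s "v 0"] by linarith
  then show ?thesis by (simp only: eq q_def)
qed simp

section \<open>The stationary boundary problem\<close>

text \<open>From k = 4 on \<open>dom_weight\<close> equals 16 (1/2)^k; the factor 20 leaves some
  slack.\<close>

lemma dom_weight_bounds: "(1/2) ^ k \<le> dom_weight k" "dom_weight k \<le> 20 * (1/2) ^ k"
proof -
  have "k = 0 \<or> k = 1 \<or> k = 2 \<or> k = 3 \<or> k = 4 \<or> k = (k - 5) + 5" by linarith
  then have "k = 0 \<or> k = 1 \<or> k = 2 \<or> k = 3 \<or> k = 4 \<or> (\<exists>i. k = i + 5)" by blast
  then show "(1/2) ^ k \<le> dom_weight k" "dom_weight k \<le> 20 * (1/2) ^ k"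
    by (auto simp: dom_weight_def power_add eval_nat_numeral)
qed

lemma Q_mat_solvable_finite_rhs:
  assumes p: "p \<in> {1, 2, 3}" and \<eta>: "\<And>k. n \<le> k \<Longrightarrow> \<eta> k = 0"
  obtains y K where "\<And>k. \<bar>y k\<bar> \<le> K * (1/2) ^ k" "\<And>k. (\<Sum>l<k+5. Q_mat p k l * y l) = \<eta> k"
proof -
  define C where "C = (\<Sum>k<n. \<bar>\<eta> k\<bar> * 2 ^ k)"
  have C0: "0 \<le> C" by (auto simp: C_def intro: sum_nonneg)
  have "\<bar>\<eta> k\<bar> \<le> C * dom_weight k" for k
  proof (cases "k < n")
    case True
    have "\<bar>\<eta> k\<bar> * 2 ^ k \<le> C" unfolding C_def by (rule member_le_sum) (use True in auto)
    then have "\<bar>\<eta> k\<bar> * 2 ^ k * (1/2) ^ k \<le> C * (1/2) ^ k" by (rule mult_right_mono) simp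
    also have "\<bar>\<eta> k\<bar> * 2 ^ k * (1/2) ^ k = \<bar>\<eta> k\<bar>" by (simp add: power_divide)
    also have "C * (1/2) ^ k \<le> C * dom_weight k" by (rule mult_left_mono[OF dom_weight_bounds(1) C0])
    finally show ?thesis .
  next
    case False
    then show ?thesis using \<eta>[of k] C0 dom_weight_pos[of k] by simp
  qed
  then obtain y K where y: "\<And>k. \<bar>y k\<bar> \<le> K * dom_weight k" "\<And>k. (\<Sum>l<k+5. Q_mat p k l * y l) = \<eta> k"
    using Q_mat_solvable[OF p] by blast
  have K: "0 \<le> K" using order_trans[OF abs_ge_zero y(1), of 0] dom_weight_pos[of 0] by (simp add: zero_le_mult_iff)
  have "\<bar>y k\<bar> \<le> (20 * K) * (1/2) ^ k" for k
    using y(1)[of k] mult_left_mono[OF dom_weight_bounds(2)[of k] K] by simp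
  then show thesis using y(2) that by blast
qed

lemma geometric_dominated_tail:
  fixes y :: "nat \<Rightarrow> real"
  assumes "\<And>k. \<bar>y k\<bar> \<le> K * (1/2) ^ k"
  shows "summable y" "\<bar>(\<Sum>k<j. y k) - (\<Sum>k. y k)\<bar> \<le> 2 * K * (1/2) ^ j"
proof -
  have geo: "summable (\<lambda>k. K * (1/2) ^ (k + j))" for j
    by (intro summable_mult summable_ignore_initial_segment[of "\<lambda>k. (1/2)^k"] summable_geometric) auto
  show s: "summable y"
    by (rule summable_comparison_test'[OF geo[of 0], of 0]) (use assms in auto)
  have sa: "summable (\<lambda>k. \<bar>y (k + j)\<bar>)"
    by (rule summable_comparison_test'[OF geo[of j], of 0]) (use assms in auto)
  have "\<bar>(\<Sum>k<j. y k) - (\<Sum>k. y k)\<bar> = \<bar>\<Sum>k. y (k + j)\<bar>"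
    using suminf_split_initial_segment[OF s, of j] by simp
  also have "\<dots> \<le> (\<Sum>k. \<bar>y (k + j)\<bar>)" by (rule summable_rabs[OF sa])
  also have "\<dots> \<le> (\<Sum>k. K * (1/2) ^ (k + j))" by (rule suminf_le[OF assms sa geo])
  also have "\<dots> = (\<Sum>k. K * (1/2) ^ j * (1/2) ^ k)" by (simp add: power_add mult_ac)
  also have "\<dots> = K * (1/2) ^ j * (\<Sum>k. (1/2) ^ k)" by (rule suminf_mult) (simp add: summable_geometric)
  also have "\<dots> = 2 * K * (1/2) ^ j" by (simp add: suminf_geometric)
  finally show "\<bar>(\<Sum>k<j. y k) - (\<Sum>k. y k)\<bar> \<le> 2 * K * (1/2) ^ j" .
qed

text \<open>Passing to the limit in the truncated form inequality gives \<open>\<alpha> s\<^sup>2 \<le> s\<close> for \<open>s = \<sigma>\<^sup>T Q\<^sup>-\<^sup>1 \<sigma>\<close>.\<close>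

lemma sigma_Q_inverse_le:
  assumes p: "p \<in> {1, 2, 3}" and y: "\<And>k. \<bar>y k\<bar> \<le> K * (1/2) ^ k"
    and Q: "\<And>k. (\<Sum>l<k+5. Q_mat p k l * y l) = sigma p k"
  shows "(\<Sum>k<4. sigma p k * y k) \<le> tau_crit p"
proof -
  define s where "s = (\<Sum>k<4. sigma p k * y k)"
  have K: "0 \<le> K" using order_trans[OF abs_ge_zero y, of 0] by simp
  have s: "(\<Sum>k<n. sigma p k * y k) = s" if "4 \<le> n" for n
    unfolding s_def by (rule sum.mono_neutral_right) (use that sigma_eq_0[OF p] in auto)
  have le: "alpha p * s\<^sup>2 - s \<le> 30 * K\<^sup>2 * (1/2) ^ n" if n: "5 \<le> n" for n
  proof -
    \<comment> \<open>Cutting the row at n drops at most five entries, each at most 3 K (1/2)^n in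
      modulus, whence 15. The sum of the |y k| is at most 2 K, which turns 15 into the 30 of the
      claim.\<close>
    have row: "\<bar>(\<Sum>l<n. Q_mat p k l * y l) - sigma p k\<bar> \<le> 15 * K * (1/2) ^ n" if "k < n" for k
    proof -
      have "sigma p k = (\<Sum>l<n+5. Q_mat p k l * y l)"
        unfolding Q[symmetric]
        by (rule sum.mono_neutral_left) (use that Q_mat_band[OF p, of k] in force)+
      also have "\<dots> = (\<Sum>l<n. Q_mat p k l * y l) + (\<Sum>l\<in>{n..<n+5}. Q_mat p k l * y l)"
        by (subst sum.union_disjoint[symmetric]) (auto intro!: sum.cong)
      finally have "\<bar>(\<Sum>l<n. Q_mat p k l * y l) - sigma p k\<bar> = \<bar>\<Sum>l\<in>{n..<n+5}. Q_mat p k l * y l\<bar>" by simp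
      also have "\<dots> \<le> (\<Sum>l\<in>{n..<n+5}. 3 * (K * (1/2) ^ n))"
      proof (rule order_trans[OF sum_abs sum_mono])
        fix l assume "l \<in> {n..<n+5}"
        then have "K * (1/2) ^ l \<le> K * (1/2) ^ n" using K by (intro mult_left_mono power_decreasing) auto
        then have "\<bar>y l\<bar> \<le> K * (1/2) ^ n" using y[of l] by linarith
        then show "\<bar>Q_mat p k l * y l\<bar> \<le> 3 * (K * (1/2) ^ n)"
          unfolding abs_mult using Q_mat_bound[OF p, of k l] by (intro mult_mono) auto
      qed
      finally show ?thesis by simp
    qed
    have "alpha p * s\<^sup>2 \<le> (\<Sum>k<n. \<Sum>l<n. Q_mat p k l * y k * y l)"
      using alpha_greatest(2)[OF p, of y n] s[of n] n by simp
    also have "\<dots> = (\<Sum>k<n. y k * (\<Sum>l<n. Q_mat p k l * y l))" by (simp add: sum_distrib_left mult_ac)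
    also have "\<dots> = (\<Sum>k<n. sigma p k * y k) + (\<Sum>k<n. y k * ((\<Sum>l<n. Q_mat p k l * y l) - sigma p k))"
      by (simp add: sum.distrib[symmetric] algebra_simps)
    also have "(\<Sum>k<n. sigma p k * y k) = s" using n by (intro s) simp
    finally have "alpha p * s\<^sup>2 - s \<le> (\<Sum>k<n. y k * ((\<Sum>l<n. Q_mat p k l * y l) - sigma p k))" by simp
    also have "\<dots> \<le> (\<Sum>k<n. K * (1/2) ^ k * (15 * K * (1/2) ^ n))"
    proof (rule sum_mono)
      fix k assume "k \<in> {..<n}"
      then have "\<bar>y k\<bar> * \<bar>(\<Sum>l<n. Q_mat p k l * y l) - sigma p k\<bar> \<le> K * (1/2) ^ k * (15 * K * (1/2) ^ n)"
        using row y K by (intro mult_mono) auto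
      then have "\<bar>y k * ((\<Sum>l<n. Q_mat p k l * y l) - sigma p k)\<bar> \<le> K * (1/2) ^ k * (15 * K * (1/2) ^ n)"
        by (simp only: abs_mult)
      then show "y k * ((\<Sum>l<n. Q_mat p k l * y l) - sigma p k) \<le> K * (1/2) ^ k * (15 * K * (1/2) ^ n)"
        by (rule order_trans[OF abs_ge_self])
    qed
    also have "\<dots> = 15 * K\<^sup>2 * (1/2) ^ n * (\<Sum>k<n. (1/2) ^ k)"
      by (simp add: sum_distrib_left power2_eq_square mult_ac)
    also have "\<dots> \<le> 15 * K\<^sup>2 * (1/2) ^ n * 2"
    proof (rule mult_left_mono)
      have "(\<Sum>k<n. (1/2::real) ^ k) \<le> (\<Sum>k. (1/2) ^ k)" by (rule sum_le_suminf) (auto simp: summable_geometric)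
      then show "(\<Sum>k<n. (1/2::real) ^ k) \<le> 2" by (simp add: suminf_geometric)
    qed simp
    finally show ?thesis by simp
  qed
  have "alpha p * s\<^sup>2 - s \<le> 0"
  proof (rule LIMSEQ_le_const)
    have "(\<lambda>n. 30 * K\<^sup>2 * (1/2) ^ n) \<longlonglongrightarrow> 30 * K\<^sup>2 * 0"
      by (intro tendsto_mult tendsto_const LIMSEQ_power_zero) simp
    then show "(\<lambda>n. 30 * K\<^sup>2 * (1/2) ^ n) \<longlonglongrightarrow> 0" by simp
    show "\<exists>N. \<forall>n\<ge>N. alpha p * s\<^sup>2 - s \<le> 30 * K\<^sup>2 * (1/2) ^ n" using le by blast
  qed
  then have "alpha p * s * s \<le> 1 * s" by (simp add: power2_eq_square mult.assoc)
  moreover have \<alpha>: "0 < alpha p" by (rule alpha_greatest(1)[OF p])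
  ultimately have "s \<le> 1 / alpha p"
  proof (cases "0 < s")
    case True
    then have "alpha p * s \<le> 1" using \<open>alpha p * s * s \<le> 1 * s\<close> by simp
    then show ?thesis using \<alpha> by (simp add: pos_le_divide_eq mult.commute)
  next
    case False
    moreover have "0 \<le> 1 / alpha p" using \<alpha> by simp
    ultimately show ?thesis by linarith
  qed
  then show ?thesis by (simp add: s_def tau_crit_def)
qed

text \<open>In terms of \<open>y = D\<^sub>+ W\<close> the system becomes \<open>Q y + W\<^sub>0 \<sigma> = \<eta>\<close> together with the scalar equation
  \<open>\<sigma>\<^sup>T y + \<tau> W\<^sub>0 = 1\<close>, which is solvable because \<open>\<sigma>\<^sup>T Q\<^sup>-\<^sup>1 \<sigma> < \<tau>\<close>.\<close>

lemma M_mat_solvable: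
  assumes p: "p \<in> {1, 2, 3}" and \<tau>: "tau_crit p < \<tau>"
  obtains W a K where "\<And>j. (\<Sum>k<j+6. M_mat p \<tau> j k * W k) = (if j = i then 1 else 0)"
    "\<And>j. \<bar>W j - a\<bar> \<le> K * (1/2) ^ j"
proof -
  obtain ys Ks where ys: "\<And>k. \<bar>ys k\<bar> \<le> Ks * (1/2) ^ k" "\<And>k. (\<Sum>l<k+5. Q_mat p k l * ys l) = sigma p k"
    using Q_mat_solvable_finite_rhs[OF p, of 4 "sigma p"] sigma_eq_0[OF p] by blast
  \<comment> \<open>Chosen so that the differences of \<eta> reproduce e_i: a row j > 0 gives
    \<eta>(j-1) - \<eta>(j), which is 1 exactly for j = i. Row 0 gives 1 - \<eta>(0), the 1 being
    the right-hand side of the scalar equation; this is the correct value also for i = 0.\<close>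
  define \<eta> where "\<eta> k = (if k < i then 1 else 0 :: real)" for k
  obtain ye Ke where ye: "\<And>k. \<bar>ye k\<bar> \<le> Ke * (1/2) ^ k" "\<And>k. (\<Sum>l<k+5. Q_mat p k l * ye l) = \<eta> k"
    using Q_mat_solvable_finite_rhs[OF p, of i \<eta>] by (auto simp: \<eta>_def)
  define s e where "s = (\<Sum>k<4. sigma p k * ys k)" and "e = (\<Sum>k<4. sigma p k * ye k)"
  have "s \<le> tau_crit p" unfolding s_def by (rule sigma_Q_inverse_le[OF p ys])
  then have ts: "\<tau> - s > 0" using \<tau> by linarith
  \<comment> \<open>This is W_0: inserting y = ye - v ys into the scalar equation gives e + (\<tau>
    - s) v = 1.\<close>
  define v where "v = (1 - e) / (\<tau> - s)"
  define y where "y k = ye k - v * ys k" for k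
  have Qy: "(\<Sum>l<k+5. Q_mat p k l * y l) = \<eta> k - v * sigma p k" for k
    by (simp add: y_def right_diff_distrib sum_subtractf ye(2) flip: ys(2))
      (simp add: sum_distrib_left mult_ac)
  have sy: "(\<Sum>k<4. sigma p k * y k) + \<tau> * v = 1"
  proof -
    have "(\<Sum>k<4. sigma p k * y k) = e - v * s"
      by (simp add: y_def e_def s_def right_diff_distrib sum_subtractf sum_distrib_left mult_ac)
    moreover have "v * (\<tau> - s) = 1 - e" using ts by (simp add: v_def)
    ultimately show ?thesis by (simp add: algebra_simps)
  qed
  have yb: "\<bar>y k\<bar> \<le> (Ke + \<bar>v\<bar> * Ks) * (1/2) ^ k" for k
  proof -
    have "\<bar>y k\<bar> \<le> \<bar>ye k\<bar> + \<bar>v\<bar> * \<bar>ys k\<bar>" unfolding y_def abs_mult[symmetric] by (rule abs_triangle_ineq4)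
    also have "\<dots> \<le> Ke * (1/2) ^ k + \<bar>v\<bar> * (Ks * (1/2) ^ k)"
      by (intro add_mono mult_left_mono ye ys) simp
    finally show ?thesis by (simp add: algebra_simps)
  qed
  define W where "W j = v + (\<Sum>k<j. y k)" for j
  have W: "W 0 = v" "W (Suc k) - W k = y k" for k by (simp_all add: W_def)
  have Qband: "Q_mat p j l = 0" if "j + 5 \<le> l" for j l using Q_mat_band[OF p, of j l] that by fastforce
  \<comment> \<open>Summation by parts in the column index: row j of A W is (Q y)(j-1) - (Q y)(j),
    with (Q y)(-1) read as 0.\<close>
  have A: "(\<Sum>k<j+6. A_mat p j k * W k) = (if j = 0 then 0 else \<eta> (j-1) - v * sigma p (j-1)) - (\<eta> j - v * sigma p j)" for j
  proof -
    define X where "X k = Q_shift p j k - Q_shift p (Suc j) k" for k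
    have "(\<Sum>k<j+6. A_mat p j k * W k) = (\<Sum>k<j+6. (X k - X (Suc k)) * W k)"
      by (simp add: A_mat_def X_def algebra_simps)
    also have "\<dots> = (\<Sum>k<j+6. X (Suc k) * y k)"
    proof -
      have "X 0 = 0" "X (j + 6) = 0"
        using Qband[of j "j+5"] Qband[of "j-1" "j+5"] by (simp_all add: X_def Q_shift_def add.commute)
      then show ?thesis using sum_by_parts[of X W "j + 6"] by (simp add: W)
    qed
    also have "\<dots> = (\<Sum>k<j+6. Q_shift p j (Suc k) * y k) - (\<Sum>k<j+6. Q_shift p (Suc j) (Suc k) * y k)"
      by (simp add: X_def left_diff_distrib sum_subtractf)
    also have "(\<Sum>k<j+6. Q_shift p (Suc j) (Suc k) * y k) = (\<Sum>k<j+5. Q_mat p j k * y k)"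
      unfolding Q_shift_def by (rule sum.mono_neutral_cong_right) (auto simp: Qband)
    also have "(\<Sum>k<j+6. Q_shift p j (Suc k) * y k) = (if j = 0 then 0 else (\<Sum>k<(j-1)+5. Q_mat p (j-1) k * y k))"
    proof (cases j)
      case (Suc i)
      have "(\<Sum>k<i+7. Q_mat p i k * y k) = (\<Sum>k<i+5. Q_mat p i k * y k)"
        by (rule sum.mono_neutral_right) (auto simp: Qband)
      then show ?thesis using Suc by (simp add: Q_shift_def add.commute)
    qed (simp add: Q_shift_def)
    finally show ?thesis unfolding Qy .
  qed
  have S: "(\<Sum>k<6. S_mat p k * W k) = (\<Sum>k<4. sigma p k * y k)"
  proof -
    have "(\<Sum>k<6. S_mat p k * W k) = (\<Sum>k<6. sigma p k * y k)"
      using sigma_eq_0[OF p, of 5] by (simp add: S_mat_sum W)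
    also have "\<dots> = (\<Sum>k<4. sigma p k * y k)"
      by (rule sum.mono_neutral_right) (auto simp: sigma_eq_0[OF p])
    finally show ?thesis .
  qed
  have eq: "(\<Sum>k<j+6. M_mat p \<tau> j k * W k) = (if j = i then 1 else 0)" for j
  proof -
    have "(\<Sum>k<j+6. M_mat p \<tau> j k * W k) = (\<Sum>k<j+6. A_mat p j k * W k)
        + (\<Sum>k<j+6. (if j = 0 then S_mat p k else 0) * W k) + (\<Sum>k<j+6. (if k = 0 then S_mat p j else 0) * W k)
        + (\<Sum>k<j+6. (if j = 0 \<and> k = 0 then \<tau> else 0) * W k)"
      by (simp only: M_mat_def distrib_right sum.distrib)
    moreover have "(\<Sum>k<j+6. (if k = 0 then S_mat p j else 0) * W k) = S_mat p j * v"
      by (subst sum.remove[of _ 0]) (auto simp: W)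
    moreover have "(\<Sum>k<j+6. (if j = 0 \<and> k = 0 then \<tau> else 0) * W k) = (if j = 0 then \<tau> * v else 0)"
      by (subst sum.remove[of _ 0]) (auto simp: W)
    moreover have "(\<Sum>k<j+6. (if j = 0 then S_mat p k else 0) * W k) = (if j = 0 then (\<Sum>k<4. sigma p k * y k) else 0)"
      using S by simp
    ultimately have eq: "(\<Sum>k<j+6. M_mat p \<tau> j k * W k) =
        (if j = 0 then 0 else \<eta> (j-1) - v * sigma p (j-1)) - (\<eta> j - v * sigma p j)
        + (if j = 0 then (\<Sum>k<4. sigma p k * y k) else 0) + S_mat p j * v + (if j = 0 then \<tau> * v else 0)"
      by (simp only: A)
    show ?thesis
    proof (cases j)
      case 0
      then show ?thesis unfolding eq using sy by (auto simp: S_mat_sigma \<eta>_def algebra_simps)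
    next
      case (Suc k)
      then show ?thesis unfolding eq by (auto simp: S_mat_sigma \<eta>_def algebra_simps)
    qed
  qed
  have "\<bar>W j - (v + (\<Sum>k. y k))\<bar> \<le> (2 * (Ke + \<bar>v\<bar> * Ks)) * (1/2) ^ j" for j
    using geometric_dominated_tail(2)[OF yb, of j] by (simp add: W_def)
  then show thesis using eq that by blast
qed

section \<open>Smooth solutions and truncation errors\<close>

lemma has_real_derivative_unique_half:
  assumes "(f has_real_derivative a) (at x within {0..})" "(f has_real_derivative b) (at x within {0..})" "0 \<le> (x::real)"
  shows "a = b"
proof -
  have "\<nexists>y. {0..} = {y::real}"
  proof
    assume "\<exists>y. {0..} = {y::real}"
    then obtain y :: real where "{0..} = {y}" by blast
    then have "0 \<in> {y}" "1 \<in> {y}" by auto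
    then show False by simp
  qed
  then have "x islimpt {0..}"
    using assms(3) by (intro connected_imp_perfect) (auto simp: convex_connected)
  then have "at x within {0..} \<noteq> bot"
    by (simp add: trivial_limit_within)
  then show ?thesis
    using assms(1,2) unfolding has_field_derivative_iff by (metis tendsto_unique)
qed

lemma has_real_derivative_zero_half:
  assumes "(f has_real_derivative a) (at x within {0..})" "0 \<le> x" "0 < d"
    and "\<And>y. 0 \<le> y \<Longrightarrow> \<bar>y - x\<bar> < d \<Longrightarrow> f y = 0"
  shows "a = (0::real)"
proof (rule has_real_derivative_unique_half[OF assms(1) _ assms(2)])
  have "((\<lambda>_. 0::real) has_real_derivative 0) (at x within {0..})" by simp
  then show "(f has_real_derivative 0) (at x within {0..})"
    by (rule has_field_derivative_transform_within[OF _ assms(3)]) (use assms in \<open>auto simp: dist_real_def\<close>)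
qed

lemma smooth_quadrantD:
  assumes "smooth_quadrant U" "0 \<le> x" "0 \<le> t"
  shows "((\<lambda>y. partial i j U y t) has_real_derivative partial (Suc i) j U x t) (at x within {0..})"
    "((\<lambda>s. partial i j U x s) has_real_derivative partial i (Suc j) U x t) (at t within {0..})"
  using assms unfolding smooth_quadrant_def by blast+

lemma smooth_quadrant_continuous:
  "smooth_quadrant U \<Longrightarrow> continuous_on ({0..} \<times> {0..}) (\<lambda>(x, t). partial i j U x t)"
  unfolding smooth_quadrant_def by blast

lemma partial_00: "partial 0 0 U = U" by (simp add: partial_def)

text \<open>Chain rule up to the boundary of the quadrant. The existence of partial derivatives
  would not suffice; joint differentiability follows from the continuity of the derivative in
  t.\<close>

lemma partial_along_line:
  assumes U: "smooth_quadrant U" and S: "\<And>s. s \<in> S \<Longrightarrow> 0 \<le> a + c * s \<and> 0 \<le> s" and s: "s \<in> S"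
  shows "((\<lambda>s. partial i j U (a + c * s) s) has_real_derivative
    c * partial (Suc i) j U (a + c * s) s + partial i (Suc j) U (a + c * s) s) (at s within S)"
proof -
  let ?Q = "{0..} \<times> {0..} :: (real \<times> real) set"
  define x where "x = a + c * s"
  have x: "0 \<le> x" and s0: "0 \<le> s" using S[OF s] by (auto simp: x_def)
  have D: "((\<lambda>(x, t). partial i j U x t) has_derivative
      (\<lambda>(tx, ty). partial (Suc i) j U x s * tx + blinfun_apply (blinfun_mult_right (partial i (Suc j) U x s)) ty))
      (at (x, s) within ?Q)"
  proof (rule has_derivative_partialsI)
    show "((\<lambda>y. partial i j U y s) has_derivative (\<lambda>tx. partial (Suc i) j U x s * tx)) (at x within {0..})"
      using smooth_quadrantD(1)[OF U x s0] unfolding has_field_derivative_def .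
    show "((\<lambda>t. partial i j U y t) has_derivative blinfun_apply (blinfun_mult_right (partial i (Suc j) U y t))) (at t within {0..})"
      if "y \<in> {0..}" "t \<in> {0..}" for y t
      using smooth_quadrantD(2)[OF U, of y t] that unfolding has_field_derivative_def by simp
    have "continuous_on ?Q (\<lambda>z. blinfun_mult_right ((\<lambda>(y, t). partial i (Suc j) U y t) z))"
      by (intro bounded_linear.continuous_on[OF bounded_linear_blinfun_mult_right] smooth_quadrant_continuous[OF U])
    then show "continuous (at (x, s) within ?Q) (\<lambda>(y, t). blinfun_mult_right (partial i (Suc j) U y t))"
      using x s0 by (simp add: continuous_on_eq_continuous_within case_prod_unfold)
  qed (use s0 in auto)
  have g: "((\<lambda>s. (a + c * s, s)) has_derivative (\<lambda>u. (c * u, u))) (at s within S)"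
    by (auto intro!: derivative_eq_intros)
  have "((\<lambda>s. (\<lambda>(x, t). partial i j U x t) (a + c * s, s)) has_derivative
      (\<lambda>u. (\<lambda>(tx, ty). partial (Suc i) j U x s * tx + blinfun_apply (blinfun_mult_right (partial i (Suc j) U x s)) ty) (c * u, u)))
      (at s within S)"
  proof (rule has_derivative_in_compose[OF g])
    show "((\<lambda>(x, t). partial i j U x t) has_derivative
      (\<lambda>(tx, ty). partial (Suc i) j U x s * tx + blinfun_apply (blinfun_mult_right (partial i (Suc j) U x s)) ty))
      (at (a + c * s, s) within (\<lambda>s. (a + c * s, s)) ` S)"
      using D unfolding x_def[symmetric]
      by (rule has_derivative_subset) (use S in auto)
  qed
  then have "((\<lambda>s. partial i j U (a + c * s) s) has_derivative
      (\<lambda>u. partial (Suc i) j U x s * (c * u) + partial i (Suc j) U x s * u)) (at s within S)" by simp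
  then show ?thesis
    unfolding has_field_derivative_def
    by (rule has_derivative_eq_rhs) (simp add: x_def fun_eq_iff algebra_simps)
qed

lemma zero_derivative_constant:
  assumes "\<And>s. s \<in> {0..t} \<Longrightarrow> (f has_real_derivative 0) (at s within {0..t})" "0 \<le> t"
  shows "f t = (f 0 :: real)"
  using has_field_derivative_zero_constant[of "{0..t}" f] assms by auto

text \<open>The two factors of \<open>(\<partial>\<^sub>t - \<partial>\<^sub>x)(\<partial>\<^sub>t + \<partial>\<^sub>x)\<close> are integrated along the two families of
  characteristics.\<close>

lemma finite_propagation:
  assumes data: "admissible_data F f1 f2 g" and sol: "smooth_wave_solution F f1 f2 g U"
  obtains R where "0 \<le> R" "\<And>x t. 0 \<le> t \<Longrightarrow> R + t < x \<Longrightarrow> U x t = 0"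
proof -
  have U: "smooth_quadrant U" and wave: "\<And>x t. 0 \<le> x \<Longrightarrow> 0 \<le> t \<Longrightarrow> partial 0 2 U x t = partial 2 0 U x t + F x t"
    and init: "\<And>x. 0 \<le> x \<Longrightarrow> U x 0 = f1 x \<and> partial 0 1 U x 0 = f2 x"
    using sol unfolding smooth_wave_solution_def by blast+
  obtain R0 where R0: "\<And>z. z \<in> {(x, t). 0 \<le> x \<and> 0 \<le> t \<and> F x t \<noteq> 0} \<Longrightarrow> norm z \<le> R0"
    using data unfolding admissible_data_def compact_support_quadrant_def bounded_iff by blast
  obtain R1 where R1: "\<And>x. x \<in> {x. 0 \<le> x \<and> f1 x \<noteq> 0} \<Longrightarrow> norm x \<le> R1"
    using data unfolding admissible_data_def compact_support_half_def bounded_iff by blast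
  obtain R2 where R2: "\<And>x. x \<in> {x. 0 \<le> x \<and> f2 x \<noteq> 0} \<Longrightarrow> norm x \<le> R2"
    using data unfolding admissible_data_def compact_support_half_def bounded_iff by blast
  define R where "R = max 0 (max R0 (max R1 R2))"
  have R: "0 \<le> R" "R0 \<le> R" "R1 \<le> R" "R2 \<le> R" by (auto simp: R_def)
  have F: "F x t = 0" if "R < x" "0 \<le> t" for x t
  proof (rule ccontr)
    assume "F x t \<noteq> 0"
    then have "norm (x, t) \<le> R0" using R0[of "(x, t)"] that R by auto
    then show False using norm_fst_le[of x t] that R by simp
  qed
  have f1: "f1 x = 0" and f2: "f2 x = 0" if "R < x" for x
    using R1[of x] R2[of x] that R by auto
  have init_x: "partial 1 0 U x 0 = 0" if x: "R < x" for x
  proof (rule has_real_derivative_zero_half)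
    show "((\<lambda>y. U y 0) has_real_derivative partial 1 0 U x 0) (at x within {0..})"
      using smooth_quadrantD(1)[OF U, of x 0 0 0] x R by (simp add: partial_00)
    show "U y 0 = 0" if "0 \<le> y" "\<bar>y - x\<bar> < x - R" for y
      using init[of y] f1[of y] that by simp
  qed (use x R in auto)
  \<comment> \<open>Followed back to the initial line, this characteristic runs outwards, so it
    stays in x > R, where F vanishes; on the initial line both U_t and U_x are zero there.\<close>
  have char: "partial 0 1 U x t + partial 1 0 U x t = 0" if x: "R < x" and t: "0 \<le> t" for x t
  proof -
    let ?\<psi> = "\<lambda>s. partial 0 1 U ((x + t) + (-1) * s) s + partial 1 0 U ((x + t) + (-1) * s) s"
    have "?\<psi> t = ?\<psi> 0"
    proof (rule zero_derivative_constant)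
      fix s assume s: "s \<in> {0..t}"
      have ok: "0 \<le> (x + t) + (-1) * s \<and> 0 \<le> s" if "s \<in> {0..t}" for s using that x R by auto
      have "(?\<psi> has_real_derivative
          ((-1) * partial (Suc 0) 1 U ((x + t) + (-1) * s) s + partial 0 (Suc 1) U ((x + t) + (-1) * s) s)
          + ((-1) * partial (Suc 1) 0 U ((x + t) + (-1) * s) s + partial 1 (Suc 0) U ((x + t) + (-1) * s) s)) (at s within {0..t})"
        by (intro DERIV_add partial_along_line[OF U ok s])
      moreover have "partial 0 2 U ((x + t) + (-1) * s) s = partial 2 0 U ((x + t) + (-1) * s) s"
        using wave[of "(x + t) + (-1) * s" s] F[of "(x + t) + (-1) * s" s] s x R by simp
      ultimately show "(?\<psi> has_real_derivative 0) (at s within {0..t})"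
        by (simp add: numeral_2_eq_2)
    qed (use t in auto)
    then show ?thesis using init[of "x + t"] f2[of "x + t"] init_x[of "x + t"] x t R by simp
  qed
  \<comment> \<open>This characteristic runs inwards and meets the initial line at x - t, which is
    why the support bound grows with t.\<close>
  have "U x t = 0" if t: "0 \<le> t" and x: "R + t < x" for x t
  proof -
    let ?\<phi> = "\<lambda>s. partial 0 0 U ((x - t) + 1 * s) s"
    have "?\<phi> t = ?\<phi> 0"
    proof (rule zero_derivative_constant)
      fix s assume s: "s \<in> {0..t}"
      have ok: "0 \<le> (x - t) + 1 * s \<and> 0 \<le> s" if "s \<in> {0..t}" for s using that x R by auto
      have "(?\<phi> has_real_derivative
          1 * partial (Suc 0) 0 U ((x - t) + 1 * s) s + partial 0 (Suc 0) U ((x - t) + 1 * s) s) (at s within {0..t})"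
        by (intro partial_along_line[OF U ok s])
      moreover have "partial 0 1 U ((x - t) + 1 * s) s + partial 1 0 U ((x - t) + 1 * s) s = 0"
        using s x by (intro char) auto
      ultimately show "(?\<phi> has_real_derivative 0) (at s within {0..t})" by (simp add: add.commute)
    qed (use t in auto)
    then show ?thesis using init[of "x - t"] f1[of "x - t"] x t R by (simp add: partial_00)
  qed
  then show thesis using that R(1) by blast
qed

lemma partial_eq_0_outside:
  assumes U: "smooth_quadrant U" and R: "0 \<le> R" "\<And>x t. 0 \<le> t \<Longrightarrow> R + t < x \<Longrightarrow> U x t = 0"
    and xt: "0 \<le> t" "R + t < x"
  shows "partial i j U x t = 0"
proof -
  have t_deriv: "partial 0 j U x t = 0" if "0 \<le> t" "R + t < x" for x t j
    using that
  proof (induct j arbitrary: x t)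
    case 0
    then show ?case using R by (simp add: partial_00)
  next
    case (Suc j)
    show ?case
    proof (rule has_real_derivative_zero_half)
      show "((\<lambda>s. partial 0 j U x s) has_real_derivative partial 0 (Suc j) U x t) (at t within {0..})"
        using Suc R by (intro smooth_quadrantD[OF U]) auto
      show "partial 0 j U x s = 0" if "0 \<le> s" "\<bar>s - t\<bar> < x - (R + t)" for s
        using that by (intro Suc) auto
    qed (use Suc in auto)
  qed
  show ?thesis using xt
  proof (induct i arbitrary: x t)
    case 0
    then show ?case by (rule t_deriv)
  next
    case (Suc i)
    show ?case
    proof (rule has_real_derivative_zero_half)
      show "((\<lambda>y. partial i j U y t) has_real_derivative partial (Suc i) j U x t) (at x within {0..})"
        using Suc R by (intro smooth_quadrantD[OF U]) auto
      show "partial i j U y t = 0" if "0 \<le> y" "\<bar>y - x\<bar> < x - (R + t)" for y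
        using that Suc(2) by (intro Suc) auto
    qed (use Suc R in auto)
  qed
qed

text \<open>Error constants must be uniform in x; finite propagation reduces this to a compact
  rectangle.\<close>

lemma partial_bounded:
  assumes U: "smooth_quadrant U" and R: "0 \<le> R" "\<And>x t. 0 \<le> t \<Longrightarrow> R + t < x \<Longrightarrow> U x t = 0" and T: "0 \<le> T"
  obtains B where "0 \<le> B" "\<And>x t. 0 \<le> x \<Longrightarrow> t \<in> {0..T} \<Longrightarrow> \<bar>partial i j U x t\<bar> \<le> B"
proof -
  have "compact ((\<lambda>(x, t). partial i j U x t) ` ({0..R + T} \<times> {0..T}))"
    by (intro compact_continuous_image compact_Times compact_Icc continuous_on_subset[OF smooth_quadrant_continuous[OF U]]) auto
  from compact_imp_bounded[OF this]
  obtain B where B: "\<And>z. z \<in> (\<lambda>(x, t). partial i j U x t) ` ({0..R + T} \<times> {0..T}) \<Longrightarrow> norm z \<le> B"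
    unfolding bounded_iff by blast
  have bound: "\<bar>partial i j U x t\<bar> \<le> max 0 B" if "0 \<le> x" "t \<in> {0..T}" for x t
  proof (cases "x \<le> R + T")
    case True
    then have "norm (partial i j U x t) \<le> B"
      using that by (intro B image_eqI[where x = "(x, t)"]) auto
    then show ?thesis by simp
  next
    case False
    then have "partial i j U x t = 0" using that by (intro partial_eq_0_outside[OF U R]) auto
    then show ?thesis by simp
  qed
  show thesis by (rule that[OF _ bound]) simp_all
qed

section \<open>Taylor expansion of the truncation error\<close>

lemma D_moments_interior:
  "list_all (\<lambda>p. list_all (\<lambda>m. (\<Sum>d\<leftarrow>[0..<2*p+1]. nth_default 0 (D_stencil p) (ndist p d) * (real d - real p) ^ m) =
     (if m = 2 then 2 else 0)) [0..<2*p+2]) [1,2,3]"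
  by code_simp

lemma sum_list_upt: "(\<Sum>k\<leftarrow>[0..<n]. f k) = (\<Sum>k<n. f k)"
  by (simp add: interv_sum_list_conv_sum_set_nat atLeast0LessThan)

lemma D_moments:
  assumes p: "p \<in> {1, 2, 3}" and m: "m \<le> p + 1 \<or> (6 \<le> j \<and> m \<le> 2 * p + 1)"
  shows "(\<Sum>k<j+9. D_mat p j k * (real k - real j) ^ m) = (if m = 2 then 2 else 0)"
proof -
  have p': "p \<in> set [1, 2, 3]" using p by simp
  show ?thesis
  proof (cases "length (D_boundary p) \<le> j")
    case True
    obtain i where i: "j = i + p" and eq: "(\<Sum>k<j+9. D_mat p j k * (real k - real j) ^ m) =
        (\<Sum>d\<le>2*p. nth_default 0 (D_stencil p) (ndist p d) * (real (i + d) - real j) ^ m)"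
      by (rule D_mat_sum_interior[OF p True])
    have "m \<in> set [0..<2*p+2]" using m p by auto
    from bspec[OF bspec[OF D_moments_interior[unfolded list_all_iff] p'] this]
    have "(\<Sum>d<2*p+1. nth_default 0 (D_stencil p) (ndist p d) * (real d - real p) ^ m) = (if m = 2 then 2 else 0)"
      unfolding sum_list_upt .
    then show ?thesis
      unfolding eq lessThan_Suc_atMost[symmetric] Suc_eq_plus1 by (simp only: i of_nat_add add_diff_cancel_left)
  next
    case False
    then have j: "j \<in> set [0..<length (D_boundary p)]" by simp
    have "m \<in> set [0..<p+2]" using m length_bounds(6)[OF p] False by auto
    from bspec[OF bspec[OF bspec[OF D_moments_boundary[unfolded list_all_iff] p'] j] this]
    show ?thesis unfolding sum_list_upt .
  qed
qed

text \<open>\<open>170 = 17 * 10\<close>: a row of \<open>D\<close> has at most \<open>17\<close> entries, of modulus at most \<open>10\<close>, at distance at most \<open>8\<close>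
  from the diagonal.\<close>

lemma D_mat_truncation:
  fixes f :: "nat \<Rightarrow> real \<Rightarrow> real"
  assumes p: "p \<in> {1, 2, 3}" and n: "n \<le> p + 1 \<or> (6 \<le> j \<and> n \<le> 2 * p + 1)" "1 \<le> n" and h: "0 < h"
    and f: "\<And>i x. 0 \<le> x \<Longrightarrow> i \<le> n \<Longrightarrow> (f i has_real_derivative f (Suc i) x) (at x within {0..})"
    and B: "\<And>x. 0 \<le> x \<Longrightarrow> \<bar>f (Suc n) x\<bar> \<le> B"
  shows "\<bar>(\<Sum>k<j+9. D_mat p j k * f 0 (real k * h)) / h\<^sup>2 - (if 2 \<le> n then f 2 (real j * h) else 0)\<bar>
    \<le> 170 * 8 ^ Suc n * B * h ^ (n - 1)"
proof -
  define x where "x = real j * h"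
  have x: "0 \<le> x" using h by (simp add: x_def)
  have B0: "0 \<le> B" using B[of 0] by simp
  define P where "P k = (\<Sum>i\<le>n. f i x * (real k * h - x) ^ i / fact i)" for k
  have taylor: "\<bar>f 0 (real k * h) - P k\<bar> \<le> B * \<bar>real k * h - x\<bar> ^ Suc n / fact n" for k
    unfolding P_def
    using field_Taylor[of "{0..}" n f B x "real k * h"] f B x h by simp
  have pw: "(real k * h - real j * h) ^ i = h ^ i * (real k - real j) ^ i" for k i
  proof -
    have "real k * h - real j * h = h * (real k - real j)" by (simp add: algebra_simps)
    then show ?thesis by (simp only: power_mult_distrib)
  qed
  \<comment> \<open>Only the quadratic Taylor term survives, with factor 2 / 2! = 1.\<close>
  have main: "(\<Sum>k<j+9. D_mat p j k * P k) = h\<^sup>2 * (if 2 \<le> n then f 2 x else 0)"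
  proof -
    have "(\<Sum>k<j+9. D_mat p j k * P k) = (\<Sum>k<j+9. \<Sum>i\<le>n. f i x * h ^ i / fact i * (D_mat p j k * (real k - real j) ^ i))"
      unfolding P_def x_def pw by (simp add: sum_distrib_left mult_ac)
    also have "\<dots> = (\<Sum>i\<le>n. \<Sum>k<j+9. f i x * h ^ i / fact i * (D_mat p j k * (real k - real j) ^ i))"
      by (rule sum.swap)
    also have "\<dots> = (\<Sum>i\<le>n. f i x * h ^ i / fact i * (\<Sum>k<j+9. D_mat p j k * (real k - real j) ^ i))"
      by (simp only: sum_distrib_left)
    also have "\<dots> = (\<Sum>i\<le>n. f i x * h ^ i / fact i * (if i = 2 then 2 else 0))"
    proof (rule sum.cong[OF refl])
      fix i assume "i \<in> {..n}"
      then have "i \<le> p + 1 \<or> (6 \<le> j \<and> i \<le> 2 * p + 1)" using n(1) by auto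
      then show "f i x * h ^ i / fact i * (\<Sum>k<j+9. D_mat p j k * (real k - real j) ^ i)
          = f i x * h ^ i / fact i * (if i = 2 then 2 else 0)" by (simp only: D_moments[OF p])
    qed
    also have "\<dots> = (\<Sum>i\<le>n. if i = 2 then h\<^sup>2 * f 2 x else 0)"
      by (rule sum.cong) (auto simp: fact_2)
    also have "\<dots> = h\<^sup>2 * (if 2 \<le> n then f 2 x else 0)" by (simp add: sum.delta)
    finally show ?thesis .
  qed
  have err: "\<bar>(\<Sum>k<j+9. D_mat p j k * f 0 (real k * h)) - (\<Sum>k<j+9. D_mat p j k * P k)\<bar>
      \<le> 170 * 8 ^ Suc n * B * h ^ Suc n"
  proof -
    have "(\<Sum>k<j+9. D_mat p j k * f 0 (real k * h)) - (\<Sum>k<j+9. D_mat p j k * P k)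
        = (\<Sum>k<j+9. D_mat p j k * (f 0 (real k * h) - P k))"
      by (simp add: right_diff_distrib sum_subtractf)
    also have "\<dots> = (\<Sum>k=j-8..j+8. D_mat p j k * (f 0 (real k * h) - P k))"
      by (rule sum.mono_neutral_right) (use D_mat_band[OF p, of j] in force)+
    also have "\<bar>\<dots>\<bar> \<le> of_nat (card {j-8..j+8}) * (10 * (B * (8 * h) ^ Suc n))"
    proof (rule order_trans[OF sum_abs sum_bounded_above])
      fix k assume k: "k \<in> {j-8..j+8}"
      have "\<bar>real k * h - x\<bar> = \<bar>real k - real j\<bar> * h" using h by (simp add: x_def abs_mult flip: left_diff_distrib)
      also have "\<dots> \<le> 8 * h" using k h by (intro mult_right_mono) auto
      finally have "\<bar>real k * h - x\<bar> ^ Suc n \<le> (8 * h) ^ Suc n" by (intro power_mono) auto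
      then have "B * \<bar>real k * h - x\<bar> ^ Suc n / fact n \<le> B * (8 * h) ^ Suc n / 1"
        using B0 h by (intro frac_le mult_left_mono mult_nonneg_nonneg) auto
      then have "\<bar>f 0 (real k * h) - P k\<bar> \<le> B * (8 * h) ^ Suc n" using taylor[of k] by simp
      then show "\<bar>D_mat p j k * (f 0 (real k * h) - P k)\<bar> \<le> 10 * (B * (8 * h) ^ Suc n)"
        unfolding abs_mult using D_mat_bound[OF p] by (intro mult_mono) auto
    qed
    also have "\<dots> \<le> 17 * (10 * (B * (8 * h) ^ Suc n))"
      using B0 h by (intro mult_right_mono mult_nonneg_nonneg) (auto simp: of_nat_diff)
    also have "\<dots> = 170 * 8 ^ Suc n * B * h ^ Suc n" by (simp add: power_mult_distrib)
    finally show ?thesis .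
  qed
  have "\<bar>(\<Sum>k<j+9. D_mat p j k * f 0 (real k * h)) / h\<^sup>2 - (if 2 \<le> n then f 2 x else 0)\<bar>
      = \<bar>(\<Sum>k<j+9. D_mat p j k * f 0 (real k * h)) - (\<Sum>k<j+9. D_mat p j k * P k)\<bar> / h\<^sup>2"
    using h unfolding main by (simp add: diff_divide_distrib[symmetric] abs_divide field_simps)
  also have "\<dots> \<le> 170 * 8 ^ Suc n * B * h ^ Suc n / h\<^sup>2" by (intro divide_right_mono err) simp
  also have "170 * 8 ^ Suc n * B * h ^ Suc n / h\<^sup>2 = 170 * 8 ^ Suc n * B * h ^ (n - 1)"
  proof -
    have "h ^ Suc n = h ^ (n - 1) * h\<^sup>2" using n(2) by (simp flip: power_add)
    then show ?thesis using h by simp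
  qed
  finally show ?thesis unfolding x_def .
qed

section \<open>Stability and consistency of the scheme\<close>

lemma l2norm_cmult:
  assumes "summable (\<lambda>j. (x j)\<^sup>2)" "0 \<le> c"
  shows "summable (\<lambda>j. (c * x j)\<^sup>2)" "l2norm (\<lambda>j. c * x j) = c * l2norm x"
proof -
  show "summable (\<lambda>j. (c * x j)\<^sup>2)" using summable_mult[OF assms(1), of "c\<^sup>2"] by (simp add: power_mult_distrib)
  have "(\<Sum>j. (c * x j)\<^sup>2) = c\<^sup>2 * (\<Sum>j. (x j)\<^sup>2)"
    using suminf_mult[OF assms(1), of "c\<^sup>2"] by (simp add: power_mult_distrib)
  then show "l2norm (\<lambda>j. c * x j) = c * l2norm x"
    using assms(2) by (simp add: l2norm_def real_sqrt_mult)
qed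

lemma l2norm_abs: "l2norm (\<lambda>j. \<bar>x j\<bar>) = l2norm x"
  by (simp add: l2norm_def)

lemma l2norm_add_le:
  assumes "summable (\<lambda>j. (x j)\<^sup>2)" "summable (\<lambda>j. (y j)\<^sup>2)"
  shows "summable (\<lambda>j. (x j + y j)\<^sup>2)" "l2norm (\<lambda>j. x j + y j) \<le> l2norm x + l2norm y"
proof -
  have "L2_set (\<lambda>j. x j + y j) {..<n} \<le> l2norm x + l2norm y" for n
    using L2_set_triangle_ineq[of x y "{..<n}"] L2_set_le_l2norm[OF assms(1), of "{..<n}"]
      L2_set_le_l2norm[OF assms(2), of "{..<n}"] by simp
  then show "summable (\<lambda>j. (x j + y j)\<^sup>2)" "l2norm (\<lambda>j. x j + y j) \<le> l2norm x + l2norm y"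
    by (rule summable_sq_if_L2_set_le, rule l2norm_le)
qed

text \<open>Shape shared by all residuals: size c on a bounded range of x and size d in a layer of a
  few cells at the boundary. In the grid norm the second part gains a factor sqrt h.\<close>

definition profile :: "real \<Rightarrow> real \<Rightarrow> real \<Rightarrow> real \<Rightarrow> nat \<Rightarrow> real" where
  "profile h X c d j = (if real j * h \<le> X then c else 0) + d * (1/2) ^ j"

lemma l2norm_profile_le:
  assumes h: "0 < h" "h < 1" and "0 \<le> X" "0 \<le> c" "0 \<le> d"
  shows "summable (\<lambda>j. (profile h X c d j)\<^sup>2)"
    "sqrt h * l2norm (profile h X c d) \<le> sqrt (X + 1) * c + 2 * sqrt h * d"
proof -
  define I where "I j = (if real j * h \<le> X then c else 0)" for j
  define N where "N = Suc (nat \<lfloor>X / h\<rfloor>)"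
  have I0: "I j = 0" if "N \<le> j" for j
  proof -
    have "X / h < real j" using that by (simp add: N_def) linarith
    then show ?thesis using h by (simp add: I_def pos_divide_less_eq)
  qed
  have hN: "h * real N \<le> X + 1"
  proof -
    have "real (nat \<lfloor>X / h\<rfloor>) \<le> X / h" using assms by (simp add: of_nat_nat)
    then have "real N \<le> X / h + 1" by (simp add: N_def)
    then have "h * real N \<le> h * (X / h + 1)" using h by (intro mult_left_mono) auto
    also have "\<dots> = X + h" using h by (simp add: distrib_left)
    finally show ?thesis using h by simp
  qed
  have I_L2: "L2_set I {..<n} \<le> sqrt (real N) * c" for n
  proof -
    have "(\<Sum>j<n. (I j)\<^sup>2) \<le> (\<Sum>j<max n N. (I j)\<^sup>2)" by (intro sum_mono2) auto
    also have "\<dots> = (\<Sum>j<N. (I j)\<^sup>2)" by (rule sum.mono_neutral_right) (auto simp: I0)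
    also have "\<dots> \<le> (\<Sum>j<N. c\<^sup>2)" by (intro sum_mono) (simp add: I_def)
    finally have "L2_set I {..<n} \<le> sqrt (real N * c\<^sup>2)" by (simp add: L2_set_def)
    then show ?thesis using assms by (simp add: real_sqrt_mult)
  qed
  have I: "summable (\<lambda>j. (I j)\<^sup>2)" "l2norm I \<le> sqrt (real N) * c"
    by (rule summable_sq_if_L2_set_le[OF I_L2], rule l2norm_le[OF I_L2])
  have geo: "(\<lambda>j. ((1/2) ^ j)\<^sup>2) = (\<lambda>j. (1/4 :: real) ^ j)"
    by (simp add: fun_eq_iff power_divide power2_eq_square flip: power_mult_distrib)
  have G0: "summable (\<lambda>j. ((1/2 :: real) ^ j)\<^sup>2)" unfolding geo by (simp add: summable_geometric)
  have G: "summable (\<lambda>j. (d * (1/2) ^ j)\<^sup>2)" "l2norm (\<lambda>j. d * (1/2) ^ j) \<le> 2 * d"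
  proof -
    show "summable (\<lambda>j. (d * (1/2) ^ j)\<^sup>2)" by (rule l2norm_cmult(1)[OF G0 \<open>0 \<le> d\<close>])
    have "l2norm (\<lambda>j. (1/2) ^ j) = sqrt (4/3)" unfolding l2norm_def geo by (simp add: suminf_geometric)
    also have "\<dots> \<le> 2" by (rule real_le_lsqrt) auto
    finally have "d * l2norm (\<lambda>j. (1/2) ^ j) \<le> d * 2" using \<open>0 \<le> d\<close> by (rule mult_left_mono)
    then show "l2norm (\<lambda>j. d * (1/2) ^ j) \<le> 2 * d"
      unfolding l2norm_cmult(2)[OF G0 \<open>0 \<le> d\<close>] by simp
  qed
  have eq: "profile h X c d = (\<lambda>j. I j + d * (1/2) ^ j)" by (simp add: fun_eq_iff profile_def I_def)
  show "summable (\<lambda>j. (profile h X c d j)\<^sup>2)" unfolding eq by (rule l2norm_add_le(1)[OF I(1) G(1)])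
  have "l2norm (profile h X c d) \<le> sqrt (real N) * c + 2 * d"
    unfolding eq using l2norm_add_le(2)[OF I(1) G(1)] I(2) G(2) by linarith
  then have "sqrt h * l2norm (profile h X c d) \<le> sqrt h * (sqrt (real N) * c + 2 * d)"
    using h by (intro mult_left_mono) auto
  also have "\<dots> = sqrt (h * real N) * c + 2 * sqrt h * d" by (simp add: real_sqrt_mult distrib_left)
  also have "\<dots> \<le> sqrt (X + 1) * c + 2 * sqrt h * d"
    using hN assms by (intro add_right_mono mult_right_mono real_sqrt_le_mono)
  finally show "sqrt h * l2norm (profile h X c d) \<le> sqrt (X + 1) * c + 2 * sqrt h * d" .
qed

text \<open>Divided by h^2 this is H^-1 M; all powers of h are kept outside.\<close>

definition L_op :: "nat \<Rightarrow> real \<Rightarrow> (nat \<Rightarrow> real) \<Rightarrow> nat \<Rightarrow> real" where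
  "L_op p \<tau> x j = (\<Sum>k<j+9. M_mat p \<tau> j k * x k) / H_mat p j"

lemma M_mat_sum:
  assumes "p \<in> {1, 2, 3}" "j + 6 \<le> n"
  shows "(\<Sum>k<n. M_mat p \<tau> j k * x k) = (\<Sum>k<j+6. M_mat p \<tau> j k * x k)"
  by (rule sum.mono_neutral_right) (use assms M_mat_band[of p \<tau> j] in force)+

text \<open>Conjugation by the square root of H makes the operator symmetric, which costs the
  factors 3/2 and 2, hence 3. The bound on the matrix entries blows up like h^-2, but the energy
  estimate does not contain it, so the constant is uniform in h.\<close>

lemma scheme_stable:
  fixes w :: "real \<Rightarrow> nat \<Rightarrow> real"
  assumes p: "p \<in> {1, 2, 3}" and \<tau>: "tau_crit p \<le> \<tau>" and h: "0 < h" and T: "0 \<le> T"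
    and w: "\<And>t j. t \<in> {0..T} \<Longrightarrow> ((\<lambda>s. w s j) has_real_derivative w' t j) (at t within {0..T})"
    and w': "\<And>t j. t \<in> {0..T} \<Longrightarrow>
      ((\<lambda>s. w' s j) has_real_derivative - L_op p \<tau> (w t) j / h\<^sup>2 + r t j) (at t within {0..T})"
    and summ: "\<And>t. t \<in> {0..T} \<Longrightarrow> summable (\<lambda>j. (w t j)\<^sup>2)"
    and \<beta>: "summable (\<lambda>j. (\<beta> j)\<^sup>2)"
    and r: "\<And>t j. t \<in> {0..T} \<Longrightarrow> \<bar>r t j\<bar> \<le> \<beta> j"
    and w0: "\<And>j. \<bar>w 0 j\<bar> \<le> \<beta> j" and w'0: "\<And>j. \<bar>w' 0 j\<bar> \<le> \<beta> j"
    and t: "t \<in> {0..T}"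
  shows "l2norm (w t) \<le> 3 * (1 + 2 * T * (1 + T)) * l2norm \<beta>"
proof -
  define q where "q j = sqrt (H_mat p j)" for j
  have q_lo: "1/2 \<le> q j" for j
  proof -
    have "sqrt (1/4) \<le> q j" unfolding q_def by (intro real_sqrt_le_mono H_mat_bounds p)
    then show ?thesis by (simp add: real_sqrt_divide)
  qed
  have q_hi: "q j \<le> 3/2" for j
    unfolding q_def using H_mat_bounds[OF p, of j] by (intro real_le_lsqrt) (auto simp: power2_eq_square)
  have q_pos: "0 < q j" for j using q_lo[of j] by linarith
  have q_nz: "q j \<noteq> 0" for j using q_pos[of j] by simp
  have q_sq: "q j * q j = H_mat p j" for j using H_mat_bounds(1)[OF p, of j] by (simp add: q_def)
  define m where "m j k = M_mat p \<tau> j k / (h\<^sup>2 * (q j * q k))" for j k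
  interpret banded_psd m 5 "(20 + \<bar>\<tau>\<bar>) / (h\<^sup>2 * (1/4))"
  proof
    show "m j k \<noteq> 0 \<Longrightarrow> j \<le> k + 5 \<and> k \<le> j + 5" for j k
      using M_mat_band[OF p, of \<tau> j k] by (auto simp: m_def)
    show "\<bar>m j k\<bar> \<le> (20 + \<bar>\<tau>\<bar>) / (h\<^sup>2 * (1/4))" for j k
    proof -
      have "1/2 * (1/2) \<le> q j * q k" using q_lo q_pos[of j] by (intro mult_mono) (auto intro: less_imp_le)
      then have "\<bar>M_mat p \<tau> j k\<bar> / (h\<^sup>2 * (q j * q k)) \<le> (20 + \<bar>\<tau>\<bar>) / (h\<^sup>2 * (1/4))"
        using h M_mat_bound[OF p] by (intro frac_le mult_left_mono) auto
      then show ?thesis using h q_pos[of j] q_pos[of k] by (simp add: m_def abs_mult)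
    qed
    show "m j k = m k j" for j k by (simp add: m_def M_mat_sym[OF p, of \<tau> j k] mult.commute)
    show "0 \<le> (\<Sum>j<n. \<Sum>k<n. m j k * x j * x k)" for n x
    proof -
      have "(\<Sum>j<n. \<Sum>k<n. m j k * x j * x k) = (\<Sum>j<n. \<Sum>k<n. M_mat p \<tau> j k * (x j / q j) * (x k / q k)) / h\<^sup>2"
        by (simp add: m_def sum_divide_distrib mult_ac)
      also have "\<dots> \<ge> 0" by (intro divide_nonneg_nonneg M_mat_psd[OF p \<tau>]) simp
      finally show ?thesis .
    qed
  qed
  have mv: "mv (\<lambda>k. q k * x k) j = q j * (L_op p \<tau> x j / h\<^sup>2)" for x j
  proof -
    have "mv (\<lambda>k. q k * x k) j = (\<Sum>k<j+6. M_mat p \<tau> j k * x k / (h\<^sup>2 * q j))"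
      unfolding mv_def
      by (rule sum.cong) (auto simp: m_def q_nz)
    also have "\<dots> = (\<Sum>k<j+9. M_mat p \<tau> j k * x k) / (h\<^sup>2 * q j)"
      using M_mat_sum[OF p, of j "j+9"] by (simp add: sum_divide_distrib)
    also have "\<dots> = q j * (L_op p \<tau> x j / h\<^sup>2)"
      unfolding L_op_def q_sq[symmetric] using q_pos[of j] by simp
    finally show ?thesis .
  qed
  have scale: "\<bar>q j * y\<bar> \<le> 3/2 * \<beta> j" if "\<bar>y\<bar> \<le> \<beta> j" for j y
    unfolding abs_mult using that q_hi[of j] q_pos[of j] by (intro mult_mono) auto
  have summ': "summable (\<lambda>j. (q j * w t j)\<^sup>2)" if "t \<in> {0..T}" for t
  proof (rule l2norm_le_dom(1))
    show "summable (\<lambda>j. (3/2 * \<bar>w t j\<bar>)\<^sup>2)" using summ[OF that] by (intro l2norm_cmult) auto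
    show "\<bar>q j * w t j\<bar> \<le> 3/2 * \<bar>w t j\<bar>" for j
      unfolding abs_mult using q_hi[of j] q_pos[of j] by (intro mult_right_mono) auto
  qed
  have "l2norm (\<lambda>j. q j * w t j) \<le> (1 + 2 * T * (1 + T)) * l2norm (\<lambda>j. 3/2 * \<beta> j)"
  proof (rule l2norm_solution_le[OF T, where w' = "\<lambda>t j. q j * w' t j" and r = "\<lambda>t j. q j * r t j"])
    show "((\<lambda>s. q j * w s j) has_real_derivative q j * w' t j) (at t within {0..T})" if "t \<in> {0..T}" for t j
      using w[OF that] by (rule DERIV_cmult)
    show "((\<lambda>s. q j * w' s j) has_real_derivative - mv (\<lambda>j. q j * w t j) j + q j * r t j) (at t within {0..T})"
      if "t \<in> {0..T}" for t j
      using DERIV_cmult[OF w'[OF that], of "q j" j] unfolding mv by (simp add: algebra_simps)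
    show "summable (\<lambda>j. (3/2 * \<beta> j)\<^sup>2)" using \<beta> by (intro l2norm_cmult) auto
  qed (use scale r w0 w'0 summ' t in auto)
  also have "l2norm (\<lambda>j. 3/2 * \<beta> j) = 3/2 * l2norm \<beta>" using \<beta> by (intro l2norm_cmult) auto
  finally have 1: "l2norm (\<lambda>j. q j * w t j) \<le> (1 + 2 * T * (1 + T)) * (3/2 * l2norm \<beta>)" .
  have "l2norm (w t) \<le> l2norm (\<lambda>j. 2 * \<bar>q j * w t j\<bar>)"
  proof (rule l2norm_le_dom(2))
    show "summable (\<lambda>j. (2 * \<bar>q j * w t j\<bar>)\<^sup>2)" using summ'[OF t] by (intro l2norm_cmult) auto
    show "\<bar>w t j\<bar> \<le> 2 * \<bar>q j * w t j\<bar>" for j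
      using mult_right_mono[OF q_lo, of "\<bar>w t j\<bar>" j] q_pos[of j] by (simp add: abs_mult)
  qed
  also have "\<dots> = 2 * l2norm (\<lambda>j. \<bar>q j * w t j\<bar>)" using summ'[OF t] by (intro l2norm_cmult) auto
  also have "\<dots> = 2 * l2norm (\<lambda>j. q j * w t j)" by (simp only: l2norm_abs)
  finally show ?thesis using 1 by (simp add: algebra_simps)
qed

text \<open>The \<open>q\<close>-th time derivative of the truncation error \<open>U\<^sub>x\<^sub>x - D U\<close>. The penalty terms do not
  contribute to it because \<open>U(0, t) = g(t)\<close>.\<close>

definition trunc :: "nat \<Rightarrow> real \<Rightarrow> (real \<Rightarrow> real \<Rightarrow> real) \<Rightarrow> nat \<Rightarrow> nat \<Rightarrow> real \<Rightarrow> real" where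
  "trunc p h U q j t = partial 2 q U (real j * h) t -
     (\<Sum>k<j+9. D_mat p j k * partial 0 q U (real k * h) t) / h\<^sup>2"

lemma trunc_deriv:
  assumes U: "smooth_quadrant U" and h: "0 < h" and t: "0 \<le> t"
  shows "((\<lambda>s. trunc p h U q j s) has_real_derivative trunc p h U (Suc q) j t) (at t within {0..})"
proof -
  have D: "((\<lambda>s. partial i q U (real k * h) s) has_real_derivative partial i (Suc q) U (real k * h) t) (at t within {0..})" for i k
    using h t by (intro smooth_quadrantD(2)[OF U]) auto
  show ?thesis unfolding trunc_def by (intro DERIV_diff D DERIV_cdivide DERIV_sum DERIV_cmult)
qed

text \<open>Taylor expansion to degree p + 1 in every row and to degree 2 p + 1 in interior rows.
  Beyond R + T + 8 all values entering a row vanish, since it reaches at most 8 nodes to the left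
  and h < 1.\<close>

lemma trunc_bound:
  assumes p: "p \<in> {1, 2, 3}" and U: "smooth_quadrant U"
    and R: "0 \<le> R" "\<And>x t. 0 \<le> t \<Longrightarrow> R + t < x \<Longrightarrow> U x t = 0" and T: "0 \<le> T"
  obtains C where "0 \<le> C"
    "\<And>h j t. 0 < h \<Longrightarrow> t \<in> {0..T} \<Longrightarrow> \<bar>trunc p h U q j t\<bar> \<le> C * h ^ p"
    "\<And>h j t. 0 < h \<Longrightarrow> t \<in> {0..T} \<Longrightarrow> 6 \<le> j \<Longrightarrow> \<bar>trunc p h U q j t\<bar> \<le> C * h ^ (2 * p)"
    "\<And>h j t. 0 < h \<Longrightarrow> h < 1 \<Longrightarrow> t \<in> {0..T} \<Longrightarrow> R + T + 8 < real j * h \<Longrightarrow> trunc p h U q j t = 0"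
proof -
  obtain B1 where B1: "0 \<le> B1" "\<And>x t. 0 \<le> x \<Longrightarrow> t \<in> {0..T} \<Longrightarrow> \<bar>partial (Suc (p + 1)) q U x t\<bar> \<le> B1"
    using partial_bounded[OF U R T, of "Suc (p + 1)" q] by blast
  obtain B2 where B2: "0 \<le> B2" "\<And>x t. 0 \<le> x \<Longrightarrow> t \<in> {0..T} \<Longrightarrow> \<bar>partial (Suc (2 * p + 1)) q U x t\<bar> \<le> B2"
    using partial_bounded[OF U R T, of "Suc (2 * p + 1)" q] by blast
  define C where "C = 170 * 8 ^ Suc (2 * p + 1) * (B1 + B2)"
  have gen: "\<bar>trunc p h U q j t\<bar> \<le> C * h ^ (n - 1)"
    if n: "n \<le> p + 1 \<or> (6 \<le> j \<and> n \<le> 2 * p + 1)" "2 \<le> n" "n \<le> 2 * p + 1" and h: "0 < h" and t: "t \<in> {0..T}"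
      and B: "\<And>x. 0 \<le> x \<Longrightarrow> \<bar>partial (Suc n) q U x t\<bar> \<le> B" "B \<le> B1 + B2" for n j h t B
  proof -
    have "\<bar>(\<Sum>k<j+9. D_mat p j k * partial 0 q U (real k * h) t) / h\<^sup>2 - (if 2 \<le> n then partial 2 q U (real j * h) t else 0)\<bar>
        \<le> 170 * 8 ^ Suc n * B * h ^ (n - 1)"
      using n h B t smooth_quadrantD(1)[OF U] by (intro D_mat_truncation[OF p, where f = "\<lambda>i x. partial i q U x t"]) auto
    moreover have "170 * 8 ^ Suc n * B * h ^ (n - 1) \<le> C * h ^ (n - 1)"
    proof -
      have "0 \<le> B" using order_trans[OF abs_ge_zero B(1)[of 0]] by simp
      moreover have "(8::real) ^ Suc n \<le> 8 ^ Suc (2 * p + 1)" using n by (intro power_increasing) auto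
      ultimately show ?thesis unfolding C_def using B h
        by (intro mult_right_mono mult_mono mult_left_mono) auto
    qed
    ultimately show ?thesis using n by (simp add: trunc_def abs_minus_commute)
  qed
  show thesis
  proof (rule that[of C])
    show "0 \<le> C" using B1 B2 by (simp add: C_def)
    show "\<bar>trunc p h U q j t\<bar> \<le> C * h ^ p" if "0 < h" "t \<in> {0..T}" for h j t
      using gen[of "p + 1" j h t B1] that B1 B2 p by auto
    show "\<bar>trunc p h U q j t\<bar> \<le> C * h ^ (2 * p)" if "0 < h" "t \<in> {0..T}" "6 \<le> j" for h j t
      using gen[of "2 * p + 1" j h t B2] that B1 B2 p by auto
    show "trunc p h U q j t = 0" if h: "0 < h" "h < 1" and t: "t \<in> {0..T}" and j: "R + T + 8 < real j * h" for h j t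
    proof -
      have far: "partial i q U (real k * h) t = 0" if k: "j \<le> k + 8" for i k
      proof (rule partial_eq_0_outside[OF U R])
        have "real j * h \<le> (real k + 8) * h" using k h by (intro mult_right_mono) linarith+
        then have "real j * h \<le> real k * h + 8 * h" by (simp add: distrib_right)
        then show "R + t < real k * h" using j t h by simp
      qed (use t in auto)
      have "(\<Sum>k<j+9. D_mat p j k * partial 0 q U (real k * h) t) = 0"
        using far D_mat_band[OF p, of j] by (intro sum.neutral) force
      then show ?thesis using far[of j] by (simp add: trunc_def)
    qed
  qed
qed

text \<open>Because U(0,t) = g(t), the penalty terms see minus the boundary value of the error and
  therefore become part of M instead of producing a residual.\<close>

lemma error_equation:
  assumes p: "p \<in> {1, 2, 3}" and h: "0 < h" and sol: "smooth_wave_solution F f1 f2 g U"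
    and u: "sbp_sat_solution p \<tau> h F f1 f2 g u"
  obtains \<xi>' where
    "\<And>t j. 0 \<le> t \<Longrightarrow> ((\<lambda>s. pointwise_error h U u s j) has_real_derivative \<xi>' t j) (at t within {0..})"
    "\<And>t j. 0 \<le> t \<Longrightarrow> ((\<lambda>s. \<xi>' s j) has_real_derivative
       - L_op p \<tau> (pointwise_error h U u t) j / h\<^sup>2 + trunc p h U 0 j t) (at t within {0..})"
    "\<And>j. pointwise_error h U u 0 j = 0" "\<And>j. \<xi>' 0 j = 0"
proof -
  have U: "smooth_quadrant U" and wave: "\<And>x t. 0 \<le> x \<Longrightarrow> 0 \<le> t \<Longrightarrow> partial 0 2 U x t = partial 2 0 U x t + F x t"
    and init: "\<And>x. 0 \<le> x \<Longrightarrow> U x 0 = f1 x \<and> partial 0 1 U x 0 = f2 x"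
    and bdry: "\<And>t. 0 \<le> t \<Longrightarrow> U 0 t = g t"
    using sol unfolding smooth_wave_solution_def by blast+
  obtain u' where u': "\<And>t j. 0 \<le> t \<Longrightarrow> ((\<lambda>s. u s j) has_real_derivative u' t j) (at t within {0..})"
    "\<And>t j. 0 \<le> t \<Longrightarrow> ((\<lambda>s. u' s j) has_real_derivative sbp_sat_rhs p \<tau> h F g (u t) t j) (at t within {0..})"
    "\<And>j. u 0 j = f1 (real j * h)" "\<And>j. u' 0 j = f2 (real j * h)"
    using u unfolding sbp_sat_solution_def by blast
  define \<xi> where "\<xi> = pointwise_error h U u"
  define \<xi>' where "\<xi>' t j = partial 0 1 U (real j * h) t - u' t j" for t j
  have rhs: "partial 0 2 U (real j * h) t - sbp_sat_rhs p \<tau> h F g (u t) t j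
      = - L_op p \<tau> (\<xi> t) j / h\<^sup>2 + trunc p h U 0 j t" if t: "0 \<le> t" for t j
  proof -
    define DU Du where "DU = (\<Sum>k<j+9. D_mat p j k * U (real k * h) t)" and "Du = (\<Sum>k<j+9. D_mat p j k * u t k)"
    have H: "0 < H_mat p j" using H_mat_bounds(1)[OF p, of j] by linarith
    have \<xi>0: "\<xi> t 0 = g t - u t 0" using bdry[OF t] by (simp add: \<xi>_def pointwise_error_def)
    define c where "c = S_mat p j + (if j = 0 then \<tau> else 0)"
    \<comment> \<open>M + H D has entries only in column 0: the row of S in M cancels against B S in
      H D, leaving the transposed S and the penalty.\<close>
    have split: "M_mat p \<tau> j k * \<xi> t k = - H_mat p j * (D_mat p j k * \<xi> t k) + (if k = 0 then c * \<xi> t 0 else 0)" for k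
      by (simp add: M_mat_def HD_mat[OF p] c_def algebra_simps flip: mult.assoc)
    have "(\<Sum>k<j+9. M_mat p \<tau> j k * \<xi> t k) = - H_mat p j * (\<Sum>k<j+9. D_mat p j k * \<xi> t k) + c * \<xi> t 0"
      unfolding split sum.distrib sum_distrib_left[symmetric] by simp
    also have "(\<Sum>k<j+9. D_mat p j k * \<xi> t k) = DU - Du"
      by (simp add: \<xi>_def pointwise_error_def DU_def Du_def right_diff_distrib sum_subtractf)
    finally have L: "L_op p \<tau> (\<xi> t) j = - (DU - Du) + c * \<xi> t 0 / H_mat p j"
      using H by (simp add: L_op_def field_simps)
    have "sbp_sat_rhs p \<tau> h F g (u t) t j = Du / h\<^sup>2 + c * \<xi> t 0 / H_mat p j / h\<^sup>2
        + F (real j * h) t"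
      using h H by (simp add: sbp_sat_rhs_def D_op_eq[OF p] Du_def Hdiag_def S0_def \<xi>0 c_def
          H_mat_def[symmetric] S_mat_def[symmetric] field_simps power2_eq_square)
    moreover have "partial 0 2 U (real j * h) t = partial 2 0 U (real j * h) t + F (real j * h) t"
      using h t by (intro wave) auto
    moreover have "trunc p h U 0 j t = partial 2 0 U (real j * h) t - DU / h\<^sup>2"
      by (simp add: trunc_def DU_def partial_00)
    ultimately show ?thesis unfolding L by (simp add: diff_divide_distrib add_divide_distrib)
  qed
  show thesis
  proof (rule that[of \<xi>'])
    fix t :: real and j assume t: "0 \<le> t"
    have x: "0 \<le> real j * h" using h by simp
    show "((\<lambda>s. pointwise_error h U u s j) has_real_derivative \<xi>' t j) (at t within {0..})"
      unfolding pointwise_error_def \<xi>'_def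
      using smooth_quadrantD(2)[OF U x t, of 0 0] u'(1)[OF t] by (intro DERIV_diff) (simp_all add: partial_00)
    have "((\<lambda>s. \<xi>' s j) has_real_derivative partial 0 2 U (real j * h) t - sbp_sat_rhs p \<tau> h F g (u t) t j) (at t within {0..})"
      unfolding \<xi>'_def using smooth_quadrantD(2)[OF U x t, of 0 1] u'(2)[OF t]
      by (intro DERIV_diff) (simp_all add: numeral_2_eq_2)
    then show "((\<lambda>s. \<xi>' s j) has_real_derivative
       - L_op p \<tau> (pointwise_error h U u t) j / h\<^sup>2 + trunc p h U 0 j t) (at t within {0..})"
      unfolding rhs[OF t] \<xi>_def .
  next
    fix j
    show "pointwise_error h U u 0 j = 0" "\<xi>' 0 j = 0"
      using init[of "real j * h"] u'(3,4)[of j] h by (simp_all add: pointwise_error_def \<xi>'_def)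
  qed
qed

section \<open>The cutoff function\<close>

lemma max_0_power_deriv:
  "((\<lambda>y. max 0 y ^ Suc (Suc n)) has_real_derivative real (n + 2) * max 0 y ^ Suc n) (at (y :: real))"
proof -
  consider "y < 0" | "y = 0" | "0 < y" by linarith
  then show ?thesis
  proof cases
    case 1
    have "((\<lambda>_. 0 :: real) has_real_derivative 0) (at y)" by simp
    then have "((\<lambda>y. max 0 y ^ Suc (Suc n)) has_real_derivative 0) (at y)"
      by (rule has_field_derivative_transform_within_open[where S = "{..<0}"]) (use 1 in auto)
    then show ?thesis using 1 by simp
  next
    case 2
    have "((\<lambda>d::real. max 0 d ^ Suc (Suc n) / d) \<longlongrightarrow> 0) (at 0)"
    proof (rule Lim_null_comparison)
      have "norm (max 0 d ^ Suc (Suc n) / d) \<le> \<bar>d\<bar> ^ Suc n" for d :: real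
      proof (cases "0 < d")
        case False
        then have "norm (max 0 d ^ Suc (Suc n) / d) = 0" by simp
        also have "0 \<le> \<bar>d\<bar> ^ Suc n" by (rule zero_le_power) (rule abs_ge_zero)
        finally show ?thesis .
      qed simp
      then show "\<forall>\<^sub>F d in at 0. norm (max 0 d ^ Suc (Suc n) / d) \<le> \<bar>d\<bar> ^ Suc n"
        by (intro always_eventually allI)
      have "((\<lambda>d::real. \<bar>d\<bar> ^ Suc n) \<longlongrightarrow> \<bar>0\<bar> ^ Suc n) (at 0)" by (intro tendsto_intros)
      then show "((\<lambda>d::real. \<bar>d\<bar> ^ Suc n) \<longlongrightarrow> 0) (at 0)" by simp
    qed
    then show ?thesis using 2 by (simp add: has_field_derivative_iff)
  next
    case 3
    have "((\<lambda>y. y ^ Suc (Suc n)) has_real_derivative real (n + 2) * y ^ Suc n) (at y)"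
      using DERIV_pow[of "Suc (Suc n)" y UNIV] by (simp add: add.commute)
    then have "((\<lambda>y. max 0 y ^ Suc (Suc n)) has_real_derivative real (n + 2) * y ^ Suc n) (at y)"
      by (rule has_field_derivative_transform_within_open[where S = "{0<..}"]) (use 3 in auto)
    then show ?thesis using 3 by simp
  qed
qed

text \<open>The cube makes the function twice differentiable across x = 1, as Taylor expansion of
  degree 1 requires, while the second derivative stays explicit.\<close>

definition cutoff :: "real \<Rightarrow> real" where
  "cutoff x = max 0 (1 - x\<^sup>2) ^ 3"

lemma cutoff_props: "cutoff 0 = 1" "0 \<le> cutoff x" "cutoff x \<le> 1" "1 \<le> x \<Longrightarrow> cutoff x = 0"
  by (auto simp: cutoff_def abs_square_le_1 intro!: power_le_one)

text \<open>\<open>326400 = 170 * 8\<^sup>2 * 30\<close>, where \<open>30\<close> bounds the second derivative of the cutoff.\<close>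

lemma cutoff_D_mat:
  assumes p: "p \<in> {1, 2, 3}" and h: "0 < h"
  shows "\<bar>\<Sum>k<j+9. D_mat p j k * (1 - cutoff (real k * h))\<bar> \<le> 326400 * h\<^sup>2"
    "h < 1 \<Longrightarrow> 9 < real j * h \<Longrightarrow> (\<Sum>k<j+9. D_mat p j k * (1 - cutoff (real k * h))) = 0"
proof -
  define m where "m x = max 0 (1 - x\<^sup>2)" for x :: real
  define f where "f i x = (if i = 0 then 1 - m x ^ 3 else if i = (1::nat) then 6 * x * m x ^ 2
     else 6 * m x ^ 2 - 24 * x\<^sup>2 * m x)" for i and x :: real
  have inner: "((\<lambda>x. 1 - x\<^sup>2) has_real_derivative - 2 * x) (at x within {0..})" for x :: real
    by (auto intro!: derivative_eq_intros)
  have m3: "((\<lambda>x. m x ^ 3) has_real_derivative 3 * m x ^ 2 * (- 2 * x)) (at x within {0..})" for x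
    unfolding m_def using DERIV_chain2[OF max_0_power_deriv[of 1] inner] by (simp add: eval_nat_numeral)
  have m2: "((\<lambda>x. m x ^ 2) has_real_derivative 2 * m x * (- 2 * x)) (at x within {0..})" for x
    unfolding m_def using DERIV_chain2[OF max_0_power_deriv[of 0] inner] by (simp add: eval_nat_numeral)
  have f_eq: "f 0 = (\<lambda>x. 1 - m x ^ 3)" "f 1 = (\<lambda>x. 6 * x * m x ^ 2)" by (simp_all add: fun_eq_iff f_def)
  have d0: "(f 0 has_real_derivative f 1 x) (at x within {0..})" for x
    using DERIV_diff[OF DERIV_const m3[of x], of 1] unfolding f_eq by (simp add: mult_ac)
  have d1: "(f 1 has_real_derivative f 2 x) (at x within {0..})" for x
    using DERIV_mult[OF DERIV_cmult_Id[of 6 x] m2[of x]] unfolding f_eq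
    by (simp add: f_def power2_eq_square algebra_simps)
  have "\<bar>(\<Sum>k<j+9. D_mat p j k * f 0 (real k * h)) / h\<^sup>2 - (if 2 \<le> (1::nat) then f 2 (real j * h) else 0)\<bar>
      \<le> 170 * 8 ^ Suc 1 * 30 * h ^ (1 - 1)"
  proof (rule D_mat_truncation[OF p _ _ h])
    show "(f i has_real_derivative f (Suc i) x) (at x within {0..})" if "0 \<le> x" "i \<le> 1" for i x
    proof -
      have "i = 0 \<or> i = 1" using that by auto
      then show ?thesis using d0[of x] d1[of x] by (auto simp: numeral_2_eq_2)
    qed
    show "\<bar>f (Suc 1) x\<bar> \<le> 30" if "0 \<le> x" for x
    proof (cases "x < 1")
      case True
      then have x: "0 \<le> x\<^sup>2" "x\<^sup>2 \<le> 1" using that by (auto intro: power_le_one)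
      then have m: "0 \<le> m x" "m x \<le> 1" by (auto simp: m_def)
      have "0 \<le> m x ^ 2" "m x ^ 2 \<le> 1" "0 \<le> x\<^sup>2 * m x" "x\<^sup>2 * m x \<le> 1"
        using x m by (auto intro: power_le_one mult_le_one)
      moreover have "f (Suc 1) x = 6 * m x ^ 2 - 24 * (x\<^sup>2 * m x)" by (simp add: f_def)
      ultimately show ?thesis by linarith
    next
      case False
      then have "m x = 0" by (simp add: m_def)
      then show ?thesis by (simp add: f_def)
    qed
  qed (use p in auto)
  then have "\<bar>\<Sum>k<j+9. D_mat p j k * f 0 (real k * h)\<bar> \<le> 326400 * h\<^sup>2"
    using h by (simp add: abs_divide pos_divide_le_eq)
  then show "\<bar>\<Sum>k<j+9. D_mat p j k * (1 - cutoff (real k * h))\<bar> \<le> 326400 * h\<^sup>2"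
    by (simp add: f_def m_def cutoff_def)
  \<comment> \<open>A row centred beyond 9 uses only nodes beyond 1, where 1 - cutoff is constant,
    and D annihilates constants.\<close>
  assume far: "h < 1" "9 < real j * h"
  have "(\<Sum>k<j+9. D_mat p j k * (1 - cutoff (real k * h))) = (\<Sum>k<j+9. D_mat p j k * (real k - real j) ^ 0)"
  proof (rule sum.cong[OF refl])
    fix k
    show "D_mat p j k * (1 - cutoff (real k * h)) = D_mat p j k * (real k - real j) ^ 0"
    proof (cases "j \<le> k + 8")
      case True
      then have "real j * h \<le> (real k + 8) * h" using h by (intro mult_right_mono) linarith+
      then have "real j * h \<le> real k * h + 8 * h" by (simp add: distrib_right)
      then have "1 \<le> real k * h" using far by simp
      then show ?thesis by (simp add: cutoff_props)
    next
      case False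
      then show ?thesis using D_mat_band[OF p, of j k] by auto
    qed
  qed
  also have "\<dots> = 0" using D_moments[OF p, of 0 j] by simp
  finally show "(\<Sum>k<j+9. D_mat p j k * (1 - cutoff (real k * h))) = 0" .
qed

section \<open>Error bounds\<close>

text \<open>Mentions neither the data nor the numerical solution, so that error constants can be
  fixed for U before these are introduced.\<close>

definition solves_error_equation ::
  "nat \<Rightarrow> real \<Rightarrow> real \<Rightarrow> (real \<Rightarrow> real \<Rightarrow> real) \<Rightarrow> real \<Rightarrow> (real \<Rightarrow> nat \<Rightarrow> real) \<Rightarrow> bool" where
  "solves_error_equation p \<tau> h U T \<xi> \<longleftrightarrow> (\<exists>\<xi>'. (\<forall>j. \<xi> 0 j = 0 \<and> \<xi>' 0 j = 0) \<and>
     (\<forall>t\<in>{0..T}. summable (\<lambda>j. (\<xi> t j)\<^sup>2)) \<and>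
     (\<forall>t\<in>{0..T}. \<forall>j. ((\<lambda>s. \<xi> s j) has_real_derivative \<xi>' t j) (at t within {0..T}) \<and>
        ((\<lambda>s. \<xi>' s j) has_real_derivative - L_op p \<tau> (\<xi> t) j / h\<^sup>2 + trunc p h U 0 j t) (at t within {0..T})))"

lemma half_power_lt_6: "j < 6 \<Longrightarrow> 1 \<le> 64 * (1/2 :: real) ^ j"
proof -
  assume "j < 6"
  then have "(1/2 :: real) ^ 6 \<le> (1/2) ^ j" by (intro power_decreasing) auto
  then show ?thesis by (simp add: eval_nat_numeral)
qed

text \<open>The energy estimate alone: boundary rows contribute h^p with an extra sqrt h from the
  profile, and interior rows h^(2p), which is no larger than h^p sqrt h because p \<ge> 1 and h <
  1.\<close>

lemma error_bound_critical:
  assumes p: "p \<in> {1, 2, 3}" and \<tau>: "tau_crit p \<le> \<tau>" and U: "smooth_quadrant U"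
    and R: "0 \<le> R" "\<And>x t. 0 \<le> t \<Longrightarrow> R + t < x \<Longrightarrow> U x t = 0" and T: "0 \<le> T"
  obtains K where "0 \<le> K" "\<And>h \<xi> t. 0 < h \<Longrightarrow> h < 1 \<Longrightarrow> solves_error_equation p \<tau> h U T \<xi> \<Longrightarrow> t \<in> {0..T} \<Longrightarrow>
    sqrt h * l2norm (\<xi> t) \<le> K * (h ^ p * sqrt h)"
proof -
  obtain C where C: "0 \<le> C"
    "\<And>h j t. 0 < h \<Longrightarrow> t \<in> {0..T} \<Longrightarrow> \<bar>trunc p h U 0 j t\<bar> \<le> C * h ^ p"
    "\<And>h j t. 0 < h \<Longrightarrow> t \<in> {0..T} \<Longrightarrow> 6 \<le> j \<Longrightarrow> \<bar>trunc p h U 0 j t\<bar> \<le> C * h ^ (2 * p)"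
    "\<And>h j t. 0 < h \<Longrightarrow> h < 1 \<Longrightarrow> t \<in> {0..T} \<Longrightarrow> R + T + 8 < real j * h \<Longrightarrow> trunc p h U 0 j t = 0"
    using trunc_bound[OF p U R T, of 0] by blast
  define M X where "M = 3 * (1 + 2 * T * (1 + T))" and "X = R + T + 8"
  have M: "0 \<le> M" using T by (simp add: M_def)
  have X: "0 \<le> X" using R T by (simp add: X_def)
  define K where "K = M * (sqrt (X + 1) * C + 128 * C)"
  show thesis
  proof (rule that[of K])
    show "0 \<le> K" using M X C(1) by (simp add: K_def)
    fix h t :: real and \<xi> :: "real \<Rightarrow> nat \<Rightarrow> real"
    assume h: "0 < h" "h < 1" and \<xi>: "solves_error_equation p \<tau> h U T \<xi>" and t: "t \<in> {0..T}"
    from \<xi> obtain \<xi>' where init: "\<forall>j. \<xi> 0 j = 0 \<and> \<xi>' 0 j = 0" and summ: "\<forall>t\<in>{0..T}. summable (\<lambda>j. (\<xi> t j)\<^sup>2)"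
      and deriv: "\<forall>t\<in>{0..T}. \<forall>j. ((\<lambda>s. \<xi> s j) has_real_derivative \<xi>' t j) (at t within {0..T}) \<and>
        ((\<lambda>s. \<xi>' s j) has_real_derivative - L_op p \<tau> (\<xi> t) j / h\<^sup>2 + trunc p h U 0 j t) (at t within {0..T})"
      unfolding solves_error_equation_def by (elim exE conjE)
    note eq = init[THEN spec, THEN conjunct1] init[THEN spec, THEN conjunct2] summ[THEN bspec]
      deriv[THEN bspec, THEN spec, THEN conjunct1] deriv[THEN bspec, THEN spec, THEN conjunct2]
    \<comment> \<open>64 = 2^6 lifts the geometric part to at least C h^p in all rows j < 6, where
      only the boundary bound is available.\<close>
    define \<beta> where "\<beta> = profile h X (C * h ^ (2 * p)) (64 * C * h ^ p)"
    have c0: "0 \<le> C * h ^ (2 * p)" "0 \<le> 64 * C * h ^ p" using C(1) h by auto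
    have \<beta>0: "0 \<le> \<beta> j" for j using c0 by (simp add: \<beta>_def profile_def)
    have \<beta>: "\<bar>trunc p h U 0 j t\<bar> \<le> \<beta> j" if t: "t \<in> {0..T}" for j t
    proof (cases "j < 6")
      case True
      have "C * h ^ p * 1 \<le> C * h ^ p * (64 * (1/2) ^ j)"
        using half_power_lt_6[OF True] C(1) h by (intro mult_left_mono) auto
      also have "\<dots> = 64 * C * h ^ p * (1/2) ^ j" by (simp only: mult_ac)
      finally have "\<bar>trunc p h U 0 j t\<bar> \<le> 64 * C * h ^ p * (1/2) ^ j" using C(2)[OF h(1) t, of j] by linarith
      also have "\<dots> \<le> \<beta> j" unfolding \<beta>_def profile_def using c0(1) by simp
      finally show ?thesis .
    next
      case False
      show ?thesis
      proof (cases "real j * h \<le> X")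
        case True
        have "0 \<le> 64 * C * h ^ p * (1/2) ^ j" using c0 by simp
        then show ?thesis using C(3)[OF h(1) t, of j] False True by (simp add: \<beta>_def profile_def)
      next
        case False
        then show ?thesis using C(4)[OF h t, of j] \<beta>0[of j] by (simp add: X_def)
      qed
    qed
    have \<beta>_init: "\<bar>\<xi> 0 j\<bar> \<le> \<beta> j" "\<bar>\<xi>' 0 j\<bar> \<le> \<beta> j" for j by (simp_all add: eq(1,2) \<beta>0)
    note prof = l2norm_profile_le[OF h X c0, folded \<beta>_def]
    have "l2norm (\<xi> t) \<le> M * l2norm \<beta>"
      unfolding M_def
      by (rule scheme_stable[where w = \<xi> and w' = \<xi>' and r = "\<lambda>t j. trunc p h U 0 j t" and \<beta> = \<beta> and t = t,
            OF p \<tau> h(1) T eq(4) eq(5) eq(3) prof(1) \<beta> \<beta>_init t])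
    then have "sqrt h * l2norm (\<xi> t) \<le> sqrt h * (M * l2norm \<beta>)" using h by (intro mult_left_mono) auto
    also have "\<dots> = M * (sqrt h * l2norm \<beta>)" by simp
    also have "\<dots> \<le> M * (sqrt (X + 1) * (C * h ^ (2 * p)) + 2 * sqrt h * (64 * C * h ^ p))"
      by (intro mult_left_mono prof M)
    also have "\<dots> \<le> M * (sqrt (X + 1) * (C * (h ^ p * sqrt h)) + 2 * sqrt h * (64 * C * h ^ p))"
    proof -
      have "h \<le> sqrt h"
        using h by (intro real_le_rsqrt) (simp add: power2_eq_square mult_le_one mult_left_le)
      moreover have "h ^ p \<le> h ^ 1" using h p by (intro power_decreasing) auto
      ultimately have "h ^ p * h ^ p \<le> h ^ p * sqrt h" using h by (intro mult_left_mono) auto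
      then have "h ^ (2 * p) \<le> h ^ p * sqrt h" by (simp add: mult_2 power_add)
      then show ?thesis using M C(1) X by (intro mult_left_mono add_right_mono) auto
    qed
    also have "\<dots> = K * (h ^ p * sqrt h)" by (simp add: K_def algebra_simps)
    finally show "sqrt h * l2norm (\<xi> t) \<le> K * (h ^ p * sqrt h)" .
  qed
qed

lemma L_op_diff: "L_op p \<tau> (\<lambda>k. x k - y k) j = L_op p \<tau> x j - L_op p \<tau> y j"
  by (simp add: L_op_def right_diff_distrib sum_subtractf diff_divide_distrib)

lemma L_op_cmult: "L_op p \<tau> (\<lambda>k. c * x k) j = c * L_op p \<tau> x j"
  by (simp add: L_op_def sum_distrib_left mult.left_commute)

lemma L_op_sum: "L_op p \<tau> (\<lambda>k. \<Sum>i\<in>I. x i k) j = (\<Sum>i\<in>I. L_op p \<tau> (x i) j)"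
proof -
  have "(\<Sum>k<j+9. M_mat p \<tau> j k * (\<Sum>i\<in>I. x i k)) = (\<Sum>i\<in>I. \<Sum>k<j+9. M_mat p \<tau> j k * x i k)"
    unfolding sum_distrib_left by (rule sum.swap)
  then show ?thesis by (simp add: L_op_def sum_divide_distrib)
qed

lemma L_op_vanishing_boundary:
  assumes p: "p \<in> {1, 2, 3}" and "x 0 = 0"
  shows "L_op p \<tau> x j = - (\<Sum>k<j+9. D_mat p j k * x k)"
proof -
  have H: "H_mat p j \<noteq> 0" using H_mat_bounds(1)[OF p, of j] by auto
  have "M_mat p \<tau> j k * x k = - H_mat p j * (D_mat p j k * x k)" for k
    using assms(2) by (cases "k = 0") (simp_all add: M_mat_def HD_mat[OF p] algebra_simps flip: mult.assoc)
  then have "(\<Sum>k<j+9. M_mat p \<tau> j k * x k) = - H_mat p j * (\<Sum>k<j+9. D_mat p j k * x k)"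
    by (simp add: sum_distrib_left)
  then show ?thesis using H by (simp add: L_op_def)
qed

text \<open>The boundary truncation error of size \<open>h\<^sup>p\<close> is removed by a corrector of size \<open>h\<^sup>p\<^sup>+\<^sup>2\<close>: a
  combination of the solutions \<open>W\<close> of \<open>M W = e\<^sub>i\<close>, whose constant limits at infinity are cut off
  at distance \<open>1\<close>.\<close>

lemma error_bound_supercritical:
  assumes p: "p \<in> {1, 2, 3}" and \<tau>: "tau_crit p < \<tau>" and U: "smooth_quadrant U"
    and R: "0 \<le> R" "\<And>x t. 0 \<le> t \<Longrightarrow> R + t < x \<Longrightarrow> U x t = 0" and T: "0 \<le> T"
    and q: "q \<le> 2 * p" "q \<le> p + 2"
  obtains K where "0 \<le> K" "\<And>h \<xi> t. 0 < h \<Longrightarrow> h < 1 \<Longrightarrow> solves_error_equation p \<tau> h U T \<xi> \<Longrightarrow> t \<in> {0..T} \<Longrightarrow>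
    sqrt h * l2norm (\<xi> t) \<le> K * h ^ q"
proof -
  \<comment> \<open>Three time orders: the corrector is a combination of values of the truncation
    error, and its first two time derivatives enter the initial data and the residual.\<close>
  obtain C0 where C0: "0 \<le> C0"
    "\<And>h j t. 0 < h \<Longrightarrow> t \<in> {0..T} \<Longrightarrow> \<bar>trunc p h U 0 j t\<bar> \<le> C0 * h ^ p"
    "\<And>h j t. 0 < h \<Longrightarrow> t \<in> {0..T} \<Longrightarrow> 6 \<le> j \<Longrightarrow> \<bar>trunc p h U 0 j t\<bar> \<le> C0 * h ^ (2 * p)"
    "\<And>h j t. 0 < h \<Longrightarrow> h < 1 \<Longrightarrow> t \<in> {0..T} \<Longrightarrow> R + T + 8 < real j * h \<Longrightarrow> trunc p h U 0 j t = 0"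
    using trunc_bound[OF p U R T, of 0] by blast
  obtain C1 where C1: "0 \<le> C1"
    "\<And>h j t. 0 < h \<Longrightarrow> t \<in> {0..T} \<Longrightarrow> \<bar>trunc p h U 1 j t\<bar> \<le> C1 * h ^ p"
    "\<And>h j t. 0 < h \<Longrightarrow> t \<in> {0..T} \<Longrightarrow> 6 \<le> j \<Longrightarrow> \<bar>trunc p h U 1 j t\<bar> \<le> C1 * h ^ (2 * p)"
    "\<And>h j t. 0 < h \<Longrightarrow> h < 1 \<Longrightarrow> t \<in> {0..T} \<Longrightarrow> R + T + 8 < real j * h \<Longrightarrow> trunc p h U 1 j t = 0"
    using trunc_bound[OF p U R T, of 1] by blast
  obtain C2 where C2: "0 \<le> C2"
    "\<And>h j t. 0 < h \<Longrightarrow> t \<in> {0..T} \<Longrightarrow> \<bar>trunc p h U 2 j t\<bar> \<le> C2 * h ^ p"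
    "\<And>h j t. 0 < h \<Longrightarrow> t \<in> {0..T} \<Longrightarrow> 6 \<le> j \<Longrightarrow> \<bar>trunc p h U 2 j t\<bar> \<le> C2 * h ^ (2 * p)"
    "\<And>h j t. 0 < h \<Longrightarrow> h < 1 \<Longrightarrow> t \<in> {0..T} \<Longrightarrow> R + T + 8 < real j * h \<Longrightarrow> trunc p h U 2 j t = 0"
    using trunc_bound[OF p U R T, of 2] by blast
  define C where "C = C0 + C1 + C2"
  have C: "0 \<le> C" using C0(1) C1(1) C2(1) by (simp add: C_def)
  have trunc_le: "\<bar>trunc p h U d j t\<bar> \<le> C * h ^ p" if d: "d \<in> {0, 1, 2}" and h: "0 < h" and t: "t \<in> {0..T}" for d h j t
  proof -
    have le: "c * h ^ p \<le> C * h ^ p" if "c \<in> {C0, C1, C2}" for c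
      using that C0(1) C1(1) C2(1) h by (intro mult_right_mono) (auto simp: C_def)
    show ?thesis
      using d C0(2)[OF h t, of j] C1(2)[OF h t, of j] C2(2)[OF h t, of j] le[of C0] le[of C1] le[of C2] by auto
  qed
  have "\<forall>i. \<exists>z. (\<forall>j. (\<Sum>l<j+6. M_mat p \<tau> j l * fst z l) = (if j = i then 1 else 0)) \<and>
      (\<forall>j. \<bar>fst z j - fst (snd z)\<bar> \<le> snd (snd z) * (1/2) ^ j)"
  proof
    fix i
    obtain W a k where "\<And>j. (\<Sum>l<j+6. M_mat p \<tau> j l * W l) = (if j = i then 1 else 0)"
      "\<And>j. \<bar>W j - a\<bar> \<le> k * (1/2) ^ j"
      using M_mat_solvable[OF p \<tau>, of i] by blast
    then show "\<exists>z. (\<forall>j. (\<Sum>l<j+6. M_mat p \<tau> j l * fst z l) = (if j = i then 1 else 0)) \<and>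
      (\<forall>j. \<bar>fst z j - fst (snd z)\<bar> \<le> snd (snd z) * (1/2) ^ j)"
      by (intro exI[of _ "(W, a, k)"]) simp
  qed
  from choice[OF this] obtain z where
    z: "\<And>i. (\<forall>j. (\<Sum>l<j+6. M_mat p \<tau> j l * fst (z i) l) = (if j = i then 1 else 0)) \<and>
      (\<forall>j. \<bar>fst (z i) j - fst (snd (z i))\<bar> \<le> snd (snd (z i)) * (1/2) ^ j)" by blast
  define W a k where "W i = fst (z i)" and "a i = fst (snd (z i))" and "k i = snd (snd (z i))" for i
  have W: "(\<Sum>l<j+6. M_mat p \<tau> j l * W i l) = (if j = i then 1 else 0)"
    and Wa: "\<bar>W i j - a i\<bar> \<le> k i * (1/2) ^ j" for i j
    using z[of i] unfolding W_def a_def k_def by blast+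
  have k0: "0 \<le> k i" for i using order_trans[OF abs_ge_zero Wa, of i 0] by simp
  define n where "n i = k i + \<bar>a i\<bar>" for i
  have n: "0 \<le> n i" "\<bar>a i\<bar> \<le> n i" for i using k0[of i] by (simp_all add: n_def)
  define N where "N = (\<Sum>i<6. n i)"
  have N: "0 \<le> N" unfolding N_def by (intro sum_nonneg n)
  \<comment> \<open>Beyond R + T + 9 both the truncation error (from R + T + 8) and the cutoff
    defect (from 9) vanish.\<close>
  define M X where "M = 3 * (1 + 2 * T * (1 + T))" and "X = R + T + 9"
  have M: "0 \<le> M" using T by (simp add: M_def)
  have X: "0 \<le> X" using R T by (simp add: X_def)
  \<comment> \<open>The terms of c stand for the interior truncation error, the cutoff defect, with
    652800 = 2 * 326400 where 2 bounds H, and the second time derivative of the corrector; d is the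
    boundary-layer part of the latter.\<close>
  define c d where "c = C + 652800 * C * N + 2 * C * N" and "d = 2 * C * N"
  have cd: "0 \<le> c" "0 \<le> d" using C N by (auto simp: c_def d_def)
  define K where "K = (M + 1) * (sqrt (X + 1) * c + 2 * d)"
  show thesis
  proof (rule that[of K])
    show "0 \<le> K" using M X cd by (simp add: K_def)
    fix h t :: real and \<xi> :: "real \<Rightarrow> nat \<Rightarrow> real"
    assume h: "0 < h" "h < 1" and \<xi>: "solves_error_equation p \<tau> h U T \<xi>" and t: "t \<in> {0..T}"
    from \<xi> obtain \<xi>' where init: "\<forall>j. \<xi> 0 j = 0 \<and> \<xi>' 0 j = 0" and summ: "\<forall>t\<in>{0..T}. summable (\<lambda>j. (\<xi> t j)\<^sup>2)"
      and deriv: "\<forall>t\<in>{0..T}. \<forall>j. ((\<lambda>s. \<xi> s j) has_real_derivative \<xi>' t j) (at t within {0..T}) \<and>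
        ((\<lambda>s. \<xi>' s j) has_real_derivative - L_op p \<tau> (\<xi> t) j / h\<^sup>2 + trunc p h U 0 j t) (at t within {0..T})"
      unfolding solves_error_equation_def by (elim exE conjE)
    note eq = init[THEN spec, THEN conjunct1] init[THEN spec, THEN conjunct2] summ[THEN bspec]
      deriv[THEN bspec, THEN spec, THEN conjunct1] deriv[THEN bspec, THEN spec, THEN conjunct2]
    define tail where "tail j = 1 - cutoff (real j * h)" for j
    \<comment> \<open>Away from the boundary this subtracts the limit a_i of W_i, which makes G_i
      decay; \<open>tail 0 = 0\<close> keeps the penalty terms out of the defect.\<close>
    define G where "G i j = W i j - a i * tail j" for i j
    \<comment> \<open>The weights are fixed by L W_i = e_i / H_i: after division by h^2 the factors
      h^2 H_i reproduce the truncation error of rows 0 to 5. The index e counts time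
      derivatives.\<close>
    define \<kappa> where "\<kappa> e t j = (\<Sum>i<6. h\<^sup>2 * H_mat p i * trunc p h U e i t * G i j)" for e t j
    define \<beta> where "\<beta> = profile h X (c * h ^ q) (d * h ^ q)"
    have h01: "0 \<le> h" "h \<le> 1" using h by auto
    note hq = power_decreasing[OF q(1) h01] power_decreasing[OF q(2) h01]
    have cdq: "0 \<le> c * h ^ q" "0 \<le> d * h ^ q" using cd h by auto
    note prof = l2norm_profile_le[OF h X cdq, folded \<beta>_def]
    define I where "I j = (if real j * h \<le> X then 1 else 0 :: real)" for j
    have I01: "0 \<le> I j" "I j \<le> 1" for j by (auto simp: I_def)
    have \<beta>_eq: "\<beta> j = c * h ^ q * I j + d * h ^ q * (1/2) ^ j" for j by (simp add: \<beta>_def profile_def I_def)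
    have G: "\<bar>G i j\<bar> \<le> n i * (I j + (1/2) ^ j)" for i j
    proof -
      have "G i j = (W i j - a i) + a i * cutoff (real j * h)" by (simp add: G_def tail_def algebra_simps)
      then have "\<bar>G i j\<bar> \<le> \<bar>W i j - a i\<bar> + \<bar>a i\<bar> * \<bar>cutoff (real j * h)\<bar>"
        using abs_triangle_ineq[of "W i j - a i" "a i * cutoff (real j * h)"] by (simp add: abs_mult)
      moreover have "\<bar>cutoff (real j * h)\<bar> \<le> I j"
      proof (cases "real j * h \<le> 1")
        case True
        then have "I j = 1" using X R T by (simp add: I_def X_def)
        then show ?thesis using cutoff_props by simp
      next
        case False
        then show ?thesis using cutoff_props(4)[of "real j * h"] I01 by simp
      qed
      then have "\<bar>a i\<bar> * \<bar>cutoff (real j * h)\<bar> \<le> \<bar>a i\<bar> * I j" by (intro mult_left_mono) auto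
      moreover have "0 \<le> k i * I j" "0 \<le> \<bar>a i\<bar> * (1/2) ^ j" using k0 I01 by auto
      ultimately have "\<bar>G i j\<bar> \<le> k i * I j + \<bar>a i\<bar> * I j + k i * (1/2) ^ j + \<bar>a i\<bar> * (1/2) ^ j"
        using Wa[of i j] by linarith
      also have "\<dots> = n i * (I j + (1/2) ^ j)" by (simp only: n_def distrib_left distrib_right)
      finally show ?thesis .
    qed
    have \<kappa>: "\<bar>\<kappa> e t j\<bar> \<le> 2 * C * N * h ^ q * (I j + (1/2) ^ j)" if e: "e \<in> {0, 1, 2}" and t: "t \<in> {0..T}" for e t j
    proof -
      have "\<bar>\<kappa> e t j\<bar> \<le> (\<Sum>i<6. h\<^sup>2 * 2 * (C * h ^ p) * (n i * (I j + (1/2) ^ j)))"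
        unfolding \<kappa>_def
      proof (rule order_trans[OF sum_abs sum_mono])
        fix i
        have "\<bar>h\<^sup>2 * H_mat p i * trunc p h U e i t * G i j\<bar> = h\<^sup>2 * \<bar>H_mat p i\<bar> * \<bar>trunc p h U e i t\<bar> * \<bar>G i j\<bar>"
          by (simp add: abs_mult)
        also have "\<dots> \<le> h\<^sup>2 * 2 * (C * h ^ p) * (n i * (I j + (1/2) ^ j))"
          using trunc_le[OF e h(1) t, of i] G[of i j] H_mat_bounds[OF p, of i] C h n(1)[of i]
          by (intro mult_mono) auto
        finally show "\<bar>h\<^sup>2 * H_mat p i * trunc p h U e i t * G i j\<bar>
          \<le> h\<^sup>2 * 2 * (C * h ^ p) * (n i * (I j + (1/2) ^ j))" .
      qed
      also have "\<dots> = 2 * C * N * h ^ (p + 2) * (I j + (1/2) ^ j)"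
        by (simp add: N_def sum_distrib_left sum_distrib_right power_add power2_eq_square mult_ac)
      also have "\<dots> \<le> 2 * C * N * h ^ q * (I j + (1/2) ^ j)"
        using hq(2) C N I01 by (intro mult_right_mono mult_left_mono) auto
      finally show ?thesis .
    qed
    have \<kappa>_\<beta>: "\<bar>\<kappa> e t j\<bar> \<le> \<beta> j" if "e \<in> {0, 1, 2}" "t \<in> {0..T}" for e t j
    proof -
      have "2 * C * N * h ^ q * I j \<le> c * h ^ q * I j"
        using C N I01 h by (intro mult_right_mono) (auto simp: c_def)
      then show ?thesis using \<kappa>[OF that, of j] by (simp add: \<beta>_eq d_def distrib_left)
    qed
    have \<kappa>_deriv: "((\<lambda>s. \<kappa> e s j) has_real_derivative \<kappa> (Suc e) t j) (at t within {0..T})" if t: "t \<in> {0..T}" for e t j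
      unfolding \<kappa>_def
      using t by (intro DERIV_sum DERIV_cmult_right DERIV_cmult DERIV_subset[OF trunc_deriv[OF U h(1)]]) auto
    define \<nu> where "\<nu> j = L_op p \<tau> tail j" for j
    have \<nu>: "\<bar>\<nu> j\<bar> \<le> 326400 * h\<^sup>2 * I j" for j
    proof -
      have "tail 0 = 0" by (simp add: tail_def cutoff_props)
      then have eq: "\<nu> j = - (\<Sum>k<j+9. D_mat p j k * (1 - cutoff (real k * h)))"
        unfolding \<nu>_def L_op_vanishing_boundary[where x = tail, OF p \<open>tail 0 = 0\<close>] by (simp add: tail_def)
      show ?thesis
      proof (cases "real j * h \<le> X")
        case True
        then show ?thesis using cutoff_D_mat(1)[OF p h(1), of j] by (simp add: eq I_def)
      next
        case False
        then have "9 < real j * h" using R T by (simp add: X_def)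
        then show ?thesis using cutoff_D_mat(2)[OF p h(1,2), of j] I01 by (simp add: eq)
      qed
    qed
    define \<mu> where "\<mu> t j = (\<Sum>i<6. H_mat p i * trunc p h U 0 i t * (a i * \<nu> j))" for t j
    have \<mu>: "\<bar>\<mu> t j\<bar> \<le> 652800 * C * N * h ^ q * I j" if t: "t \<in> {0..T}" for t j
    proof -
      have "\<bar>\<mu> t j\<bar> \<le> (\<Sum>i<6. 2 * (C * h ^ p) * (n i * (326400 * h\<^sup>2 * I j)))"
        unfolding \<mu>_def
      proof (rule order_trans[OF sum_abs sum_mono])
        fix i
        have "\<bar>H_mat p i * trunc p h U 0 i t * (a i * \<nu> j)\<bar> = \<bar>H_mat p i\<bar> * \<bar>trunc p h U 0 i t\<bar> * (\<bar>a i\<bar> * \<bar>\<nu> j\<bar>)"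
          by (simp add: abs_mult)
        also have "\<dots> \<le> 2 * (C * h ^ p) * (n i * (326400 * h\<^sup>2 * I j))"
          using trunc_le[OF _ h(1) t, of 0 i] \<nu>[of j] H_mat_bounds[OF p, of i] C h n[of i] I01[of j]
          by (intro mult_mono) auto
        finally show "\<bar>H_mat p i * trunc p h U 0 i t * (a i * \<nu> j)\<bar> \<le> 2 * (C * h ^ p) * (n i * (326400 * h\<^sup>2 * I j))" .
      qed
      also have "\<dots> = 652800 * C * N * h ^ (p + 2) * I j"
        by (simp add: N_def sum_distrib_left sum_distrib_right power_add power2_eq_square mult_ac)
      also have "\<dots> \<le> 652800 * C * N * h ^ q * I j"
        using hq(2) C N I01 by (intro mult_right_mono mult_left_mono) auto
      finally show ?thesis .
    qed
    have L_G: "L_op p \<tau> (G i) j = (if j = i then 1 / H_mat p j else 0) - a i * \<nu> j" for i j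
    proof -
      have "L_op p \<tau> (W i) j = (if j = i then 1 / H_mat p j else 0)"
        using M_mat_sum[OF p, of j "j + 9"] W[of j i] by (simp add: L_op_def)
      moreover have "L_op p \<tau> (\<lambda>l. a i * tail l) j = a i * \<nu> j" unfolding \<nu>_def by (rule L_op_cmult)
      ultimately show ?thesis unfolding G_def[abs_def] L_op_diff by simp
    qed
    have L_\<kappa>: "L_op p \<tau> (\<kappa> 0 t) j / h\<^sup>2 = (if j < 6 then trunc p h U 0 j t else 0) - \<mu> t j" for t j
    proof -
      have H: "H_mat p i \<noteq> 0" for i using H_mat_bounds(1)[OF p, of i] by auto
      have "L_op p \<tau> (\<kappa> 0 t) j = (\<Sum>i<6. h\<^sup>2 * H_mat p i * trunc p h U 0 i t * L_op p \<tau> (G i) j)"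
        unfolding \<kappa>_def[abs_def] L_op_sum L_op_cmult ..
      also have "\<dots> = h\<^sup>2 * (\<Sum>i<6. H_mat p i * trunc p h U 0 i t * ((if j = i then 1 / H_mat p j else 0) - a i * \<nu> j))"
        unfolding L_G by (simp add: sum_distrib_left mult.assoc)
      also have "(\<Sum>i<6. H_mat p i * trunc p h U 0 i t * ((if j = i then 1 / H_mat p j else 0) - a i * \<nu> j))
          = (\<Sum>i<6. if j = i then trunc p h U 0 i t else 0) - \<mu> t j"
        unfolding \<mu>_def sum_subtractf[symmetric] by (rule sum.cong) (auto simp: H right_diff_distrib)
      also have "(\<Sum>i<6. if j = i then trunc p h U 0 i t else 0) = (if j < 6 then trunc p h U 0 j t else 0)"
        by (simp add: sum.delta)
      finally show ?thesis using h by simp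
    qed
    \<comment> \<open>Residual of w = \<xi> - \<kappa>: rows below 6 are cancelled exactly, at the
      price of the cutoff defect and of the second time derivative of the corrector.\<close>
    define r where "r t j = (if j < 6 then 0 else trunc p h U 0 j t) + \<mu> t j - \<kappa> 2 t j" for t j
    have r: "\<bar>r t j\<bar> \<le> \<beta> j" if t: "t \<in> {0..T}" for t j
    proof -
      have "\<bar>if j < 6 then 0 else trunc p h U 0 j t\<bar> \<le> C * h ^ q * I j"
      proof (cases "j < 6 \<or> \<not> real j * h \<le> X")
        case True
        then have "(if j < 6 then 0 else trunc p h U 0 j t) = 0" using C0(4)[OF h t, of j] by (auto simp: X_def)
        moreover have "0 \<le> C * h ^ q * I j" using C h I01 by simp
        ultimately show ?thesis by simp
      next
        case False
        have "C0 * h ^ (2 * p) \<le> C * h ^ q"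
          using hq(1) C0(1) C1(1) C2(1) h by (intro mult_mono) (auto simp: C_def)
        then show ?thesis using False C0(3)[OF h(1) t, of j] by (simp add: I_def)
      qed
      moreover have "\<bar>\<kappa> 2 t j\<bar> \<le> 2 * C * N * h ^ q * (I j + (1/2) ^ j)" using \<kappa>[OF _ t, of 2 j] by simp
      moreover have "\<bar>r t j\<bar> \<le> \<bar>if j < 6 then 0 else trunc p h U 0 j t\<bar> + \<bar>\<mu> t j\<bar> + \<bar>\<kappa> 2 t j\<bar>"
        unfolding r_def by linarith
      ultimately have "\<bar>r t j\<bar> \<le> C * h ^ q * I j + 652800 * C * N * h ^ q * I j + 2 * C * N * h ^ q * (I j + (1/2) ^ j)"
        using \<mu>[OF t, of j] by linarith
      also have "\<dots> = \<beta> j" by (simp add: \<beta>_eq c_def d_def algebra_simps)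
      finally show ?thesis .
    qed
    have \<kappa>_summ: "summable (\<lambda>j. (\<kappa> 0 t j)\<^sup>2)" "l2norm (\<kappa> 0 t) \<le> l2norm \<beta>" if "t \<in> {0..T}" for t
      by (rule l2norm_le_dom[OF prof(1) \<kappa>_\<beta>[OF _ that]], simp)+
    define w where "w t j = \<xi> t j - \<kappa> 0 t j" for t j
    have w_summ: "summable (\<lambda>j. (w t j)\<^sup>2)" if "t \<in> {0..T}" for t
    proof -
      have "summable (\<lambda>j. (\<xi> t j + - \<kappa> 0 t j)\<^sup>2)"
        by (rule l2norm_add_le(1)[OF eq(3)[OF that]]) (use \<kappa>_summ(1)[OF that] in simp)
      then show ?thesis by (simp add: w_def)
    qed
    have T0: "(0::real) \<in> {0..T}" using T by simp
    have w1: "((\<lambda>s. w s j) has_real_derivative \<xi>' t j - \<kappa> 1 t j) (at t within {0..T})" if "t \<in> {0..T}" for t j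
      unfolding w_def One_nat_def by (rule DERIV_diff[OF eq(4)[OF that] \<kappa>_deriv[OF that]])
    have w2: "((\<lambda>s. \<xi>' s j - \<kappa> 1 s j) has_real_derivative - L_op p \<tau> (w t) j / h\<^sup>2 + r t j) (at t within {0..T})"
      if "t \<in> {0..T}" for t j
    proof -
      have "L_op p \<tau> (w t) j = L_op p \<tau> (\<xi> t) j - L_op p \<tau> (\<kappa> 0 t) j"
        unfolding w_def[abs_def] by (rule L_op_diff)
      then have "L_op p \<tau> (w t) j / h\<^sup>2 = L_op p \<tau> (\<xi> t) j / h\<^sup>2 - ((if j < 6 then trunc p h U 0 j t else 0) - \<mu> t j)"
        by (simp only: diff_divide_distrib L_\<kappa>)
      then have "- L_op p \<tau> (w t) j / h\<^sup>2 + r t j = (- L_op p \<tau> (\<xi> t) j / h\<^sup>2 + trunc p h U 0 j t) - \<kappa> (Suc 1) t j"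
        unfolding r_def Suc_1 by (cases "j < 6") simp_all
      then show ?thesis by (simp only: DERIV_diff[OF eq(5)[OF that] \<kappa>_deriv[OF that]])
    qed
    \<comment> \<open>The corrector need not vanish at time 0, so w may start from nonzero data;
      these are within \<beta> as well.\<close>
    have w3: "\<bar>w 0 j\<bar> \<le> \<beta> j" "\<bar>\<xi>' 0 j - \<kappa> 1 0 j\<bar> \<le> \<beta> j" for j
      using \<kappa>_\<beta>[OF _ T0, of 0 j] \<kappa>_\<beta>[OF _ T0, of 1 j] by (simp_all add: w_def eq(1,2))
    have "l2norm (w t) \<le> M * l2norm \<beta>"
      unfolding M_def
      by (rule scheme_stable[where w = w and w' = "\<lambda>t j. \<xi>' t j - \<kappa> 1 t j" and r = r and \<beta> = \<beta> and t = t,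
            OF p less_imp_le[OF \<tau>] h(1) T w1 w2 w_summ prof(1) r w3 t])
    moreover have "l2norm (\<xi> t) \<le> l2norm (w t) + l2norm (\<kappa> 0 t)"
    proof -
      have "\<xi> t = (\<lambda>j. w t j + \<kappa> 0 t j)" by (simp add: w_def)
      then show ?thesis using l2norm_add_le(2)[OF w_summ[OF t] \<kappa>_summ(1)[OF t]] by (simp only:)
    qed
    moreover have "(M + 1) * l2norm \<beta> = M * l2norm \<beta> + l2norm \<beta>" by (simp add: distrib_right)
    ultimately have "l2norm (\<xi> t) \<le> (M + 1) * l2norm \<beta>" using \<kappa>_summ(2)[OF t] by linarith
    then have "sqrt h * l2norm (\<xi> t) \<le> sqrt h * ((M + 1) * l2norm \<beta>)" using h by (intro mult_left_mono) auto
    also have "\<dots> = (M + 1) * (sqrt h * l2norm \<beta>)" by simp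
    also have "\<dots> \<le> (M + 1) * (sqrt (X + 1) * (c * h ^ q) + 2 * sqrt h * (d * h ^ q))"
      using M by (intro mult_left_mono prof) auto
    also have "\<dots> \<le> (M + 1) * (sqrt (X + 1) * (c * h ^ q) + 2 * 1 * (d * h ^ q))"
      using M h cdq by (intro mult_left_mono add_left_mono mult_right_mono) auto
    also have "\<dots> = K * h ^ q" by (simp add: K_def algebra_simps)
    finally show "sqrt h * l2norm (\<xi> t) \<le> K * h ^ q" .
  qed
qed

text \<open>Both branches of \<open>rate\<close> are uniform in p: min(2p, p + 2) above the
  threshold and p + 1/2 at it.\<close>

lemma error_bound:
  assumes p: "p \<in> {1, 2, 3}" and \<tau>: "tau_crit p \<le> \<tau>" and U: "smooth_quadrant U"
    and R: "0 \<le> R" "\<And>x t. 0 \<le> t \<Longrightarrow> R + t < x \<Longrightarrow> U x t = 0" and T: "0 \<le> T"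
  obtains K where "0 \<le> K" "\<And>h \<xi> t. 0 < h \<Longrightarrow> h < 1 \<Longrightarrow> solves_error_equation p \<tau> h U T \<xi> \<Longrightarrow> t \<in> {0..T} \<Longrightarrow>
    sqrt h * l2norm (\<xi> t) \<le> K * h powr rate p \<tau>"
proof (cases "tau_crit p < \<tau>")
  case True
  define q where "q = min (2 * p) (p + 2)"
  have "rate p \<tau> = real q" using p True by (auto simp: rate_def q_def)
  then have "h ^ q = h powr rate p \<tau>" if "0 < h" for h using that by (simp add: powr_realpow)
  moreover obtain K where "0 \<le> K" "\<And>h \<xi> t. 0 < h \<Longrightarrow> h < 1 \<Longrightarrow> solves_error_equation p \<tau> h U T \<xi> \<Longrightarrow> t \<in> {0..T} \<Longrightarrow>
    sqrt h * l2norm (\<xi> t) \<le> K * h ^ q"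
    using error_bound_supercritical[OF p True U R T, of q] by (auto simp: q_def)
  ultimately show thesis using that[of K] by simp
next
  case False
  then have "rate p \<tau> = real p + 1/2" using p by (auto simp: rate_def)
  then have "h ^ p * sqrt h = h powr rate p \<tau>" if "0 < h" for h
    using that by (simp add: powr_realpow powr_add powr_half_sqrt)
  moreover obtain K where "0 \<le> K" "\<And>h \<xi> t. 0 < h \<Longrightarrow> h < 1 \<Longrightarrow> solves_error_equation p \<tau> h U T \<xi> \<Longrightarrow> t \<in> {0..T} \<Longrightarrow>
    sqrt h * l2norm (\<xi> t) \<le> K * (h ^ p * sqrt h)"
    using error_bound_critical[OF p \<tau> U R T] by blast
  ultimately show thesis using that[of K] by simp
qed

section \<open>Integration in time and the choice of the constant\<close>

lemma grid_norm_eq: "grid_norm h v = sqrt h * l2norm v"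
  by (simp add: grid_norm_def l2norm_def real_sqrt_mult)

text \<open>Only the coordinates are assumed continuous in t, so integrability of the squared norm
  comes from monotone convergence of its partial sums.\<close>

lemma grid_norm_square_integrable:
  assumes h: "0 < h" and cont: "\<And>j. continuous_on {0..T} (\<lambda>t. \<xi> t j)"
    and summ: "\<And>t. t \<in> {0..T} \<Longrightarrow> summable (\<lambda>j. (\<xi> t j)\<^sup>2)"
    and bnd: "\<And>t. t \<in> {0..T} \<Longrightarrow> grid_norm h (\<xi> t) \<le> M" and T: "0 \<le> T"
  shows "(\<lambda>t. (grid_norm h (\<xi> t))\<^sup>2) integrable_on {0..T}"
    "sqrt (integral {0..T} (\<lambda>t. (grid_norm h (\<xi> t))\<^sup>2)) \<le> sqrt T * M"
proof -
  have nn: "0 \<le> grid_norm h (\<xi> t)" if "t \<in> {0..T}" for t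
    using h l2norm_nonneg[OF summ[OF that]] by (simp add: grid_norm_eq)
  have M: "0 \<le> M" using nn[of 0] bnd[of 0] T by simp
  have sq: "(grid_norm h (\<xi> t))\<^sup>2 = h * (\<Sum>j. (\<xi> t j)\<^sup>2)" if "t \<in> {0..T}" for t
    using h suminf_nonneg[OF summ[OF that]] by (simp add: grid_norm_def)
  have le: "(grid_norm h (\<xi> t))\<^sup>2 \<le> M\<^sup>2" if "t \<in> {0..T}" for t
    using bnd[OF that] nn[OF that] by (intro power_mono)
  have part: "h * (\<Sum>j<n. (\<xi> t j)\<^sup>2) \<le> (grid_norm h (\<xi> t))\<^sup>2" if "t \<in> {0..T}" for t n
    unfolding sq[OF that] using h summ[OF that] by (intro mult_left_mono sum_le_suminf) auto
  have int_n: "(\<lambda>t. h * (\<Sum>j<n. (\<xi> t j)\<^sup>2)) integrable_on {0..T}" for n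
    by (intro integrable_continuous_real continuous_intros cont)
  show int: "(\<lambda>t. (grid_norm h (\<xi> t))\<^sup>2) integrable_on {0..T}"
  proof (rule monotone_convergence_increasing[THEN conjunct1])
    show "(\<lambda>t. h * (\<Sum>j<n. (\<xi> t j)\<^sup>2)) integrable_on {0..T}" for n by (rule int_n)
    show "h * (\<Sum>j<n. (\<xi> t j)\<^sup>2) \<le> h * (\<Sum>j<Suc n. (\<xi> t j)\<^sup>2)" for n t
      using h by (intro mult_left_mono) auto
    show "(\<lambda>n. h * (\<Sum>j<n. (\<xi> t j)\<^sup>2)) \<longlonglongrightarrow> (grid_norm h (\<xi> t))\<^sup>2" if "t \<in> {0..T}" for t
      unfolding sq[OF that] by (intro tendsto_mult tendsto_const summable_LIMSEQ summ that)
    show "bounded (range (\<lambda>n. integral {0..T} (\<lambda>t. h * (\<Sum>j<n. (\<xi> t j)\<^sup>2))))"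
    proof (rule boundedI)
      fix y assume "y \<in> range (\<lambda>n. integral {0..T} (\<lambda>t. h * (\<Sum>j<n. (\<xi> t j)\<^sup>2)))"
      then obtain n where y: "y = integral {0..T} (\<lambda>t. h * (\<Sum>j<n. (\<xi> t j)\<^sup>2))" by blast
      have "0 \<le> y" unfolding y using h by (intro integral_nonneg int_n mult_nonneg_nonneg sum_nonneg) auto
      moreover have "y \<le> integral {0..T} (\<lambda>t. M\<^sup>2)"
        unfolding y using part le by (intro integral_le int_n) (auto intro: order_trans)
      ultimately show "norm y \<le> integral {0..T} (\<lambda>t. M\<^sup>2)" by simp
    qed
  qed
  have "integral {0..T} (\<lambda>t. (grid_norm h (\<xi> t))\<^sup>2) \<le> integral {0..T} (\<lambda>t. M\<^sup>2)"
    using le by (intro integral_le int) auto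
  also have "\<dots> = T * M\<^sup>2" using T by simp
  finally have "sqrt (integral {0..T} (\<lambda>t. (grid_norm h (\<xi> t))\<^sup>2)) \<le> sqrt (T * M\<^sup>2)"
    by (rule real_sqrt_le_mono)
  then show "sqrt (integral {0..T} (\<lambda>t. (grid_norm h (\<xi> t))\<^sup>2)) \<le> sqrt T * M"
    using M by (simp add: real_sqrt_mult)
qed

text \<open>The constant has to be chosen from U and T before F, f1, f2, g. One admissible set of
  data for U supplies the support radius through finite propagation, and the bound then holds for
  all data with the same U; if no such set exists, the claim is vacuous.\<close>

lemma convergence_for_solution:
  assumes p: "p \<in> {1, 2, 3}" and \<tau>: "tau_crit p \<le> \<tau>" and T: "0 < T"
  shows "\<exists>c. \<forall>F f1 f2 g h u. admissible_data F f1 f2 g \<and> smooth_wave_solution F f1 f2 g U \<and> 0 < h \<and> h < 1 \<and>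
     sbp_sat_solution p \<tau> h F f1 f2 g u \<and> (\<forall>t\<ge>0. finite_grid_norm (pointwise_error h U u t)) \<longrightarrow>
     (\<lambda>t. (grid_norm h (pointwise_error h U u t))\<^sup>2) integrable_on {0..T} \<and>
     sqrt (integral {0..T} (\<lambda>t. (grid_norm h (pointwise_error h U u t))\<^sup>2)) \<le> c * h powr rate p \<tau>"
proof (cases "\<exists>F f1 f2 g. admissible_data F f1 f2 g \<and> smooth_wave_solution F f1 f2 g U")
  case True
  then obtain F0 f10 f20 g0 where data0: "admissible_data F0 f10 f20 g0" "smooth_wave_solution F0 f10 f20 g0 U"
    by blast
  then have U: "smooth_quadrant U" by (simp add: smooth_wave_solution_def)
  obtain R where R: "0 \<le> R" "\<And>x t. 0 \<le> t \<Longrightarrow> R + t < x \<Longrightarrow> U x t = 0"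
    using finite_propagation[OF data0] by blast
  have T0: "0 \<le> T" using T by simp
  obtain K where K: "0 \<le> K" "\<And>h \<xi> t. 0 < h \<Longrightarrow> h < 1 \<Longrightarrow> solves_error_equation p \<tau> h U T \<xi> \<Longrightarrow> t \<in> {0..T} \<Longrightarrow>
    sqrt h * l2norm (\<xi> t) \<le> K * h powr rate p \<tau>"
    using error_bound[OF p \<tau> U R T0] by blast
  show ?thesis
  proof (intro exI[of _ "sqrt T * K"] allI impI, elim conjE)
    fix F f1 f2 g h u
    assume sol: "smooth_wave_solution F f1 f2 g U" and h: "0 < h" "h < 1"
      and u: "sbp_sat_solution p \<tau> h F f1 f2 g u"
      and fin: "\<forall>t\<ge>0. finite_grid_norm (pointwise_error h U u t)"
    define \<xi> where "\<xi> = pointwise_error h U u"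
    obtain \<xi>' where eq:
      "\<And>t j. 0 \<le> t \<Longrightarrow> ((\<lambda>s. \<xi> s j) has_real_derivative \<xi>' t j) (at t within {0..})"
      "\<And>t j. 0 \<le> t \<Longrightarrow> ((\<lambda>s. \<xi>' s j) has_real_derivative
         - L_op p \<tau> (\<xi> t) j / h\<^sup>2 + trunc p h U 0 j t) (at t within {0..})"
      "\<And>j. \<xi> 0 j = 0" "\<And>j. \<xi>' 0 j = 0"
      using error_equation[OF p h(1) sol u] unfolding \<xi>_def by blast
    have summ: "summable (\<lambda>j. (\<xi> t j)\<^sup>2)" if "t \<in> {0..T}" for t
      using fin that by (simp add: finite_grid_norm_def \<xi>_def)
    have d1: "((\<lambda>s. \<xi> s j) has_real_derivative \<xi>' t j) (at t within {0..T})" if "t \<in> {0..T}" for t j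
      using that by (intro DERIV_subset[OF eq(1)]) auto
    have d2: "((\<lambda>s. \<xi>' s j) has_real_derivative - L_op p \<tau> (\<xi> t) j / h\<^sup>2 + trunc p h U 0 j t) (at t within {0..T})"
      if "t \<in> {0..T}" for t j
      using that by (intro DERIV_subset[OF eq(2)]) auto
    have solves: "solves_error_equation p \<tau> h U T \<xi>"
      unfolding solves_error_equation_def
      by (intro exI[of _ \<xi>'] conjI allI ballI eq summ d1 d2)
    have bnd: "grid_norm h (\<xi> t) \<le> K * h powr rate p \<tau>" if "t \<in> {0..T}" for t
      unfolding grid_norm_eq by (rule K(2)[OF h solves that])
    have cont: "continuous_on {0..T} (\<lambda>t. \<xi> t j)" for j
      using d1 by (intro DERIV_continuous_on) auto
    show "(\<lambda>t. (grid_norm h (pointwise_error h U u t))\<^sup>2) integrable_on {0..T} \<and>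
     sqrt (integral {0..T} (\<lambda>t. (grid_norm h (pointwise_error h U u t))\<^sup>2)) \<le> sqrt T * K * h powr rate p \<tau>"
      using grid_norm_square_integrable[OF h(1) cont summ bnd T0] by (simp add: \<xi>_def mult.assoc)
  qed
next
  case False
  then show ?thesis by blast
qed

theorem theorem2p1:
  fixes p :: nat and \<tau> :: real
  assumes "p \<in> {1, 2, 3}"
    and "\<tau> \<ge> tau_crit p"
  shows "\<exists>C :: real \<Rightarrow> real \<Rightarrow> (nat \<Rightarrow> nat \<Rightarrow> real \<Rightarrow> real \<Rightarrow> real) \<Rightarrow> real.
    \<forall>\<eta>>0. \<forall>t\<^sub>f>0. \<forall>F f1 f2 g U.
      admissible_data F f1 f2 g \<and> smooth_wave_solution F f1 f2 g U \<longrightarrow>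
      (\<exists>h0>0. \<forall>h u. 0 < h \<and> h < h0 \<and>
         sbp_sat_solution p \<tau> h F f1 f2 g u \<and>
         (\<forall>t\<ge>0. finite_grid_norm (pointwise_error h U u t)) \<longrightarrow>
         (\<lambda>t. (grid_norm h (pointwise_error h U u t))\<^sup>2) integrable_on {0..t\<^sub>f} \<and>
         sqrt (integral {0..t\<^sub>f} (\<lambda>t. (grid_norm h (pointwise_error h U u t))\<^sup>2))
           \<le> C \<eta> t\<^sub>f (\<lambda>i j. partial i j U) * h powr rate p \<tau>)"
proof -
  define P where "P c T U \<longleftrightarrow> (\<forall>F f1 f2 g h u. admissible_data F f1 f2 g \<and> smooth_wave_solution F f1 f2 g U \<and> 0 < h \<and> h < 1 \<and>
     sbp_sat_solution p \<tau> h F f1 f2 g u \<and> (\<forall>t\<ge>0. finite_grid_norm (pointwise_error h U u t)) \<longrightarrow>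
     (\<lambda>t. (grid_norm h (pointwise_error h U u t))\<^sup>2) integrable_on {0..T} \<and>
     sqrt (integral {0..T} (\<lambda>t. (grid_norm h (pointwise_error h U u t))\<^sup>2)) \<le> c * h powr rate p \<tau>)" for c T U
  have "\<exists>c. P c T U" if "0 < T" for T U
    unfolding P_def by (rule convergence_for_solution[OF assms that])
  then have P: "P (SOME c. P c T U) T U" if "0 < T" for T U
    using someI_ex[of "\<lambda>c. P c T U"] that by blast
  show ?thesis
  \<comment> \<open>The order-zero member of the family of derivatives is U itself, so
    \<open>V 0 0\<close> recovers U and the constant may be selected for T and U.\<close>
  proof (intro exI[of _ "\<lambda>\<eta> T V. SOME c. P c T (V 0 0)"] allI impI, elim conjE)
    fix \<eta> T :: real and F f1 f2 g U
    assume "0 < T" and data: "admissible_data F f1 f2 g" "smooth_wave_solution F f1 f2 g U"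
    define c where "c = (SOME c. P c T U)"
    have "P c T U" unfolding c_def by (rule P[OF \<open>0 < T\<close>])
    note c = this[unfolded P_def, rule_format, OF conjI, OF data(1) conjI, OF data(2)]
    show "\<exists>h0>0. \<forall>h u. 0 < h \<and> h < h0 \<and> sbp_sat_solution p \<tau> h F f1 f2 g u \<and>
         (\<forall>t\<ge>0. finite_grid_norm (pointwise_error h U u t)) \<longrightarrow>
         (\<lambda>t. (grid_norm h (pointwise_error h U u t))\<^sup>2) integrable_on {0..T} \<and>
         sqrt (integral {0..T} (\<lambda>t. (grid_norm h (pointwise_error h U u t))\<^sup>2))
           \<le> (SOME c. P c T (partial 0 0 U)) * h powr rate p \<tau>"
      unfolding partial_00 c_def[symmetric]
    proof (intro exI[of _ 1] conjI[OF zero_less_one] allI impI)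
      fix h u
      assume hu: "0 < h \<and> h < 1 \<and> sbp_sat_solution p \<tau> h F f1 f2 g u \<and>
         (\<forall>t\<ge>0. finite_grid_norm (pointwise_error h U u t))"
      show "(\<lambda>t. (grid_norm h (pointwise_error h U u t))\<^sup>2) integrable_on {0..T} \<and>
         sqrt (integral {0..T} (\<lambda>t. (grid_norm h (pointwise_error h U u t))\<^sup>2)) \<le> c * h powr rate p \<tau>"
        by (rule c[OF hu])
    qed
  qed
qed

end
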